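(* Let $n>r\ge1$ be integers, let $\theta_1,\dots,\theta_n$ be positive integers, put $\theta_0:=\sum_{j=1}^n\theta_j$, and assume the parameter $\theta=(\theta_0,-r\theta_1,\dots,-r\theta_n)$ is generic for the dimension vector $\mathbf d=(r,1,\dots,1)$ of the star-shaped quiver with $n$ branches. Suppose $\ell=r$, and let $\mathbf d^\ell$ be a type $(1,\dots,1)$ dimension vector of star-shaped quiver chains, i.e. $r_1=\dots=r_\ell=1$, with branches distributed according to a decomposition $\{1,\dots,n\}=I_1\sqcup\cdots\sqcup I_\ell$, and $n_k:=|I_k|$. Then $$\mathcal M^{\theta^\ell}(Q^\ell,\mathbf d^\ell,\mathcal R^\ell)\cong\mathbb P^{n_2-2}_{\mathbb C}\times\cdots\times\mathbb P^{n_\ell-2}_{\mathbb C}.$$ In particular, if $n_k<2$ for some $k=2,\dots,\ell$, then $\mathcal M^{\theta^\ell}(Q^\ell,\mathbf d^\ell,\mathcal R^\ell)=\varnothing$.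
   Context: The star-shaped quiver $Q$ with $n$ branches has a central vertex $0$ and branch vertices $1,\dots,n$, with one arrow $j\to0$ for each branch $j$. Generic means $\theta\cdot\mathbf d=0$ and $\theta\cdot\mathbf e\ne0$ for every $\mathbf e\in\mathbb N^{Q_0}$ with $\mathbf e\le\mathbf d$ componentwise and $\mathbf e\neq0,\mathbf d$. Star-shaped quiver chains with $\ell$ levels describe the fixed points of the $\mathbb C^*$-action scaling the reversed arrows on the Nakajima quiver variety of $Q$ with dimension vector $\mathbf d$. Level $k$ ($k=1,\dots,\ell$) has a central space $\mathbb C^{r_k}$, with $r_1+\dots+r_\ell=r$, and one-dimensional branch spaces indexed by $j\in I_k$. In type $(1,\dots,1)$ all central spaces are one-dimensional, so a $\mathbf d^\ell$-dimensional representation of the chain quiver $Q^\ell$ amounts to scalars $X_{k,j}$ (from branch $j\in I_k$ of level $k$ to the centre of level $k$), $1\le k\le\ell$, and $Y_{k-1,j}$ (from the centre of level $k-1$ to branch $j\in I_k$ of level $k$), $2\le k\le\ell$. The torus $\operatorname{GL}(\mathbf d^\ell)$ has coordinates $t_{k,0}$ (centres) and $t_{k,j}$, $j\in I_k$ (branches), and acts by $X_{k,j}\mapsto t_{k,0}X_{k,j}t_{k,j}^{-1}$, $Y_{k-1,j}\mapsto t_{k,j}Y_{k-1,j}t_{k-1,0}^{-1}$. The relations $\mathcal R^\ell$ are $\sum_{j\in I_k}X_{k,j}Y_{k-1,j}=0$ for $k=2,\dots,\ell$. The stability parameter $\theta^\ell$ assigns $\theta_0$ to the centre of every level and $-r\theta_j$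 to the branch $j$. The corresponding character of $\operatorname{GL}(\mathbf d^\ell)$ is $\chi(t)=\prod_{k=1}^\ell\bigl(t_{k,0}^{\theta_0}\prod_{j\in I_k}t_{k,j}^{-r\theta_j}\bigr)$. The moduli space without relations is $\mathcal M^{\theta^\ell}(Q^\ell,\mathbf d^\ell)=\operatorname{Proj}\bigoplus_{\eta\ge0}\mathcal O^{\chi^\eta}$, where $\mathcal O$ is the polynomial ring in the $X_{k,j},Y_{k-1,j}$ and $\mathcal O^{\chi^\eta}=\{f\in\mathcal O: f(t\cdot x)=\chi(t)^\eta f(x)\text{ for all }t\in\operatorname{GL}(\mathbf d^\ell)\text{ and all points }x\}$. The moduli space of quiver chains $\mathcal M^{\theta^\ell}(Q^\ell,\mathbf d^\ell,\mathcal R^\ell)$ is the closed subvariety of it cut out by the relations $\mathcal R^\ell$. Conventions: $\mathbb P^m_{\mathbb C}=\varnothing$ for $m<0$; an empty product is a point.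
   Formalization: The isomorphism is stated when the moduli space without relations is non-empty; otherwise it can fail: for r=ℓ=2, n=3, θ_j=1, I_1={1}, I_2={2,3} the moduli space is empty but P^0 is a point. The emptiness claim for n_k<2 is unconditional. *)

theory Defs
  imports
    "HOL-Analysis.Function_Topology"
    "HOL-Library.Poly_Mapping"
    "HOL-Computational_Algebra.Polynomial"
    "HOL-Algebra.Ideal"
begin

section \<open>Spaces with functions\<close>

text \<open>
  Complex varieties are treated classically: a variety is its set of closed points, with the
  Zariski topology and, for each open set, the regular complex-valued functions on it.
  A function belongs to \<open>reg X U\<close> or not according to its values on \<open>U\<close> alone; its values
  elsewhere are irrelevant.
\<close>

record 'a fun_space =
  zar :: "'a topology"
  reg :: "'a set \<Rightarrow> ('a \<Rightarrow> complex) set"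

definition points :: "'a fun_space \<Rightarrow> 'a set" where
  "points X = topspace (zar X)"

definition morphism :: "'a fun_space \<Rightarrow> 'b fun_space \<Rightarrow> ('a \<Rightarrow> 'b) \<Rightarrow> bool" where
  "morphism X Y \<phi> \<longleftrightarrow>
     continuous_map (zar X) (zar Y) \<phi> \<and>
     (\<forall>V h. openin (zar Y) V \<and> h \<in> reg Y V \<longrightarrow> h \<circ> \<phi> \<in> reg X {x \<in> points X. \<phi> x \<in> V})"

definition isomorphic :: "'a fun_space \<Rightarrow> 'b fun_space \<Rightarrow> bool" where
  "isomorphic X Y \<longleftrightarrow>
     (\<exists>\<phi> \<psi>. morphism X Y \<phi> \<and> morphism Y X \<psi> \<and>
        (\<forall>x\<in>points X. \<psi> (\<phi> x) = x) \<and> (\<forall>y\<in>points Y. \<phi> (\<psi> y) = y))"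

definition subvariety :: "'a fun_space \<Rightarrow> 'a set \<Rightarrow> 'a fun_space" where
  "subvariety X Z =
     \<lparr>zar = subtopology (zar X) Z,
      reg = (\<lambda>U. {h. openin (subtopology (zar X) Z) U \<and>
        (\<forall>p\<in>U. \<exists>W g. openin (zar X) W \<and> p \<in> W \<and> g \<in> reg X W \<and> (\<forall>q\<in>W \<inter> U. h q = g q))})\<rparr>"

text \<open>
  The product of varieties, for a finite index set \<open>I\<close>.  On a box \<open>\<Pi> V i\<close> of open sets one has the
  functions in the tensor product of the \<open>reg (X i) (V i)\<close>; their non-vanishing loci form
  a basis of the Zariski topology of the product (which is finer than the product topology), and
  regular functions are locally quotients of such functions.  The scalars \<open>c s\<close> matter
  only for \<open>I = {}\<close>, where the product is a point with all complex constants as functions.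
\<close>

definition tensor_funs ::
    "'i set \<Rightarrow> ('i \<Rightarrow> 'a fun_space) \<Rightarrow> ('i \<Rightarrow> 'a set) \<Rightarrow> (('i \<Rightarrow> 'a) \<Rightarrow> complex) set" where
  "tensor_funs I X V =
     {(\<lambda>x. \<Sum>s<m. c s * (\<Prod>i\<in>I. f s i (x i))) | (m::nat) c f.
        \<forall>s<m. \<forall>i\<in>I. f s i \<in> reg (X i) (V i)}"

definition prod_basic ::
    "'i set \<Rightarrow> ('i \<Rightarrow> 'a set) \<Rightarrow> (('i \<Rightarrow> 'a) \<Rightarrow> complex) \<Rightarrow> ('i \<Rightarrow> 'a) set" where
  "prod_basic I V b = {x \<in> Pi\<^sub>E I V. b x \<noteq> 0}"

definition prod_topology :: "'i set \<Rightarrow> ('i \<Rightarrow> 'a fun_space) \<Rightarrow> ('i \<Rightarrow> 'a) topology" where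
  "prod_topology I X =
     topology_generated_by
       {prod_basic I V b | V b. (\<forall>i\<in>I. openin (zar (X i)) (V i)) \<and> b \<in> tensor_funs I X V}"

definition prod_space :: "'i set \<Rightarrow> ('i \<Rightarrow> 'a fun_space) \<Rightarrow> ('i \<Rightarrow> 'a) fun_space" where
  "prod_space I X =
     \<lparr>zar = prod_topology I X,
      reg = (\<lambda>U. {h. openin (prod_topology I X) U \<and>
        (\<forall>x\<in>U. \<exists>V a b. (\<forall>i\<in>I. openin (zar (X i)) (V i)) \<and>
           a \<in> tensor_funs I X V \<and> b \<in> tensor_funs I X V \<and> x \<in> prod_basic I V b \<and>
           (\<forall>y\<in>U \<inter> prod_basic I V b. h y = a y / b y))})\<rparr>"


section \<open>Polynomial rings over the complex numbers\<close>

text \<open>Finitely supported maps from monomials to coefficients.\<close>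

type_synonym 'v cpoly = "('v \<Rightarrow>\<^sub>0 nat) \<Rightarrow>\<^sub>0 complex"

definition const :: "complex \<Rightarrow> 'v cpoly" where
  "const c = Poly_Mapping.single 0 c"

definition var :: "'v \<Rightarrow> 'v cpoly" where
  "var v = Poly_Mapping.single (Poly_Mapping.single v 1) 1"

definition peval :: "('v \<Rightarrow> complex) \<Rightarrow> 'v cpoly \<Rightarrow> complex" where
  "peval x f =
     (\<Sum>m\<in>Poly_Mapping.keys f.
        Poly_Mapping.lookup f m * (\<Prod>v\<in>Poly_Mapping.keys m. x v ^ Poly_Mapping.lookup m v))"

definition polys :: "'v set \<Rightarrow> 'v cpoly set" where
  "polys V = {f. \<forall>m\<in>Poly_Mapping.keys f. Poly_Mapping.keys m \<subseteq> V}"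

definition ring_on :: "'a::comm_ring_1 set \<Rightarrow> 'a ring" where
  "ring_on A = \<lparr>carrier = A, monoid.mult = (*), one = 1, zero = 0, add = (+)\<rparr>"


section \<open>Proj\<close>

text \<open>
  A graded ring \<open>\<Oplus>\<^sub>d G d\<close> of subspaces of a polynomial ring is realised as the subring
  \<open>\<Oplus>\<^sub>d G d z\<^sup>d\<close> of the ring of univariate polynomials in \<open>z\<close>, so that the sum
  is direct whether or not the \<open>G d\<close> are independent.
\<close>

definition graded_ring :: "(nat \<Rightarrow> 'v cpoly set) \<Rightarrow> 'v cpoly poly ring" where
  "graded_ring G = ring_on {F. \<forall>d. coeff F d \<in> G d}"

definition relevant_prime :: "(nat \<Rightarrow> 'v cpoly set) \<Rightarrow> 'v cpoly poly set \<Rightarrow> bool" where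
  "relevant_prime G p \<longleftrightarrow>
     primeideal p (graded_ring G) \<and>
     (\<forall>F\<in>p. \<forall>d. monom (coeff F d) d \<in> p) \<and>
     \<not> {F \<in> carrier (graded_ring G). coeff F 0 = 0} \<subseteq> p"

definition proj_points :: "(nat \<Rightarrow> 'v cpoly set) \<Rightarrow> 'v cpoly poly set set" where
  "proj_points G = {p. relevant_prime G p \<and> (\<forall>q. relevant_prime G q \<and> p \<subseteq> q \<longrightarrow> q = p)}"

definition proj_topology :: "(nat \<Rightarrow> 'v cpoly set) \<Rightarrow> 'v cpoly poly set topology" where
  "proj_topology G =
     topology_generated_by {{p \<in> proj_points G. monom f d \<notin> p} | d f. 0 < d \<and> f \<in> G d}"

text \<open>
  The maximal elements among the relevant homogeneous primes are the closed points of Proj.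
  The residue field at such a point \<open>q\<close> is the field of complex numbers, and a fraction \<open>g/f\<close>
  with \<open>f\<close>, \<open>g\<close> of degree \<open>d\<close> and \<open>f \<notin> q\<close> has the value \<open>c\<close> at \<open>q\<close> iff \<open>g - c f \<in> q\<close>.
\<close>

definition Proj :: "(nat \<Rightarrow> 'v cpoly set) \<Rightarrow> 'v cpoly poly set fun_space" where
  "Proj G =
     \<lparr>zar = proj_topology G,
      reg = (\<lambda>U. {h. openin (proj_topology G) U \<and>
        (\<forall>p\<in>U. \<exists>W d f g. openin (proj_topology G) W \<and> p \<in> W \<and> W \<subseteq> U \<and> f \<in> G d \<and> g \<in> G d \<and>
           (\<forall>q\<in>W. monom f d \<notin> q \<and> monom (g - const (h q) * f) d \<in> q))})\<rparr>"

text \<open>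
  The closed subvariety of Proj cut out by an ideal \<open>J\<close> of the surrounding polynomial ring, i.e.
  by the homogeneous ideal \<open>\<Oplus>\<^sub>d (J \<inter> G d)\<close>, with its reduced structure.
\<close>

definition proj_closed ::
    "(nat \<Rightarrow> 'v cpoly set) \<Rightarrow> 'v cpoly set \<Rightarrow> 'v cpoly poly set fun_space" where
  "proj_closed G J =
     subvariety (Proj G) {p \<in> points (Proj G). \<forall>d. \<forall>f\<in>G d \<inter> J. monom f d \<in> p}"

definition homogeneous_polys :: "'v set \<Rightarrow> nat \<Rightarrow> 'v cpoly set" where
  "homogeneous_polys V d =
     {f \<in> polys V. \<forall>m\<in>Poly_Mapping.keys f. (\<Sum>v\<in>Poly_Mapping.keys m. Poly_Mapping.lookup m v) = d}"

text \<open>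
  Homogeneous coordinates \<open>x\<^sub>0, \<dots>, x\<^sub>m\<close>; for \<open>m < 0\<close> there are none, and Proj of the
  field of constants is empty.
\<close>

definition proj_space :: "int \<Rightarrow> nat cpoly poly set fun_space" where
  "proj_space m = Proj (homogeneous_polys {i::nat. int i \<le> m})"


section \<open>Star-shaped quiver chains of type (1,...,1)\<close>

text \<open>Vertex 0 is the centre, vertices 1, ..., n are the branches.\<close>

definition generic :: "nat \<Rightarrow> (nat \<Rightarrow> int) \<Rightarrow> (nat \<Rightarrow> nat) \<Rightarrow> bool" where
  "generic n \<theta> d \<longleftrightarrow>
     (\<Sum>v\<le>n. \<theta> v * int (d v)) = 0 \<and>
     (\<forall>e::nat \<Rightarrow> nat. (\<forall>v\<le>n. e v \<le> d v) \<and> (\<exists>v\<le>n. e v \<noteq> 0) \<and> (\<exists>v\<le>n. e v \<noteq> d v) \<longrightarrow>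
        (\<Sum>v\<le>n. \<theta> v * int (e v)) \<noteq> 0)"

definition star_dim :: "nat \<Rightarrow> nat \<Rightarrow> nat" where
  "star_dim r v = (if v = 0 then r else 1)"

text \<open>
  From the positive integers \<open>\<theta>\<^sub>1, \<dots>, \<theta>\<^sub>n\<close> one forms
  \<open>(\<theta>\<^sub>1 + \<dots> + \<theta>\<^sub>n, -r \<theta>\<^sub>1, \<dots>, -r \<theta>\<^sub>n)\<close>.
  The vertex \<open>v\<close> of each level of the chain carries the same weight as the vertex \<open>v\<close> of the star.
\<close>

definition star_stab :: "nat \<Rightarrow> nat \<Rightarrow> (nat \<Rightarrow> int) \<Rightarrow> nat \<Rightarrow> int" where
  "star_stab n r \<theta> v = (if v = 0 then (\<Sum>j=1..n. \<theta> j) else - int r * \<theta> v)"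

text \<open>
  \<open>Xarr k j\<close> goes from branch \<open>j\<close> of level \<open>k\<close> to the centre of level \<open>k\<close>;
  \<open>Yarr k j\<close> goes from the centre of level \<open>k\<close> to branch \<open>j\<close> of level \<open>k + 1\<close>.
\<close>

datatype chain_arrow = Xarr nat nat | Yarr nat nat

definition chain_arrows :: "nat \<Rightarrow> (nat \<Rightarrow> nat set) \<Rightarrow> chain_arrow set" where
  "chain_arrows l I =
     {Xarr k j | k j. k \<in> {1..l} \<and> j \<in> I k} \<union> {Yarr (k - 1) j | k j. k \<in> {2..l} \<and> j \<in> I k}"

text \<open>The torus coordinate \<open>t k 0\<close> belongs to the centre, \<open>t k j\<close> to branch \<open>j\<close> of level \<open>k\<close>.\<close>

definition chain_torus :: "nat \<Rightarrow> (nat \<Rightarrow> nat set) \<Rightarrow> (nat \<Rightarrow> nat \<Rightarrow> complex) set" where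
  "chain_torus l I = {t. \<forall>k\<in>{1..l}. t k 0 \<noteq> 0 \<and> (\<forall>j\<in>I k. t k j \<noteq> 0)}"

fun chain_act ::
    "(nat \<Rightarrow> nat \<Rightarrow> complex) \<Rightarrow> (chain_arrow \<Rightarrow> complex) \<Rightarrow> chain_arrow \<Rightarrow> complex" where
  "chain_act t x (Xarr k j) = t k 0 * x (Xarr k j) * inverse (t k j)"
| "chain_act t x (Yarr k j) = t (k + 1) j * x (Yarr k j) * inverse (t k 0)"

definition chain_char ::
    "nat \<Rightarrow> (nat \<Rightarrow> nat set) \<Rightarrow> (nat \<Rightarrow> int) \<Rightarrow> (nat \<Rightarrow> nat \<Rightarrow> complex) \<Rightarrow> complex" where
  "chain_char l I \<theta> t = (\<Prod>k=1..l. t k 0 powi \<theta> 0 * (\<Prod>j\<in>I k. t k j powi \<theta> j))"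

definition semi_invariants ::
    "nat \<Rightarrow> (nat \<Rightarrow> nat set) \<Rightarrow> (nat \<Rightarrow> int) \<Rightarrow> nat \<Rightarrow> chain_arrow cpoly set" where
  "semi_invariants l I \<theta> \<eta> =
     {f \<in> polys (chain_arrows l I). \<forall>t\<in>chain_torus l I. \<forall>x.
        peval (chain_act t x) f = chain_char l I \<theta> t ^ \<eta> * peval x f}"

definition chain_relation :: "(nat \<Rightarrow> nat set) \<Rightarrow> nat \<Rightarrow> chain_arrow cpoly" where
  "chain_relation I k = (\<Sum>j\<in>I k. var (Xarr k j) * var (Yarr (k - 1) j))"

definition relation_ideal :: "nat \<Rightarrow> (nat \<Rightarrow> nat set) \<Rightarrow> chain_arrow cpoly set" where
  "relation_ideal l I = genideal (ring_on (polys (chain_arrows l I))) (chain_relation I ` {2..l})"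

text \<open>
  For some distributions of the branches there are no semi-invariants of positive weight at all and
  this space is empty: with \<open>l = r\<close> they exist only if
  \<open>k \<theta>\<^sub>0 \<le> r (\<Sum>i\<le>k. \<Sum>j\<in>I i. \<theta>\<^sub>j)\<close> for all \<open>1 \<le> k < l\<close>.
\<close>

definition chain_moduli_free ::
    "nat \<Rightarrow> (nat \<Rightarrow> nat set) \<Rightarrow> (nat \<Rightarrow> int) \<Rightarrow> chain_arrow cpoly poly set fun_space" where
  "chain_moduli_free l I \<theta> = Proj (semi_invariants l I \<theta>)"

definition chain_moduli ::
    "nat \<Rightarrow> (nat \<Rightarrow> nat set) \<Rightarrow> (nat \<Rightarrow> int) \<Rightarrow> chain_arrow cpoly poly set fun_space" where
  "chain_moduli l I \<theta> = proj_closed (semi_invariants l I \<theta>) (relation_ideal l I)"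

end

theory Submission
  imports Defs
    "HOL-Analysis.Continuum_Not_Denumerable"
    "HOL-Computational_Algebra.Fundamental_Theorem_Algebra"
begin

text \<open>
  Distinct monomials are linearly independent functions, so a semi-invariant of weight \<open>\<eta>\<close> is a
  combination of monomials that are semi-invariant of this weight.  For a monomial, the condition at
  the branch \<open>j\<close> of level \<open>k\<close> says that the exponent of \<open>X\<^sub>k\<^sub>,\<^sub>j\<close> is
  \<open>\<eta> r \<theta>\<^sub>j\<close> plus the exponent of \<open>Y\<^sub>k\<^sub>-\<^sub>1\<^sub>,\<^sub>j\<close> (which is absent for
  \<open>k = 1\<close>).  Summing over the branches of a level, the conditions at the centres say that the
  \<open>Y\<close>-exponents of level \<open>k\<close> add up to \<open>\<eta> C\<^sub>k\<close>, where
  \<open>C\<^sub>k = r (\<Sum>i<k. \<Sum>j\<in>I i. \<theta> j) - (k - 1) \<theta>\<^sub>0\<close> is called \<open>excess k\<close> below; at the last centre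
  this is consistent because \<open>l = r\<close>.  Genericity, applied to the subdimension vector with \<open>k - 1\<close>
  at the centre and the branches of the levels below \<open>k\<close>, gives \<open>C\<^sub>k \<noteq> 0\<close> for
  \<open>2 \<le> k \<le> l\<close>, and as soon as there is a non-zero semi-invariant of positive weight, \<open>C\<^sub>k > 0\<close>.

  Hence, up to a monomial in the \<open>X\<close> alone, the semi-invariants of weight \<open>\<eta>\<close> are the
  polynomials in the products \<open>y\<^sub>j = X\<^sub>k\<^sub>,\<^sub>j Y\<^sub>k\<^sub>-\<^sub>1\<^sub>,\<^sub>j\<close> that are homogeneous of degree
  \<open>\<eta> C\<^sub>k\<close> in those of each level \<open>k \<ge> 2\<close>.  So the space without relations is a Segre-Veronese
  embedding of a product of projective spaces, one for each level \<open>k \<ge> 2\<close>, with homogeneous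
  coordinates \<open>y\<^sub>j\<close>, \<open>j \<in> I k\<close>.  The relation of level \<open>k\<close> is the linear form
  \<open>\<Sum>j\<in>I k. y\<^sub>j\<close>, which cuts out a hyperplane of the factor \<open>k\<close>; if \<open>I k\<close> has fewer than two
  elements, this hyperplane is empty.  This is \<open>chain_moduli_hyperplanes\<close>.

  The closed points of Proj are maximal relevant primes, so describing them by coordinates needs a
  Nullstellensatz.  Over the uncountable field of complex numbers, and for graded pieces of finite
  dimension, it has a short proof by counting dimensions (\<open>residue_field_complex\<close>).  It yields
  homogeneous coordinates for all points of Proj of a Segre-Veronese algebra
  (\<open>point_coordinates\<close>), which can locally be chosen to be regular functions
  (\<open>local_coordinates\<close>).  Conversely a map into Proj is a morphism if it is locally given by
  regular coordinates (\<open>morphism_into_Proj\<close>).  These facts apply alike to the moduli space and to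
  the projective spaces, and together with the universal property of products
  (\<open>morphism_into_prod\<close>) they show that dropping the last coordinate of every factor is an
  isomorphism (\<open>hyperplanes_isomorphic\<close>).
\<close>

section \<open>Evaluation of polynomials\<close>

definition mval :: "('v \<Rightarrow> complex) \<Rightarrow> ('v \<Rightarrow>\<^sub>0 nat) \<Rightarrow> complex" where
  "mval x m = (\<Prod>v\<in>Poly_Mapping.keys m. x v ^ Poly_Mapping.lookup m v)"

lemma mval_superset:
  assumes "finite S" "Poly_Mapping.keys m \<subseteq> S"
  shows "mval x m = (\<Prod>v\<in>S. x v ^ Poly_Mapping.lookup m v)"
  unfolding mval_def
  by (rule prod.mono_neutral_left) (use assms in \<open>auto simp: in_keys_iff\<close>)

lemma mval_0 [simp]: "mval x 0 = 1"
  by (simp add: mval_def)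

lemma mval_add: "mval x (m + m') = mval x m * mval x m'"
proof -
  let ?S = "Poly_Mapping.keys m \<union> Poly_Mapping.keys m'"
  have "Poly_Mapping.keys (m + m') \<subseteq> ?S"
    by (rule Poly_Mapping.keys_add)
  then show ?thesis
    by (simp add: mval_superset[of ?S] lookup_add power_add prod.distrib)
qed

lemma mval_single [simp]: "mval x (Poly_Mapping.single v n) = x v ^ n"
  by (simp add: mval_def)

lemma mval_sum: "mval x (sum f S) = (\<Prod>s\<in>S. mval x (f s))"
  by (induction S rule: infinite_finite_induct) (simp_all add: mval_add)

lemma mval_mult_point: "mval (\<lambda>v. x v * y v) m = mval x m * mval y m"
  by (simp add: mval_def power_mult_distrib prod.distrib)

lemma peval_superset:
  assumes "finite S" "Poly_Mapping.keys f \<subseteq> S"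
  shows "peval x f = (\<Sum>m\<in>S. Poly_Mapping.lookup f m * mval x m)"
  unfolding peval_def mval_def[symmetric]
  by (rule sum.mono_neutral_left) (use assms in \<open>auto simp: in_keys_iff\<close>)

lemma peval_0 [simp]: "peval x 0 = 0"
  by (simp add: peval_def)

lemma peval_single [simp]: "peval x (Poly_Mapping.single m c) = c * mval x m"
  by (simp add: peval_superset[of "{m}"])

lemma peval_const [simp]: "peval x (const c) = c"
  by (simp add: const_def)

lemma peval_1 [simp]: "peval x 1 = 1"
  using peval_single[of x 0 1] by (simp del: peval_single)

lemma peval_var [simp]: "peval x (var v) = x v"
  by (simp add: var_def)

lemma peval_add [simp]: "peval x (f + g) = peval x f + peval x g"
proof -
  let ?S = "Poly_Mapping.keys f \<union> Poly_Mapping.keys g"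
  have "Poly_Mapping.keys (f + g) \<subseteq> ?S"
    by (rule Poly_Mapping.keys_add)
  then show ?thesis
    by (simp add: peval_superset[of ?S] lookup_add distrib_right sum.distrib)
qed

lemma peval_sum: "peval x (sum f S) = (\<Sum>s\<in>S. peval x (f s))"
  by (induction S rule: infinite_finite_induct) simp_all

lemma sum_of_monomials:
  "(\<Sum>m\<in>Poly_Mapping.keys f. Poly_Mapping.single m (Poly_Mapping.lookup f m)) = f"
  by (rule poly_mapping_eqI) (simp add: lookup_sum lookup_single when_def in_keys_iff)

lemma peval_mult [simp]: "peval x (f * g) = peval x f * peval x g"
proof -
  let ?s = "\<lambda>f m. Poly_Mapping.single m (Poly_Mapping.lookup f m)"
  have "f * g = (\<Sum>m\<in>Poly_Mapping.keys f. ?s f m) * (\<Sum>m\<in>Poly_Mapping.keys g. ?s g m)"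
    by (simp only: sum_of_monomials)
  then have "peval x (f * g)
      = (\<Sum>m\<in>Poly_Mapping.keys f. \<Sum>m'\<in>Poly_Mapping.keys g. peval x (?s f m) * peval x (?s g m'))"
    by (simp add: sum_product peval_sum mult_single mval_add mult.assoc mult.left_commute)
  then show ?thesis
    unfolding sum_product[symmetric] peval_sum[symmetric] sum_of_monomials .
qed

lemma peval_uminus [simp]: "peval x (- f) = - peval x f"
  by (simp add: eq_neg_iff_add_eq_0 flip: peval_add)

lemma peval_diff [simp]: "peval x (f - g) = peval x f - peval x g"
  by (simp only: diff_conv_add_uminus peval_add peval_uminus)

lemma peval_power [simp]: "peval x (f ^ n) = peval x f ^ n"
  by (induction n) simp_all

lemma const_simps:
  "const 0 = 0" "const 1 = 1" "const (a + b) = const a + const b" "const (- a) = - const a"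
  "const (a - b) = const a - const b" "const (a * b) = const a * const b"
  by (simp_all add: const_def single_add single_diff single_uminus mult_single)

lemma single_eq_const_mult: "Poly_Mapping.single m c = const c * Poly_Mapping.single m 1"
  by (simp add: const_def mult_single)

text \<open>
  Distinct monomials are distinct multiplicative characters of the monoid of points, so Artin's
  argument shows that they are linearly independent: subtracting from the relation at \<open>x y\<close> the
  relation at \<open>x\<close> scaled by one character at \<open>y\<close> makes the relation shorter.
\<close>

lemma monomials_independent:
  assumes "finite S" "\<And>x. (\<Sum>m\<in>S. a m * mval x m) = 0" "m \<in> S"
  shows "a m = 0"
  using assms
proof (induction S arbitrary: a m rule: finite_induct)
  case empty
  then show ?case by simp
next
  case (insert m0 S)
  have other: "a m = 0" if "m \<in> S" for m
  proof -
    have "m \<noteq> m0" using insert.hyps that by blast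
    then obtain v where v: "Poly_Mapping.lookup m v \<noteq> Poly_Mapping.lookup m0 v"
      by (metis poly_mapping_eqI)
    define y :: "_ \<Rightarrow> complex" where "y = (\<lambda>_. 1)(v := 2)"
    have y: "mval y m' = 2 ^ Poly_Mapping.lookup m' v" for m'
    proof -
      have "mval y m' = (\<Prod>u\<in>insert v (Poly_Mapping.keys m'). y u ^ Poly_Mapping.lookup m' u)"
        by (rule mval_superset) auto
      also have "\<dots> = (\<Prod>u\<in>{v}. y u ^ Poly_Mapping.lookup m' u)"
        by (rule prod.mono_neutral_right) (auto simp: y_def)
      finally show ?thesis by (simp add: y_def)
    qed
    have "(\<Sum>m\<in>S. (a m * (mval y m - mval y m0)) * mval x m) = 0" for x
    proof -
      have "(\<Sum>m\<in>insert m0 S. a m * mval (\<lambda>v. x v * y v) m)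
          - mval y m0 * (\<Sum>m\<in>insert m0 S. a m * mval x m) = 0"
        using insert.prems(1) by simp
      then show ?thesis
        using insert.hyps
        by (simp add: mval_mult_point sum_distrib_left algebra_simps sum_subtractf)
    qed
    then have "a m * (mval y m - mval y m0) = 0"
      using insert.IH[of "\<lambda>m. a m * (mval y m - mval y m0)" m] that by blast
    moreover have "(2::complex) ^ i \<noteq> 2 ^ j" if "i \<noteq> j" for i j :: nat
    proof
      assume "(2::complex) ^ i = 2 ^ j"
      then have "of_nat (2 ^ i) = (of_nat (2 ^ j) :: complex)" by simp
      then have "(2::nat) ^ i = 2 ^ j" by (simp only: of_nat_eq_iff)
      with that show False by simp
    qed
    ultimately show ?thesis
      using v by (simp add: y)
  qed
  have "a m0 = 0"
    using insert.prems(1)[of "\<lambda>_. 1"] insert.hyps other by (simp add: mval_def)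
  then show ?case
    using other insert.prems(2) by blast
qed


section \<open>Subrings of commutative rings\<close>

lemma ring_on_simps [simp]:
  "carrier (ring_on A) = A" "x \<otimes>\<^bsub>ring_on A\<^esub> y = x * y" "\<one>\<^bsub>ring_on A\<^esub> = 1"
  "x \<oplus>\<^bsub>ring_on A\<^esub> y = x + y" "\<zero>\<^bsub>ring_on A\<^esub> = 0"
  by (simp_all add: ring_on_def)

lemma cring_ring_on:
  fixes A :: "'a::comm_ring_1 set"
  assumes "0 \<in> A" "1 \<in> A" "\<And>a b. a \<in> A \<Longrightarrow> b \<in> A \<Longrightarrow> a + b \<in> A"
    "\<And>a. a \<in> A \<Longrightarrow> - a \<in> A" "\<And>a b. a \<in> A \<Longrightarrow> b \<in> A \<Longrightarrow> a * b \<in> A"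
  shows "cring (ring_on A)"
proof (rule cringI)
  show "abelian_group (ring_on A)"
  proof (rule abelian_groupI)
    fix x assume "x \<in> carrier (ring_on A)"
    then show "\<exists>y\<in>carrier (ring_on A). y \<oplus>\<^bsub>ring_on A\<^esub> x = \<zero>\<^bsub>ring_on A\<^esub>"
      using assms(4) by (intro bexI[of _ "- x"]) auto
  qed (use assms in \<open>auto simp: algebra_simps\<close>)
  show "comm_monoid (ring_on A)"
    by (rule comm_monoidI) (use assms in \<open>auto simp: algebra_simps\<close>)
qed (auto simp: algebra_simps)

lemma ideal_ring_onI:
  fixes A :: "'a::comm_ring_1 set"
  assumes "cring (ring_on A)" "J \<subseteq> A" "0 \<in> J" "\<And>a b. a \<in> J \<Longrightarrow> b \<in> J \<Longrightarrow> a + b \<in> J"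
    "\<And>a. a \<in> J \<Longrightarrow> - a \<in> J" "\<And>a b. a \<in> A \<Longrightarrow> b \<in> J \<Longrightarrow> a * b \<in> J"
  shows "ideal J (ring_on A)"
proof (rule idealI)
  interpret cring "ring_on A" by fact
  show "ring (ring_on A)" by (rule ring_axioms)
  show "subgroup J (add_monoid (ring_on A))"
  proof (rule subgroup.intro)
    fix x assume x: "x \<in> J"
    have "inv\<^bsub>add_monoid (ring_on A)\<^esub> x = - x"
      using minus_equality[of "- x" x] x assms(2,5) by (auto simp: a_inv_def)
    then show "inv\<^bsub>add_monoid (ring_on A)\<^esub> x \<in> J" using assms(5) x by simp
  qed (use assms in auto)
next
  fix a x assume "a \<in> J" "x \<in> carrier (ring_on A)"
  then show "x \<otimes>\<^bsub>ring_on A\<^esub> a \<in> J" "a \<otimes>\<^bsub>ring_on A\<^esub> x \<in> J"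
    using assms(6)[of x a] by (simp_all add: mult.commute)
qed

lemma ideal_ring_onD:
  fixes A :: "'a::comm_ring_1 set"
  assumes "ideal J (ring_on A)"
  shows "J \<subseteq> A" "0 \<in> J" "\<And>a b. a \<in> J \<Longrightarrow> b \<in> J \<Longrightarrow> a + b \<in> J"
    "\<And>a b. a \<in> A \<Longrightarrow> b \<in> J \<Longrightarrow> a * b \<in> J"
proof -
  interpret ideal J "ring_on A" by fact
  show "J \<subseteq> A" using a_subset by simp
  show "0 \<in> J" using additive_subgroup.zero_closed[OF additive_subgroup_axioms] by simp
  show "\<And>a b. a \<in> J \<Longrightarrow> b \<in> J \<Longrightarrow> a + b \<in> J"
    using additive_subgroup.a_closed[OF additive_subgroup_axioms] by simp
  show "\<And>a b. a \<in> A \<Longrightarrow> b \<in> J \<Longrightarrow> a * b \<in> J" using I_l_closed by simp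
qed

lemma polys_add: "f \<in> polys V \<Longrightarrow> g \<in> polys V \<Longrightarrow> f + g \<in> polys V"
  unfolding polys_def using Poly_Mapping.keys_add[of f g] by blast

lemma polys_mult:
  assumes "f \<in> polys V" "g \<in> polys V"
  shows "f * g \<in> polys V"
proof -
  have "v \<in> V" if m: "m \<in> Poly_Mapping.keys (f * g)" "v \<in> Poly_Mapping.keys m" for m v
  proof -
    from m(1) obtain a b where ab: "m = a + b" "a \<in> Poly_Mapping.keys f" "b \<in> Poly_Mapping.keys g"
      using Poly_Mapping.keys_mult[of f g] by blast
    then have "Poly_Mapping.keys a \<subseteq> V" "Poly_Mapping.keys b \<subseteq> V"
      using assms unfolding polys_def by blast+
    with ab m(2) show "v \<in> V"
      using Poly_Mapping.keys_add[of a b] by blast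
  qed
  then show ?thesis unfolding polys_def by blast
qed

lemma polys_uminus: "f \<in> polys V \<Longrightarrow> - f \<in> polys V"
  by (simp add: polys_def)

lemma polys_0: "0 \<in> polys V" and polys_1: "1 \<in> polys V"
  by (simp_all add: polys_def)

lemma cring_polys: "cring (ring_on (polys V))"
  by (rule cring_ring_on) (auto intro: polys_add polys_mult polys_uminus polys_0 polys_1)

lemma genideal_vanishes:
  assumes "S \<subseteq> polys V" "\<And>f. f \<in> S \<Longrightarrow> peval x f = 0" "f \<in> genideal (ring_on (polys V)) S"
  shows "peval x f = 0"
proof -
  interpret cring "ring_on (polys V)" by (rule cring_polys)
  have "ideal {f \<in> polys V. peval x f = 0} (ring_on (polys V))"
    by (rule ideal_ring_onI[OF cring_polys])
      (use polys_0 in \<open>auto intro: polys_add polys_mult polys_uminus\<close>)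
  moreover have "S \<subseteq> {f \<in> polys V. peval x f = 0}"
    using assms by auto
  ultimately show ?thesis
    using genideal_minimal assms(3) by blast
qed


section \<open>Spaces with functions that behave like varieties\<close>

text \<open>
  The properties of the sheaf of regular functions on a variety that the proof uses.  Since
  \<open>reg_local\<close> compares values only, it expresses restriction, gluing and the irrelevance of the
  values outside the open set all at once.
\<close>

locale function_sheaf =
  fixes X :: "'a fun_space"
  assumes reg_open: "h \<in> reg X U \<Longrightarrow> openin (zar X) U"
    and reg_local: "\<lbrakk>openin (zar X) U;
      \<And>x. x \<in> U \<Longrightarrow> \<exists>V g. openin (zar X) V \<and> x \<in> V \<and> g \<in> reg X V \<and> (\<forall>y\<in>U \<inter> V. h y = g y)\<rbrakk>
      \<Longrightarrow> h \<in> reg X U"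
    and reg_const: "openin (zar X) U \<Longrightarrow> (\<lambda>_. c) \<in> reg X U"
    and reg_add: "\<lbrakk>h \<in> reg X U; h' \<in> reg X U\<rbrakk> \<Longrightarrow> (\<lambda>x. h x + h' x) \<in> reg X U"
    and reg_mult: "\<lbrakk>h \<in> reg X U; h' \<in> reg X U\<rbrakk> \<Longrightarrow> (\<lambda>x. h x * h' x) \<in> reg X U"
    and reg_inverse: "h \<in> reg X U \<Longrightarrow> (\<lambda>x. inverse (h x)) \<in> reg X {x \<in> U. h x \<noteq> 0}"
begin

lemma reg_restrict:
  assumes "g \<in> reg X V" "openin (zar X) U" "U \<subseteq> V" "\<And>y. y \<in> U \<Longrightarrow> h y = g y"
  shows "h \<in> reg X U"
  using assms reg_open[OF assms(1)] by (intro reg_local) auto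

lemma reg_subset: "g \<in> reg X V \<Longrightarrow> openin (zar X) U \<Longrightarrow> U \<subseteq> V \<Longrightarrow> g \<in> reg X U"
  by (rule reg_restrict[OF _ _ _ refl])

lemma openin_nonzero: "h \<in> reg X U \<Longrightarrow> openin (zar X) {x \<in> U. h x \<noteq> 0}"
  by (rule reg_open[OF reg_inverse])

lemma reg_sum:
  assumes "openin (zar X) U" "\<And>s. s \<in> S \<Longrightarrow> f s \<in> reg X U"
  shows "(\<lambda>x. \<Sum>s\<in>S. f s x) \<in> reg X U"
  using assms(2) by (induction S rule: infinite_finite_induct) (auto intro: reg_const reg_add assms(1))

lemma reg_prod:
  assumes "openin (zar X) U" "\<And>s. s \<in> S \<Longrightarrow> f s \<in> reg X U"
  shows "(\<lambda>x. \<Prod>s\<in>S. f s x) \<in> reg X U"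
  using assms(2) by (induction S rule: infinite_finite_induct) (auto intro: reg_const reg_mult assms(1))

lemma reg_power:
  assumes "h \<in> reg X U"
  shows "(\<lambda>x. h x ^ n) \<in> reg X U"
  by (induction n) (auto intro: reg_const reg_mult assms reg_open[OF assms])

lemma reg_uminus: "h \<in> reg X U \<Longrightarrow> (\<lambda>x. - h x) \<in> reg X U"
  using reg_mult[OF reg_const[OF reg_open, of h U "-1"]] by simp

lemma reg_divide:
  assumes "g \<in> reg X U" "h \<in> reg X U" "\<And>x. x \<in> U \<Longrightarrow> h x \<noteq> 0"
  shows "(\<lambda>x. g x / h x) \<in> reg X U"
proof -
  have "{x \<in> U. h x \<noteq> 0} = U" using assms(3) by blast
  with reg_inverse[OF assms(2)] have "(\<lambda>x. inverse (h x)) \<in> reg X U" by simp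
  from reg_mult[OF assms(1) this] show ?thesis by (simp add: divide_inverse)
qed

lemma reg_peval:
  assumes "openin (zar X) U" "\<And>v. e v \<in> reg X U"
  shows "(\<lambda>x. peval (\<lambda>v. e v x) f) \<in> reg X U"
  unfolding peval_def
  by (intro reg_sum reg_mult reg_const reg_prod reg_power assms)

end

lemma openin_preimage:
  "morphism X Y \<phi> \<Longrightarrow> openin (zar Y) V \<Longrightarrow> openin (zar X) {x \<in> points X. \<phi> x \<in> V}"
  unfolding morphism_def points_def by (blast intro: openin_continuous_map_preimage)

lemma reg_preimage:
  "morphism X Y \<phi> \<Longrightarrow> openin (zar Y) V \<Longrightarrow> h \<in> reg Y V \<Longrightarrow>
    (\<lambda>x. h (\<phi> x)) \<in> reg X {x \<in> points X. \<phi> x \<in> V}"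
  unfolding morphism_def o_def by blast


subsection \<open>Closed subvarieties\<close>

lemma subvariety_simps:
  "zar (subvariety X Z) = subtopology (zar X) Z" "points (subvariety X Z) = points X \<inter> Z"
  by (simp_all add: subvariety_def points_def)

lemma reg_subvariety:
  "h \<in> reg (subvariety X Z) U \<longleftrightarrow> openin (subtopology (zar X) Z) U \<and>
    (\<forall>p\<in>U. \<exists>W g. openin (zar X) W \<and> p \<in> W \<and> g \<in> reg X W \<and> (\<forall>q\<in>W \<inter> U. h q = g q))"
  by (simp add: subvariety_def)

lemma openin_subtopology_inter:
  "openin (subtopology T Z) U \<Longrightarrow> openin T W \<Longrightarrow> openin (subtopology T Z) (U \<inter> W)"
  unfolding openin_subtopology by (metis Int_assoc Int_commute openin_Int)

lemma function_sheaf_subvariety: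
  assumes "function_sheaf X"
  shows "function_sheaf (subvariety X Z)"
proof -
  interpret function_sheaf X by fact
  show ?thesis
  proof
    fix h U assume "h \<in> reg (subvariety X Z) U"
    then show "openin (zar (subvariety X Z)) U"
      by (simp add: reg_subvariety subvariety_simps)
  next
    fix U h
    assume U: "openin (zar (subvariety X Z)) U"
      and loc: "\<And>x. x \<in> U \<Longrightarrow> \<exists>V g. openin (zar (subvariety X Z)) V \<and> x \<in> V \<and>
        g \<in> reg (subvariety X Z) V \<and> (\<forall>y\<in>U \<inter> V. h y = g y)"
    have "\<exists>W g. openin (zar X) W \<and> p \<in> W \<and> g \<in> reg X W \<and> (\<forall>q\<in>W \<inter> U. h q = g q)" if p: "p \<in> U" for p
    proof -
      from loc[OF p] obtain V g where V: "openin (subtopology (zar X) Z) V" "p \<in> V"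
        "g \<in> reg (subvariety X Z) V" "\<forall>y\<in>U \<inter> V. h y = g y"
        unfolding subvariety_simps by blast
      from V(2,3) obtain W g' where W: "openin (zar X) W" "p \<in> W" "g' \<in> reg X W"
        "\<forall>q\<in>W \<inter> V. g q = g' q"
        unfolding reg_subvariety by blast
      from V(1) obtain V' where V': "openin (zar X) V'" "V = V' \<inter> Z"
        unfolding openin_subtopology by blast
      have "U \<subseteq> Z" using U unfolding subvariety_simps openin_subtopology by blast
      have "g' \<in> reg X (W \<inter> V')"
        using W(1,3) V'(1) by (intro reg_restrict[OF W(3)]) auto
      moreover have "\<forall>q\<in>(W \<inter> V') \<inter> U. h q = g' q"
        using V(4) W(4) V'(2) \<open>U \<subseteq> Z\<close> by auto
      ultimately show ?thesis
        using W(1,2) V(2) V' by (intro exI[of _ "W \<inter> V'"] exI[of _ g']) auto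
    qed
    with U show "h \<in> reg (subvariety X Z) U"
      by (simp add: reg_subvariety subvariety_simps)
  next
    fix U c assume "openin (zar (subvariety X Z)) U"
    then show "(\<lambda>_. c) \<in> reg (subvariety X Z) U"
      unfolding reg_subvariety subvariety_simps openin_subtopology using reg_const by blast
  next
    fix U h h' assume h: "h \<in> reg (subvariety X Z) U" "h' \<in> reg (subvariety X Z) U"
    have loc: "\<exists>W g g'. openin (zar X) W \<and> p \<in> W \<and> g \<in> reg X W \<and> g' \<in> reg X W \<and>
        (\<forall>q\<in>W \<inter> U. h q = g q \<and> h' q = g' q)" if "p \<in> U" for p
    proof -
      from h(1) that obtain W g where W: "openin (zar X) W" "p \<in> W" "g \<in> reg X W" "\<forall>q\<in>W \<inter> U. h q = g q"
        unfolding reg_subvariety by blast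
      from h(2) that obtain W' g' where W': "openin (zar X) W'" "p \<in> W'" "g' \<in> reg X W'"
          "\<forall>q\<in>W' \<inter> U. h' q = g' q"
        unfolding reg_subvariety by blast
      show ?thesis
        using W W'
        by (intro exI[of _ "W \<inter> W'"] exI[of _ g] exI[of _ g'])
          (auto intro: reg_restrict[OF W(3)] reg_restrict[OF W'(3)])
    qed
    have "\<exists>W g. openin (zar X) W \<and> p \<in> W \<and> g \<in> reg X W \<and> (\<forall>q\<in>W \<inter> U. h q + h' q = g q)"
      "\<exists>W g. openin (zar X) W \<and> p \<in> W \<and> g \<in> reg X W \<and> (\<forall>q\<in>W \<inter> U. h q * h' q = g q)"
      if p: "p \<in> U" for p
    proof -
      obtain W g g' where W: "openin (zar X) W" "p \<in> W" "g \<in> reg X W" "g' \<in> reg X W"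
        "\<forall>q\<in>W \<inter> U. h q = g q \<and> h' q = g' q"
        using loc[OF p] by blast
      show "\<exists>W g. openin (zar X) W \<and> p \<in> W \<and> g \<in> reg X W \<and> (\<forall>q\<in>W \<inter> U. h q + h' q = g q)"
        using W reg_add[OF W(3,4)] by (intro exI[of _ W] exI[of _ "\<lambda>x. g x + g' x"]) simp
      show "\<exists>W g. openin (zar X) W \<and> p \<in> W \<and> g \<in> reg X W \<and> (\<forall>q\<in>W \<inter> U. h q * h' q = g q)"
        using W reg_mult[OF W(3,4)] by (intro exI[of _ W] exI[of _ "\<lambda>x. g x * g' x"]) simp
    qed
    then show "(\<lambda>x. h x + h' x) \<in> reg (subvariety X Z) U" "(\<lambda>x. h x * h' x) \<in> reg (subvariety X Z) U"
      using h(1) unfolding reg_subvariety by blast+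
  next
    fix U h assume h: "h \<in> reg (subvariety X Z) U"
    let ?U = "{x \<in> U. h x \<noteq> 0}"
    have loc: "\<exists>W g. openin (zar X) W \<and> p \<in> W \<and> (\<lambda>x. inverse (g x)) \<in> reg X W \<and>
        (\<forall>q\<in>W \<inter> U. h q = g q \<and> h q \<noteq> 0)" if p: "p \<in> ?U" for p
    proof -
      from h p obtain W g where W: "openin (zar X) W" "p \<in> W" "g \<in> reg X W" "\<forall>q\<in>W \<inter> U. h q = g q"
        unfolding reg_subvariety by blast
      show ?thesis
        using W p
        by (intro exI[of _ "{x\<in>W. g x \<noteq> 0}"] exI[of _ g])
          (auto intro: openin_nonzero[OF W(3)] reg_inverse[OF W(3)])
    qed
    have "openin (subtopology (zar X) Z) ?U"
    proof (subst openin_subopen, safe)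
      fix p assume p: "p \<in> U" "h p \<noteq> 0"
      then obtain W g where W: "openin (zar X) W" "p \<in> W" "\<forall>q\<in>W \<inter> U. h q = g q \<and> h q \<noteq> 0"
        using loc[of p] by blast
      have "openin (subtopology (zar X) Z) (U \<inter> W)"
        using h W(1) by (intro openin_subtopology_inter) (auto simp: reg_subvariety)
      moreover have "U \<inter> W \<subseteq> ?U" using W(3) by auto
      ultimately show "\<exists>T. openin (subtopology (zar X) Z) T \<and> p \<in> T \<and> T \<subseteq> ?U"
        using p(1) W(2) by blast
    qed
    moreover have "\<exists>W g. openin (zar X) W \<and> p \<in> W \<and> g \<in> reg X W \<and> (\<forall>q\<in>W \<inter> ?U. inverse (h q) = g q)"
      if p: "p \<in> ?U" for p
      using loc[OF p] by (elim exE conjE) (rule exI, rule exI[of _ "\<lambda>x. inverse (_ x)"], auto)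
    ultimately show "(\<lambda>x. inverse (h x)) \<in> reg (subvariety X Z) ?U"
      unfolding reg_subvariety by blast
  qed
qed

lemma reg_restrict_subvariety:
  "openin (zar X) W \<Longrightarrow> g \<in> reg X W \<Longrightarrow> g \<in> reg (subvariety X Z) (W \<inter> Z)"
  unfolding reg_subvariety openin_subtopology by blast

text \<open>
  A regular function on a subvariety is locally the restriction of one on the ambient space, and the
  pullbacks of these restrictions glue.
\<close>

lemma morphism_into_subvariety:
  assumes "function_sheaf X" "morphism X Y \<phi>" "\<And>x. x \<in> points X \<Longrightarrow> \<phi> x \<in> Z"
  shows "morphism X (subvariety Y Z) \<phi>"
  unfolding morphism_def
proof (intro conjI allI impI)
  interpret function_sheaf X by fact
  show cont: "continuous_map (zar X) (zar (subvariety Y Z)) \<phi>"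
    using assms(2,3) by (auto simp: morphism_def subvariety_simps continuous_map_in_subtopology points_def)
  fix V h assume V: "openin (zar (subvariety Y Z)) V \<and> h \<in> reg (subvariety Y Z) V"
  show "h \<circ> \<phi> \<in> reg X {x \<in> points X. \<phi> x \<in> V}"
  proof (rule reg_local)
    show "openin (zar X) {x \<in> points X. \<phi> x \<in> V}"
      unfolding points_def by (rule openin_continuous_map_preimage[OF cont]) (use V in blast)
    fix x assume x: "x \<in> {x \<in> points X. \<phi> x \<in> V}"
    with V obtain W g where W: "openin (zar Y) W" "\<phi> x \<in> W" "g \<in> reg Y W" "\<forall>q\<in>W \<inter> V. h q = g q"
      unfolding reg_subvariety by blast
    show "\<exists>U g. openin (zar X) U \<and> x \<in> U \<and> g \<in> reg X U \<and>
        (\<forall>y\<in>{x \<in> points X. \<phi> x \<in> V} \<inter> U. (h \<circ> \<phi>) y = g y)"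
      using openin_preimage[OF assms(2) W(1)] reg_preimage[OF assms(2) W(1,3)] x W(2,4)
      by (intro exI[of _ "{x \<in> points X. \<phi> x \<in> W}"] exI[of _ "\<lambda>x. g (\<phi> x)"]) auto
  qed
qed


subsection \<open>Products\<close>

locale sheaf_family =
  fixes I :: "'i set" and X :: "'i \<Rightarrow> 'a fun_space"
  assumes finite_index: "finite I"
    and sheaf: "i \<in> I \<Longrightarrow> function_sheaf (X i)"
begin

abbreviation open_box :: "('i \<Rightarrow> 'a set) \<Rightarrow> bool" where
  "open_box V \<equiv> \<forall>i\<in>I. openin (zar (X i)) (V i)"

lemma open_box_Int: "open_box V \<Longrightarrow> open_box V' \<Longrightarrow> open_box (\<lambda>i. V i \<inter> V' i)"
  by auto

lemma tensor_single:
  "(\<And>i. i \<in> I \<Longrightarrow> f i \<in> reg (X i) (V i)) \<Longrightarrow> (\<lambda>x. c * (\<Prod>i\<in>I. f i (x i))) \<in> tensor_funs I X V"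
  unfolding tensor_funs_def
  by (rule CollectI, rule exI[of _ "1::nat"], rule exI[of _ "\<lambda>_. c"], rule exI[of _ "\<lambda>_. f"]) auto

lemma tensor_const: "open_box V \<Longrightarrow> (\<lambda>_. c) \<in> tensor_funs I X V"
  using tensor_single[of "\<lambda>_ _. 1" V c] function_sheaf.reg_const[OF sheaf] by simp

lemma tensor_add:
  assumes "a \<in> tensor_funs I X V" "b \<in> tensor_funs I X V"
  shows "(\<lambda>x. a x + b x) \<in> tensor_funs I X V"
proof -
  from assms(1) obtain m :: nat and c f where a: "a = (\<lambda>x. \<Sum>s<m. c s * (\<Prod>i\<in>I. f s i (x i)))"
    "\<forall>s<m. \<forall>i\<in>I. f s i \<in> reg (X i) (V i)"
    unfolding tensor_funs_def by blast
  from assms(2) obtain m' :: nat and c' f' where b: "b = (\<lambda>x. \<Sum>s<m'. c' s * (\<Prod>i\<in>I. f' s i (x i)))"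
    "\<forall>s<m'. \<forall>i\<in>I. f' s i \<in> reg (X i) (V i)"
    unfolding tensor_funs_def by blast
  have concat: "(\<Sum>s<m + k. if s < m then p s else q (s - m)) = (\<Sum>s<m. p s) + (\<Sum>s<k. q s)"
    for p q :: "nat \<Rightarrow> complex" and k
    by (induction k) simp_all
  let ?c = "\<lambda>s. if s < m then c s else c' (s - m)" and ?f = "\<lambda>s. if s < m then f s else f' (s - m)"
  have "(\<lambda>x. a x + b x) = (\<lambda>x. \<Sum>s<m + m'. ?c s * (\<Prod>i\<in>I. ?f s i (x i)))"
    unfolding a(1) b(1) concat[symmetric] by (intro ext sum.cong) auto
  moreover have "\<forall>s<m + m'. \<forall>i\<in>I. ?f s i \<in> reg (X i) (V i)"
    using a(2) b(2) by auto
  ultimately show ?thesis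
    unfolding tensor_funs_def by (intro CollectI exI[of _ "m + m'"] exI[of _ ?c] exI[of _ ?f] conjI)
qed

lemma tensor_sum:
  assumes "open_box V" "\<And>s. s \<in> S \<Longrightarrow> f s \<in> tensor_funs I X V"
  shows "(\<lambda>x. \<Sum>s\<in>S. f s x) \<in> tensor_funs I X V"
  using assms(2) tensor_const[OF assms(1), of 0]
  by (induction S rule: infinite_finite_induct) (auto intro: tensor_add)

lemma tensor_mult:
  assumes "open_box V" "a \<in> tensor_funs I X V" "b \<in> tensor_funs I X V"
  shows "(\<lambda>x. a x * b x) \<in> tensor_funs I X V"
proof -
  from assms(2) obtain m :: nat and c f where a: "a = (\<lambda>x. \<Sum>s<m. c s * (\<Prod>i\<in>I. f s i (x i)))"
    "\<forall>s<m. \<forall>i\<in>I. f s i \<in> reg (X i) (V i)"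
    unfolding tensor_funs_def by blast
  from assms(3) obtain m' :: nat and c' f' where b: "b = (\<lambda>x. \<Sum>s<m'. c' s * (\<Prod>i\<in>I. f' s i (x i)))"
    "\<forall>s<m'. \<forall>i\<in>I. f' s i \<in> reg (X i) (V i)"
    unfolding tensor_funs_def by blast
  have "(\<lambda>x. \<Sum>s<m. \<Sum>t<m'. (c s * c' t) * (\<Prod>i\<in>I. (\<lambda>y. f s i y * f' t i y) (x i))) \<in> tensor_funs I X V"
  proof (intro tensor_sum tensor_single assms(1))
    fix s t i assume "s \<in> {..<m}" "t \<in> {..<m'}" "i \<in> I"
    then show "(\<lambda>y. f s i y * f' t i y) \<in> reg (X i) (V i)"
      using a(2) b(2) by (intro function_sheaf.reg_mult[OF sheaf]) auto
  qed
  moreover have "(\<lambda>x. a x * b x)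
      = (\<lambda>x. \<Sum>s<m. \<Sum>t<m'. (c s * c' t) * (\<Prod>i\<in>I. (\<lambda>y. f s i y * f' t i y) (x i)))"
    unfolding a(1) b(1) by (simp only: sum_product prod.distrib mult.assoc mult.left_commute)
  ultimately show ?thesis by simp
qed

lemma tensor_restrict:
  assumes "a \<in> tensor_funs I X V" "open_box V'" "\<And>i. i \<in> I \<Longrightarrow> V' i \<subseteq> V i"
  shows "a \<in> tensor_funs I X V'"
proof -
  from assms(1) obtain m :: nat and c f where a: "a = (\<lambda>x. \<Sum>s<m. c s * (\<Prod>i\<in>I. f s i (x i)))"
    "\<forall>s<m. \<forall>i\<in>I. f s i \<in> reg (X i) (V i)"
    unfolding tensor_funs_def by blast
  have "f s i \<in> reg (X i) (V' i)" if "s < m" "i \<in> I" for s i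
    using function_sheaf.reg_subset[OF sheaf, of i "f s i" "V i" "V' i"] a(2) assms(2,3) that by blast
  then show ?thesis
    unfolding a(1) by (intro tensor_sum tensor_single assms(2)) auto
qed

lemma tensor_coordinate:
  assumes "open_box V" "i \<in> I" "g \<in> reg (X i) (V i)"
  shows "(\<lambda>x. g (x i)) \<in> tensor_funs I X V"
proof -
  have "(\<lambda>x. 1 * (\<Prod>j\<in>I. (if j = i then g else (\<lambda>_. 1)) (x j))) \<in> tensor_funs I X V"
    using assms by (intro tensor_single) (auto intro: function_sheaf.reg_const[OF sheaf])
  moreover have "(\<Prod>j\<in>I. (if j = i then g else (\<lambda>_. 1)) (x j)) = g (x i)" for x
  proof -
    have "(\<Prod>j\<in>I. (if j = i then g else (\<lambda>_. 1)) (x j)) = (\<Prod>j\<in>I. if j = i then g (x j) else 1)"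
      by (rule prod.cong) auto
    then show ?thesis using assms(2) finite_index by simp
  qed
  ultimately show ?thesis by simp
qed

lemma prod_basic_Int:
  "prod_basic I V b \<inter> prod_basic I V' b' = prod_basic I (\<lambda>i. V i \<inter> V' i) (\<lambda>x. b x * b' x)"
  by (auto simp: prod_basic_def PiE_iff)

lemma zar_prod: "zar (prod_space I X) = prod_topology I X"
  by (simp add: prod_space_def)

lemma openin_prod_basic:
  "open_box V \<Longrightarrow> b \<in> tensor_funs I X V \<Longrightarrow> openin (prod_topology I X) (prod_basic I V b)"
  unfolding prod_topology_def by (rule topology_generated_by_Basis) blast

text \<open>
  The defining sets of the product topology are closed under intersections, by intersecting the boxes
  and multiplying the functions, so they form a basis.
\<close>

lemma prod_topology_base:
  assumes "openin (prod_topology I X) U" "x \<in> U"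
  shows "\<exists>V b. open_box V \<and> b \<in> tensor_funs I X V \<and> x \<in> prod_basic I V b \<and> prod_basic I V b \<subseteq> U"
proof -
  have "generate_topology_on {prod_basic I V b | V b. open_box V \<and> b \<in> tensor_funs I X V} U"
    using assms(1) unfolding prod_topology_def by (rule openin_topology_generated_by)
  then show ?thesis
    using assms(2)
  proof (induction arbitrary: x rule: generate_topology_on.induct)
    case (Int U U')
    from Int.IH(1)[of x] Int.prems obtain V b
      where V: "open_box V" "b \<in> tensor_funs I X V" "x \<in> prod_basic I V b" "prod_basic I V b \<subseteq> U"
      by auto
    from Int.IH(2)[of x] Int.prems obtain V' b'
      where V': "open_box V'" "b' \<in> tensor_funs I X V'" "x \<in> prod_basic I V' b'" "prod_basic I V' b' \<subseteq> U'"
      by auto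
    have box: "open_box (\<lambda>i. V i \<inter> V' i)"
      by (rule open_box_Int[OF V(1) V'(1)])
    moreover have "(\<lambda>x. b x * b' x) \<in> tensor_funs I X (\<lambda>i. V i \<inter> V' i)"
      by (intro tensor_mult box tensor_restrict[OF V(2) box] tensor_restrict[OF V'(2) box]) auto
    moreover have "x \<in> prod_basic I (\<lambda>i. V i \<inter> V' i) (\<lambda>x. b x * b' x)"
        "prod_basic I (\<lambda>i. V i \<inter> V' i) (\<lambda>x. b x * b' x) \<subseteq> U \<inter> U'"
      unfolding prod_basic_Int[symmetric] using V V' by auto
    ultimately show ?case
      by (intro exI[of _ "\<lambda>i. V i \<inter> V' i"] exI[of _ "\<lambda>x. b x * b' x"] conjI)
  next
    case (UN K)
    then obtain U where U: "U \<in> K" "x \<in> U" by blast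
    from UN.IH[OF U] obtain V b
      where "open_box V" "b \<in> tensor_funs I X V" "x \<in> prod_basic I V b" "prod_basic I V b \<subseteq> U"
      by blast
    moreover from this(4) U(1) have "prod_basic I V b \<subseteq> \<Union>K" by blast
    ultimately show ?case by blast
  qed auto
qed

lemma points_prod: "points (prod_space I X) = (\<Pi>\<^sub>E i\<in>I. points (X i))"
proof
  have "prod_basic I V b \<subseteq> (\<Pi>\<^sub>E i\<in>I. points (X i))" if "open_box V" for V b
  proof -
    have "V i \<subseteq> points (X i)" if "i \<in> I" for i
      using \<open>open_box V\<close> that openin_subset unfolding points_def by blast
    then show ?thesis
      unfolding prod_basic_def using PiE_mono[of I V "\<lambda>i. points (X i)"] by blast
  qed
  then show "points (prod_space I X) \<subseteq> (\<Pi>\<^sub>E i\<in>I. points (X i))"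
    unfolding points_def zar_prod prod_topology_def topology_generated_by_topspace by blast
  have "openin (prod_topology I X) (prod_basic I (\<lambda>i. points (X i)) (\<lambda>_. 1))"
    by (intro openin_prod_basic tensor_const) (auto simp: points_def)
  then show "(\<Pi>\<^sub>E i\<in>I. points (X i)) \<subseteq> points (prod_space I X)"
    using openin_subset[of "prod_topology I X"] unfolding zar_prod points_def by (auto simp: prod_basic_def)
qed

lemma reg_prod_iff:
  "h \<in> reg (prod_space I X) U \<longleftrightarrow> openin (prod_topology I X) U \<and>
     (\<forall>x\<in>U. \<exists>V a b. open_box V \<and> a \<in> tensor_funs I X V \<and> b \<in> tensor_funs I X V \<and>
        x \<in> prod_basic I V b \<and> (\<forall>y\<in>U \<inter> prod_basic I V b. h y = a y / b y))"
  by (simp add: prod_space_def)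

lemma function_sheaf_prod: "function_sheaf (prod_space I X)"
proof
  fix h U assume "h \<in> reg (prod_space I X) U"
  then show "openin (zar (prod_space I X)) U"
    by (simp add: reg_prod_iff zar_prod)
next
  fix U h
  assume U: "openin (zar (prod_space I X)) U"
    and loc: "\<And>x. x \<in> U \<Longrightarrow> \<exists>V g. openin (zar (prod_space I X)) V \<and> x \<in> V \<and>
      g \<in> reg (prod_space I X) V \<and> (\<forall>y\<in>U \<inter> V. h y = g y)"
  have "\<exists>V a b. open_box V \<and> a \<in> tensor_funs I X V \<and> b \<in> tensor_funs I X V \<and>
        x \<in> prod_basic I V b \<and> (\<forall>y\<in>U \<inter> prod_basic I V b. h y = a y / b y)" if x: "x \<in> U" for x
  proof -
    from loc[OF x] obtain W g where W: "openin (prod_topology I X) W" "x \<in> W"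
      "g \<in> reg (prod_space I X) W" "\<forall>y\<in>U \<inter> W. h y = g y"
      unfolding zar_prod by blast
    from W(2,3) obtain V a b where V: "open_box V" "a \<in> tensor_funs I X V" "b \<in> tensor_funs I X V"
      "x \<in> prod_basic I V b" "\<forall>y\<in>W \<inter> prod_basic I V b. g y = a y / b y"
      unfolding reg_prod_iff by blast
    from prod_topology_base[OF W(1,2)] obtain V' b' where V': "open_box V'" "b' \<in> tensor_funs I X V'"
      "x \<in> prod_basic I V' b'" "prod_basic I V' b' \<subseteq> W"
      by blast
    let ?V = "\<lambda>i. V i \<inter> V' i"
    have box: "open_box ?V" by (rule open_box_Int[OF V(1) V'(1)])
    have "(\<lambda>x. a x * b' x) \<in> tensor_funs I X ?V" "(\<lambda>x. b x * b' x) \<in> tensor_funs I X ?V"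
      by (intro tensor_mult box tensor_restrict[OF V(2) box] tensor_restrict[OF V(3) box]
          tensor_restrict[OF V'(2) box]; auto)+
    moreover have "x \<in> prod_basic I ?V (\<lambda>x. b x * b' x)"
      using V(4) V'(3) unfolding prod_basic_Int[symmetric] by blast
    moreover have "h y = (a y * b' y) / (b y * b' y)" if "y \<in> U \<inter> prod_basic I ?V (\<lambda>x. b x * b' x)" for y
    proof -
      have y: "y \<in> U" "y \<in> prod_basic I V b" "y \<in> prod_basic I V' b'"
        using that unfolding prod_basic_Int[symmetric] by auto
      then have "h y = a y / b y" "b' y \<noteq> 0"
        using V(5) V'(4) W(4) by (auto simp: prod_basic_def)
      then show ?thesis by simp
    qed
    ultimately have "open_box ?V \<and> (\<lambda>x. a x * b' x) \<in> tensor_funs I X ?V \<and>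
        (\<lambda>x. b x * b' x) \<in> tensor_funs I X ?V \<and> x \<in> prod_basic I ?V (\<lambda>x. b x * b' x) \<and>
        (\<forall>y\<in>U \<inter> prod_basic I ?V (\<lambda>x. b x * b' x). h y = (a y * b' y) / (b y * b' y))"
      using box by simp
    then show ?thesis
      by (intro exI[of _ ?V] exI)
  qed
  with U show "h \<in> reg (prod_space I X) U"
    by (simp add: reg_prod_iff zar_prod)
next
  fix U c assume U: "openin (zar (prod_space I X)) U"
  have "\<exists>V a b. open_box V \<and> a \<in> tensor_funs I X V \<and> b \<in> tensor_funs I X V \<and>
        x \<in> prod_basic I V b \<and> (\<forall>y\<in>U \<inter> prod_basic I V b. c = a y / b y)" if x: "x \<in> U" for x
  proof -
    have box: "open_box (\<lambda>i. points (X i))" by (simp add: points_def)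
    have "x \<in> prod_basic I (\<lambda>i. points (X i)) (\<lambda>_. 1)"
      using x openin_subset[OF U] points_prod by (auto simp: prod_basic_def points_def)
    then show ?thesis
      using box tensor_const[OF box, of c] tensor_const[OF box, of 1]
      by (intro exI[of _ "\<lambda>i. points (X i)"] exI[of _ "\<lambda>_. c"] exI[of _ "\<lambda>_. 1"]) auto
  qed
  with U show "(\<lambda>_. c) \<in> reg (prod_space I X) U"
    by (simp add: reg_prod_iff zar_prod)
next
  fix U h h' assume h: "h \<in> reg (prod_space I X) U" "h' \<in> reg (prod_space I X) U"
  have loc: "\<exists>V a a' b b'. open_box V \<and> a \<in> tensor_funs I X V \<and> b \<in> tensor_funs I X V \<and>
        a' \<in> tensor_funs I X V \<and> b' \<in> tensor_funs I X V \<and> x \<in> prod_basic I V (\<lambda>y. b y * b' y) \<and>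
        (\<forall>y\<in>U \<inter> prod_basic I V (\<lambda>y. b y * b' y).
          h y = a y / b y \<and> h' y = a' y / b' y \<and> b y \<noteq> 0 \<and> b' y \<noteq> 0)" if x: "x \<in> U" for x
  proof -
    from h(1) x obtain V a b where V: "open_box V" "a \<in> tensor_funs I X V" "b \<in> tensor_funs I X V"
      "x \<in> prod_basic I V b" "\<forall>y\<in>U \<inter> prod_basic I V b. h y = a y / b y"
      unfolding reg_prod_iff by blast
    from h(2) x obtain V' a' b' where V': "open_box V'" "a' \<in> tensor_funs I X V'" "b' \<in> tensor_funs I X V'"
      "x \<in> prod_basic I V' b'" "\<forall>y\<in>U \<inter> prod_basic I V' b'. h' y = a' y / b' y"
      unfolding reg_prod_iff by blast
    let ?V = "\<lambda>i. V i \<inter> V' i"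
    have box: "open_box ?V" by (rule open_box_Int[OF V(1) V'(1)])
    have "a \<in> tensor_funs I X ?V" "b \<in> tensor_funs I X ?V" "a' \<in> tensor_funs I X ?V" "b' \<in> tensor_funs I X ?V"
      by (auto intro: tensor_restrict[OF V(2) box] tensor_restrict[OF V(3) box]
          tensor_restrict[OF V'(2) box] tensor_restrict[OF V'(3) box])
    moreover have "x \<in> prod_basic I ?V (\<lambda>y. b y * b' y)"
      using V(4) V'(4) unfolding prod_basic_Int[symmetric] by blast
    moreover have "h y = a y / b y \<and> h' y = a' y / b' y \<and> b y \<noteq> 0 \<and> b' y \<noteq> 0"
      if "y \<in> U \<inter> prod_basic I ?V (\<lambda>y. b y * b' y)" for y
      using that V(5) V'(5) unfolding prod_basic_Int[symmetric] by (auto simp: prod_basic_def)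
    ultimately have "open_box ?V \<and> a \<in> tensor_funs I X ?V \<and> b \<in> tensor_funs I X ?V \<and>
        a' \<in> tensor_funs I X ?V \<and> b' \<in> tensor_funs I X ?V \<and> x \<in> prod_basic I ?V (\<lambda>y. b y * b' y) \<and>
        (\<forall>y\<in>U \<inter> prod_basic I ?V (\<lambda>y. b y * b' y).
          h y = a y / b y \<and> h' y = a' y / b' y \<and> b y \<noteq> 0 \<and> b' y \<noteq> 0)"
      using box by simp
    then show ?thesis
      by (intro exI[of _ ?V] exI)
  qed
  show "(\<lambda>x. h x + h' x) \<in> reg (prod_space I X) U"
    unfolding reg_prod_iff
  proof (intro conjI ballI)
    show "openin (prod_topology I X) U" using h(1) unfolding reg_prod_iff by blast
    fix x assume "x \<in> U"
    from loc[OF this] obtain V a a' b b' where V: "open_box V" "a \<in> tensor_funs I X V" "b \<in> tensor_funs I X V"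
      "a' \<in> tensor_funs I X V" "b' \<in> tensor_funs I X V" "x \<in> prod_basic I V (\<lambda>y. b y * b' y)"
      "\<forall>y\<in>U \<inter> prod_basic I V (\<lambda>y. b y * b' y).
          h y = a y / b y \<and> h' y = a' y / b' y \<and> b y \<noteq> 0 \<and> b' y \<noteq> 0"
      by blast
    show "\<exists>V a b. open_box V \<and> a \<in> tensor_funs I X V \<and> b \<in> tensor_funs I X V \<and>
        x \<in> prod_basic I V b \<and> (\<forall>y\<in>U \<inter> prod_basic I V b. h y + h' y = a y / b y)"
      using V
      by (intro exI[of _ V] exI[of _ "\<lambda>y. a y * b' y + a' y * b y"] exI[of _ "\<lambda>y. b y * b' y"] conjI
          tensor_add tensor_mult ballI) (auto simp: add_frac_eq)
  qed
  show "(\<lambda>x. h x * h' x) \<in> reg (prod_space I X) U"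
    unfolding reg_prod_iff
  proof (intro conjI ballI)
    show "openin (prod_topology I X) U" using h(1) unfolding reg_prod_iff by blast
    fix x assume "x \<in> U"
    from loc[OF this] obtain V a a' b b' where V: "open_box V" "a \<in> tensor_funs I X V" "b \<in> tensor_funs I X V"
      "a' \<in> tensor_funs I X V" "b' \<in> tensor_funs I X V" "x \<in> prod_basic I V (\<lambda>y. b y * b' y)"
      "\<forall>y\<in>U \<inter> prod_basic I V (\<lambda>y. b y * b' y).
          h y = a y / b y \<and> h' y = a' y / b' y \<and> b y \<noteq> 0 \<and> b' y \<noteq> 0"
      by blast
    show "\<exists>V a b. open_box V \<and> a \<in> tensor_funs I X V \<and> b \<in> tensor_funs I X V \<and>
        x \<in> prod_basic I V b \<and> (\<forall>y\<in>U \<inter> prod_basic I V b. h y * h' y = a y / b y)"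
      using V
      by (intro exI[of _ V] exI[of _ "\<lambda>y. a y * a' y"] exI[of _ "\<lambda>y. b y * b' y"] conjI
          tensor_mult ballI) auto
  qed
next
  fix U h assume h: "h \<in> reg (prod_space I X) U"
  let ?U = "{x \<in> U. h x \<noteq> 0}"
  have loc: "\<exists>V a b. open_box V \<and> a \<in> tensor_funs I X V \<and> b \<in> tensor_funs I X V \<and>
        x \<in> prod_basic I V (\<lambda>y. a y * b y) \<and>
        (\<forall>y\<in>U \<inter> prod_basic I V (\<lambda>y. a y * b y). h y \<noteq> 0 \<and> inverse (h y) = (b y * b y) / (a y * b y))"
    if x: "x \<in> ?U" for x
  proof -
    from h x obtain V a b where V: "open_box V" "a \<in> tensor_funs I X V" "b \<in> tensor_funs I X V"
      "x \<in> prod_basic I V b" "\<forall>y\<in>U \<inter> prod_basic I V b. h y = a y / b y"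
      unfolding reg_prod_iff by blast
    have "a x \<noteq> 0" using V(4,5) x by auto
    then have "x \<in> prod_basic I V (\<lambda>y. a y * b y)"
      using V(4) by (auto simp: prod_basic_def)
    moreover have "h y \<noteq> 0 \<and> inverse (h y) = (b y * b y) / (a y * b y)"
      if "y \<in> U \<inter> prod_basic I V (\<lambda>y. a y * b y)" for y
    proof -
      have "h y = a y / b y" "a y \<noteq> 0" "b y \<noteq> 0"
        using that V(5) by (auto simp: prod_basic_def)
      then show ?thesis by simp
    qed
    ultimately have "open_box V \<and> a \<in> tensor_funs I X V \<and> b \<in> tensor_funs I X V \<and>
        x \<in> prod_basic I V (\<lambda>y. a y * b y) \<and>
        (\<forall>y\<in>U \<inter> prod_basic I V (\<lambda>y. a y * b y). h y \<noteq> 0 \<and> inverse (h y) = (b y * b y) / (a y * b y))"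
      using V(1-3) by simp
    then show ?thesis by (intro exI)
  qed
  have U: "openin (prod_topology I X) U" using h unfolding reg_prod_iff by blast
  have "openin (prod_topology I X) ?U"
  proof (subst openin_subopen, safe)
    fix x assume x: "x \<in> U" "h x \<noteq> 0"
    with loc[of x] obtain V a b where V: "open_box V" "a \<in> tensor_funs I X V" "b \<in> tensor_funs I X V"
        "x \<in> prod_basic I V (\<lambda>y. a y * b y)"
        "\<forall>y\<in>U \<inter> prod_basic I V (\<lambda>y. a y * b y). h y \<noteq> 0"
      by blast
    have "openin (prod_topology I X) (U \<inter> prod_basic I V (\<lambda>y. a y * b y))"
      by (intro openin_Int U openin_prod_basic tensor_mult V)
    then show "\<exists>T. openin (prod_topology I X) T \<and> x \<in> T \<and> T \<subseteq> ?U"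
      using V(4,5) x(1) by blast
  qed
  moreover have "\<exists>V a b. open_box V \<and> a \<in> tensor_funs I X V \<and> b \<in> tensor_funs I X V \<and>
        x \<in> prod_basic I V b \<and> (\<forall>y\<in>?U \<inter> prod_basic I V b. inverse (h y) = a y / b y)"
    if x: "x \<in> ?U" for x
  proof -
    from loc[OF x] obtain V a b where V: "open_box V" "a \<in> tensor_funs I X V" "b \<in> tensor_funs I X V"
        "x \<in> prod_basic I V (\<lambda>y. a y * b y)"
        "\<forall>y\<in>U \<inter> prod_basic I V (\<lambda>y. a y * b y). h y \<noteq> 0 \<and> inverse (h y) = (b y * b y) / (a y * b y)"
      by blast
    then show ?thesis
      by (intro exI[of _ V] exI[of _ "\<lambda>y. b y * b y"] exI[of _ "\<lambda>y. a y * b y"] conjI tensor_mult) auto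
  qed
  ultimately show "(\<lambda>x. inverse (h x)) \<in> reg (prod_space I X) ?U"
    unfolding reg_prod_iff by blast
qed

lemma morphism_projection:
  assumes i: "i \<in> I"
  shows "morphism (prod_space I X) (X i) (\<lambda>x. x i)"
proof -
  let ?V = "\<lambda>W j. if j = i then W else points (X j)"
  have box: "open_box (?V W)" if "openin (zar (X i)) W" for W
    using that by (auto simp: points_def)
  have pre: "{x \<in> points (prod_space I X). x i \<in> W} = prod_basic I (?V W) (\<lambda>_. 1)"
    if "openin (zar (X i)) W" for W
    using openin_subset[OF that] i unfolding points_prod
    by (auto simp: prod_basic_def PiE_iff points_def split: if_splits)
  have "openin (prod_topology I X) {x \<in> points (prod_space I X). x i \<in> W}"
    if "openin (zar (X i)) W" for W
    unfolding pre[OF that] by (intro openin_prod_basic tensor_const box that)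
  moreover have "(\<lambda>x. h (x i)) \<in> reg (prod_space I X) {x \<in> points (prod_space I X). x i \<in> W}"
    if W: "openin (zar (X i)) W" and h: "h \<in> reg (X i) W" for W h
    unfolding reg_prod_iff
  proof (intro conjI ballI)
    show "openin (prod_topology I X) {x \<in> points (prod_space I X). x i \<in> W}"
      unfolding pre[OF W] by (intro openin_prod_basic tensor_const box W)
    fix x assume x: "x \<in> {x \<in> points (prod_space I X). x i \<in> W}"
    have "(\<lambda>x. h (x i)) \<in> tensor_funs I X (?V W)"
      using h by (intro tensor_coordinate box W i) simp
    then show "\<exists>V a b. open_box V \<and> a \<in> tensor_funs I X V \<and> b \<in> tensor_funs I X V \<and>
        x \<in> prod_basic I V b \<and>
        (\<forall>y\<in>{x \<in> points (prod_space I X). x i \<in> W} \<inter> prod_basic I V b. h (y i) = a y / b y)"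
      using box[OF W] tensor_const[OF box[OF W], of 1] x unfolding pre[OF W]
      by (intro exI[of _ "?V W"] exI[of _ "\<lambda>x. h (x i)"] exI[of _ "\<lambda>_. 1"]) auto
  qed
  moreover have "x i \<in> topspace (zar (X i))" if "x \<in> points (prod_space I X)" for x
    using that i unfolding points_prod by (auto simp: points_def)
  ultimately show ?thesis
    unfolding morphism_def continuous_map_def zar_prod o_def
    by (auto simp: points_def zar_prod)
qed

text \<open>The universal property of the product.\<close>

lemma morphism_into_prod:
  assumes Y: "function_sheaf Y" and f: "\<And>i. i \<in> I \<Longrightarrow> morphism Y (X i) (\<lambda>y. f y i)"
    and ext: "\<And>y. y \<in> points Y \<Longrightarrow> f y \<in> extensional I"
  shows "morphism Y (prod_space I X) f"
proof -
  interpret Y: function_sheaf Y by fact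
  define pre where "pre V = {y \<in> points Y. \<forall>i\<in>I. f y i \<in> V i}" for V
  have pre_open: "openin (zar Y) (pre V)" if "open_box V" for V
  proof -
    have "openin (zar Y) ((\<Inter>i\<in>I. {y \<in> points Y. f y i \<in> V i}) \<inter> topspace (zar Y))"
      using that by (intro openin_INT finite_index openin_preimage[OF f]) auto
    also have "(\<Inter>i\<in>I. {y \<in> points Y. f y i \<in> V i}) \<inter> topspace (zar Y) = pre V"
      by (auto simp: pre_def points_def)
    finally show ?thesis .
  qed
  have tensor_pre: "(\<lambda>y. a (f y)) \<in> reg Y (pre V)" if V: "open_box V" "a \<in> tensor_funs I X V" for V a
  proof -
    from V(2) obtain m :: nat and c g where a: "a = (\<lambda>x. \<Sum>s<m. c s * (\<Prod>i\<in>I. g s i (x i)))"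
      "\<forall>s<m. \<forall>i\<in>I. g s i \<in> reg (X i) (V i)"
      unfolding tensor_funs_def by blast
    have "(\<lambda>y. g s i (f y i)) \<in> reg Y (pre V)" if s: "s < m" "i \<in> I" for s i
      using V(1) s a(2) pre_open[OF V(1)]
      by (intro Y.reg_restrict[OF reg_preimage[OF f[OF s(2)], of "V i" "g s i"]]) (auto simp: pre_def)
    then show ?thesis
      unfolding a(1) by (intro Y.reg_sum Y.reg_mult Y.reg_const Y.reg_prod pre_open V) auto
  qed
  have pre_basic: "{y \<in> points Y. f y \<in> prod_basic I V b} = {y \<in> pre V. b (f y) \<noteq> 0}" for V b
    using ext by (auto simp: pre_def prod_basic_def PiE_iff)
  have basic_open: "openin (zar Y) {y \<in> points Y. f y \<in> prod_basic I V b}"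
    if "open_box V" "b \<in> tensor_funs I X V" for V b
    unfolding pre_basic by (rule Y.openin_nonzero[OF tensor_pre[OF that]])
  have into: "f y \<in> points (prod_space I X)" if "y \<in> points Y" for y
  proof -
    have "f y i \<in> points (X i)" if "i \<in> I" for i
      using f[OF that] \<open>y \<in> points Y\<close> unfolding morphism_def points_def continuous_map_def by auto
    with ext[OF that] show ?thesis by (simp add: points_prod PiE_iff)
  qed
  have cont: "openin (zar Y) {y \<in> points Y. f y \<in> U}" if U: "openin (prod_topology I X) U" for U
  proof (subst openin_subopen, safe)
    fix y assume y: "y \<in> points Y" "f y \<in> U"
    from prod_topology_base[OF U y(2)] obtain V b where V: "open_box V" "b \<in> tensor_funs I X V"
      "f y \<in> prod_basic I V b" "prod_basic I V b \<subseteq> U"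
      by blast
    show "\<exists>T. openin (zar Y) T \<and> y \<in> T \<and> T \<subseteq> {y \<in> points Y. f y \<in> U}"
      using basic_open[OF V(1,2)] V(3,4) y(1)
      by (intro exI[of _ "{y \<in> points Y. f y \<in> prod_basic I V b}"]) auto
  qed
  moreover have "(\<lambda>y. h (f y)) \<in> reg Y {y \<in> points Y. f y \<in> U}" if h: "h \<in> reg (prod_space I X) U" for U h
  proof (rule Y.reg_local)
    show "openin (zar Y) {y \<in> points Y. f y \<in> U}"
      using h by (intro cont) (simp add: reg_prod_iff)
    fix y assume y: "y \<in> {y \<in> points Y. f y \<in> U}"
    with h obtain V a b where V: "open_box V" "a \<in> tensor_funs I X V" "b \<in> tensor_funs I X V"
      "f y \<in> prod_basic I V b" "\<forall>x\<in>U \<inter> prod_basic I V b. h x = a x / b x"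
      unfolding reg_prod_iff by blast
    let ?W = "{y \<in> points Y. f y \<in> prod_basic I V b}"
    have W: "openin (zar Y) ?W" by (rule basic_open[OF V(1,3)])
    have "(\<lambda>y. a (f y) / b (f y)) \<in> reg Y ?W"
      using W
      by (intro Y.reg_divide Y.reg_restrict[OF tensor_pre[OF V(1,2)]] Y.reg_restrict[OF tensor_pre[OF V(1,3)]])
        (auto simp: pre_basic)
    then show "\<exists>W g. openin (zar Y) W \<and> y \<in> W \<and> g \<in> reg Y W \<and>
        (\<forall>y\<in>{y \<in> points Y. f y \<in> U} \<inter> W. h (f y) = g y)"
      using W y V(4,5) by (intro exI[of _ ?W] exI[of _ "\<lambda>y. a (f y) / b (f y)"]) auto
  qed
  ultimately show ?thesis
    unfolding morphism_def continuous_map_def zar_prod o_def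
    using into by (auto simp: points_def zar_prod)
qed

end


section \<open>Graded algebras spanned by monomials\<close>

definition spanned :: "(nat \<Rightarrow> ('v \<Rightarrow>\<^sub>0 nat) set) \<Rightarrow> nat \<Rightarrow> 'v cpoly set" where
  "spanned A d = {f. Poly_Mapping.keys f \<subseteq> A d}"

definition point_ideal :: "(nat \<Rightarrow> 'v cpoly set) \<Rightarrow> ('v \<Rightarrow> complex) \<Rightarrow> 'v cpoly poly set" where
  "point_ideal G x = {F. \<forall>d. coeff F d \<in> G d \<and> peval x (coeff F d) = 0}"

text \<open>
  Gaussian elimination: an unknown whose coefficient in some equation is not zero is eliminated
  from the other equations.
\<close>

lemma linear_system_nontrivial_solution:
  fixes s :: "'c \<Rightarrow> 'm \<Rightarrow> complex"
  assumes "finite S" "finite C" "card S < card C"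
  shows "\<exists>a. (\<exists>c\<in>C. a c \<noteq> 0) \<and> (\<forall>m\<in>S. (\<Sum>c\<in>C. a c * s c m) = 0)"
  using assms
proof (induction S arbitrary: C s rule: finite_induct)
  case empty
  then have "C \<noteq> {}" by auto
  then show ?case by (intro exI[of _ "\<lambda>_. 1"]) auto
next
  case (insert m S)
  show ?case
  proof (cases "\<forall>c\<in>C. s c m = 0")
    case True
    have "card S < card C" using insert.prems(2) insert.hyps by simp
    from insert.IH[OF insert.prems(1) this, of s] True show ?thesis by auto
  next
    case False
    then obtain c0 where c0: "c0 \<in> C" "s c0 m \<noteq> 0" by blast
    let ?C = "C - {c0}"
    define s' where "s' = (\<lambda>c m'. s c m' - s c m / s c0 m * s c0 m')"
    have "card S < card ?C" using insert.prems insert.hyps c0(1) by simp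
    from insert.IH[OF _ this, of s'] insert.prems(1) obtain a where
      a: "\<exists>c\<in>?C. a c \<noteq> 0" "\<forall>m'\<in>S. (\<Sum>c\<in>?C. a c * s' c m') = 0"
      by auto
    define b where "b = a(c0 := - (\<Sum>c\<in>?C. a c * (s c m / s c0 m)))"
    have b: "(\<Sum>c\<in>C. b c * s c m') = (\<Sum>c\<in>?C. a c * s' c m')" for m'
    proof -
      have "(\<Sum>c\<in>C. b c * s c m') = b c0 * s c0 m' + (\<Sum>c\<in>?C. b c * s c m')"
        using c0(1) insert.prems(1) by (rule sum.remove[rotated])
      also have "(\<Sum>c\<in>?C. b c * s c m') = (\<Sum>c\<in>?C. a c * s c m')"
        by (rule sum.cong) (auto simp: b_def)
      also have "b c0 * s c0 m' = - (\<Sum>c\<in>?C. a c * (s c m / s c0 m * s c0 m'))"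
        by (simp add: b_def sum_distrib_right mult.assoc)
      finally show ?thesis
        by (simp add: s'_def right_diff_distrib sum_subtractf)
    qed
    have "s' c m = 0" for c using c0(2) by (simp add: s'_def)
    then have "\<forall>m'\<in>insert m S. (\<Sum>c\<in>C. b c * s c m') = 0"
      using a(2) by (simp add: b)
    moreover have "\<exists>c\<in>C. b c \<noteq> 0"
      using a(1) by (auto simp: b_def)
    ultimately show ?thesis by blast
  qed
qed

text \<open>The polynomial \<open>f ^ D * P(g / f)\<close>, written without denominators.\<close>

definition homog :: "'v cpoly \<Rightarrow> 'v cpoly \<Rightarrow> nat \<Rightarrow> complex poly \<Rightarrow> 'v cpoly" where
  "homog f g D P = (\<Sum>k\<le>D. const (coeff P k) * g ^ k * f ^ (D - k))"

lemma homog_add: "homog f g D (P + P') = homog f g D P + homog f g D P'"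
  by (simp add: homog_def const_simps sum.distrib algebra_simps)

lemma homog_smult: "homog f g D (smult c P) = const c * homog f g D P"
  by (simp add: homog_def const_simps sum_distrib_left mult.assoc)

lemma homog_sum: "homog f g D (sum p S) = (\<Sum>s\<in>S. homog f g D (p s))"
  by (induction S rule: infinite_finite_induct) (simp_all add: homog_add, simp_all add: homog_def const_simps)

lemma homog_linear_mult:
  assumes "degree P \<le> D"
  shows "homog f g (Suc D) ([:- c, 1:] * P) = (g - const c * f) * homog f g D P"
proof -
  have "homog f g (Suc D) (pCons 0 P) = g * homog f g D P"
    unfolding homog_def
    by (subst sum.atMost_Suc_shift) (simp add: const_simps sum_distrib_left mult_ac)
  moreover have "homog f g (Suc D) P = f * homog f g D P"
  proof -
    have "coeff P (Suc D) = 0" using assms by (intro coeff_eq_0) simp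
    then have "homog f g (Suc D) P = (\<Sum>k\<le>D. const (coeff P k) * g ^ k * f ^ (Suc D - k))"
      by (simp add: homog_def const_simps)
    also have "\<dots> = (\<Sum>k\<le>D. f * (const (coeff P k) * g ^ k * f ^ (D - k)))"
      by (rule sum.cong) (simp_all add: Suc_diff_le mult_ac)
    finally show ?thesis by (simp add: homog_def sum_distrib_left)
  qed
  moreover have "[:- c, 1:] * P = smult (- c) P + pCons 0 P" by simp
  ultimately show ?thesis
    by (simp only: homog_add homog_smult const_simps) (simp add: algebra_simps)
qed

lemma homog_prod_linear:
  assumes "finite S"
  shows "homog f g (card S) (\<Prod>c\<in>S. [:- c, 1:]) = (\<Prod>c\<in>S. g - const c * f) \<and>
    degree (\<Prod>c\<in>S. [:- c, 1:]) \<le> card S"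
  using assms
proof (induction S rule: finite_induct)
  case empty
  then show ?case by (simp add: homog_def const_simps)
next
  case (insert c S)
  have "degree ([:- c, 1:] * (\<Prod>c\<in>S. [:- c, 1:])) \<le> Suc (card S)"
    using degree_mult_le[of "[:- c, 1:]" "\<Prod>c\<in>S. [:- c, 1:]"] insert.IH by simp
  then show ?case
    using insert homog_linear_mult[of "\<Prod>c\<in>S. [:- c, 1:]" "card S" f g c] by (simp del: mult_pCons_left)
qed

locale monomial_algebra =
  fixes A :: "nat \<Rightarrow> ('v \<Rightarrow>\<^sub>0 nat) set"
  assumes A_zero: "0 \<in> A 0"
    and A_add: "m \<in> A d \<Longrightarrow> m' \<in> A e \<Longrightarrow> m + m' \<in> A (d + e)"
    and A_finite: "finite (A d)"
begin

abbreviation G :: "nat \<Rightarrow> 'v cpoly set" where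
  "G \<equiv> spanned A"

lemma G_0: "0 \<in> G d"
  by (simp add: spanned_def)

lemma G_const: "const c \<in> G 0"
  using A_zero by (simp add: spanned_def const_def)

lemma G_1: "1 \<in> G 0"
  using G_const[of 1] by (simp add: const_simps)

lemma G_single: "m \<in> A d \<Longrightarrow> Poly_Mapping.single m c \<in> G d"
  by (simp add: spanned_def)

lemma G_add: "f \<in> G d \<Longrightarrow> g \<in> G d \<Longrightarrow> f + g \<in> G d"
  unfolding spanned_def using Poly_Mapping.keys_add[of f g] by blast

lemma G_uminus: "f \<in> G d \<Longrightarrow> - f \<in> G d"
  by (simp add: spanned_def)

lemma G_diff: "f \<in> G d \<Longrightarrow> g \<in> G d \<Longrightarrow> f - g \<in> G d"
  using G_add[of f d "- g"] G_uminus by simp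

lemma G_mult:
  assumes "f \<in> G d" "g \<in> G e"
  shows "f * g \<in> G (d + e)"
proof -
  have "m \<in> A (d + e)" if m: "m \<in> Poly_Mapping.keys (f * g)" for m
  proof -
    from m obtain a b where "m = a + b" "a \<in> Poly_Mapping.keys f" "b \<in> Poly_Mapping.keys g"
      using Poly_Mapping.keys_mult[of f g] by blast
    then show ?thesis using assms A_add unfolding spanned_def by blast
  qed
  then show ?thesis unfolding spanned_def by blast
qed

lemma G_scale: "f \<in> G d \<Longrightarrow> const c * f \<in> G d"
  using G_mult[OF G_const] by simp

lemma G_sum: "(\<And>s. s \<in> S \<Longrightarrow> f s \<in> G d) \<Longrightarrow> sum f S \<in> G d"
  by (induction S rule: infinite_finite_induct) (auto intro: G_0 G_add)

lemma G_power: "f \<in> G d \<Longrightarrow> f ^ n \<in> G (n * d)"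
proof (induction n)
  case (Suc n)
  then show ?case using G_mult[of f d "f ^ n" "n * d"] by simp
qed (simp add: G_1)

lemma carrier_graded: "F \<in> carrier (graded_ring G) \<longleftrightarrow> (\<forall>d. coeff F d \<in> G d)"
  by (simp add: graded_ring_def)

lemma monom_carrier: "f \<in> G d \<Longrightarrow> monom f d \<in> carrier (graded_ring G)"
  by (simp add: carrier_graded G_0)

lemma cring_graded: "cring (graded_ring G)"
  unfolding graded_ring_def
proof (rule cring_ring_on; (unfold mem_Collect_eq)?)
  fix F H :: "'v cpoly poly" assume FH: "\<forall>d. coeff F d \<in> G d" "\<forall>d. coeff H d \<in> G d"
  show "\<forall>d. coeff (F * H) d \<in> G d"
  proof
    fix d
    have "coeff F i * coeff H (d - i) \<in> G d" if "i \<le> d" for i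
      using G_mult[of "coeff F i" i "coeff H (d - i)" "d - i"] FH that by simp
    then show "coeff (F * H) d \<in> G d"
      unfolding coeff_mult by (intro G_sum) simp
  qed
qed (auto intro: G_0 G_1 G_add G_uminus)


subsection \<open>Homogeneous ideals as families of their graded pieces\<close>

text \<open>
  A homogeneous ideal is determined by its graded pieces.  These are collected in a set of pairs of a
  degree and an element, so that families of pieces are ordered by inclusion, as Zorn's lemma needs.
\<close>

definition hideal :: "(nat \<times> 'v cpoly) set \<Rightarrow> bool" where
  "hideal Q \<longleftrightarrow> (\<forall>d f. (d, f) \<in> Q \<longrightarrow> f \<in> G d) \<and> (\<forall>d. (d, 0) \<in> Q) \<and>
     (\<forall>d f g. (d, f) \<in> Q \<and> (d, g) \<in> Q \<longrightarrow> (d, f + g) \<in> Q) \<and>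
     (\<forall>d e f g. f \<in> G d \<and> (e, g) \<in> Q \<longrightarrow> (d + e, f * g) \<in> Q)"

definition hprime :: "(nat \<times> 'v cpoly) set \<Rightarrow> bool" where
  "hprime Q \<longleftrightarrow> hideal Q \<and>
     (\<forall>d e f g. f \<in> G d \<and> g \<in> G e \<and> (d + e, f * g) \<in> Q \<longrightarrow> (d, f) \<in> Q \<or> (e, g) \<in> Q) \<and>
     (\<exists>d>0. \<exists>f\<in>G d. (d, f) \<notin> Q)"

definition total :: "(nat \<times> 'v cpoly) set \<Rightarrow> 'v cpoly poly set" where
  "total Q = {F. \<forall>d. (d, coeff F d) \<in> Q}"

definition pieces :: "'v cpoly poly set \<Rightarrow> (nat \<times> 'v cpoly) set" where
  "pieces p = {(d, f). f \<in> G d \<and> monom f d \<in> p}"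

lemma hidealD:
  assumes "hideal Q"
  shows "(d, f) \<in> Q \<Longrightarrow> f \<in> G d" "(d, 0) \<in> Q" "(d, f) \<in> Q \<Longrightarrow> (d, g) \<in> Q \<Longrightarrow> (d, f + g) \<in> Q"
    "f \<in> G d \<Longrightarrow> (e, g) \<in> Q \<Longrightarrow> (d + e, f * g) \<in> Q"
  using assms unfolding hideal_def by blast+

lemma hprimeD:
  assumes "hprime Q"
  shows "hideal Q" "f \<in> G d \<Longrightarrow> g \<in> G e \<Longrightarrow> (d + e, f * g) \<in> Q \<Longrightarrow> (d, f) \<in> Q \<or> (e, g) \<in> Q"
    "\<exists>d>0. \<exists>f\<in>G d. (d, f) \<notin> Q"
  using assms unfolding hprime_def by blast+

lemma hideal_scale: "hideal Q \<Longrightarrow> (d, f) \<in> Q \<Longrightarrow> (d, const c * f) \<in> Q"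
  using hidealD(4)[OF _ G_const] by fastforce

lemma hideal_uminus: "hideal Q \<Longrightarrow> (d, f) \<in> Q \<Longrightarrow> (d, - f) \<in> Q"
  using hideal_scale[of Q d f "-1"] by (simp add: const_simps)

lemma hideal_diff: "hideal Q \<Longrightarrow> (d, f) \<in> Q \<Longrightarrow> (d, g) \<in> Q \<Longrightarrow> (d, f - g) \<in> Q"
  using hidealD(3)[of Q d f "- g"] hideal_uminus[of Q d g] by simp

lemma hideal_sum: "hideal Q \<Longrightarrow> (\<And>s. s \<in> S \<Longrightarrow> (d, f s) \<in> Q) \<Longrightarrow> (d, sum f S) \<in> Q"
  by (induction S rule: infinite_finite_induct) (auto intro: hidealD(2,3))

lemma hideal_mult_right: "hideal Q \<Longrightarrow> (e, g) \<in> Q \<Longrightarrow> f \<in> G d \<Longrightarrow> (e + d, g * f) \<in> Q"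
  using hidealD(4)[of Q f d e g] by (simp add: add.commute mult.commute)

lemma hideal_scale_iff:
  assumes "hideal Q" "c \<noteq> 0"
  shows "(d, const c * f) \<in> Q \<longleftrightarrow> (d, f) \<in> Q"
proof
  assume "(d, const c * f) \<in> Q"
  from hideal_scale[OF assms(1) this, of "inverse c"] show "(d, f) \<in> Q"
    using assms(2) by (simp add: mult.assoc[symmetric] const_simps(6)[symmetric]) (simp add: const_simps)
qed (rule hideal_scale[OF assms(1)])

lemma hprime_mult_iff:
  assumes "hprime Q" "f \<in> G d" "g \<in> G e"
  shows "(d + e, f * g) \<in> Q \<longleftrightarrow> (d, f) \<in> Q \<or> (e, g) \<in> Q"
  using hprimeD(2)[OF assms] hidealD(4)[OF hprimeD(1)[OF assms(1)] assms(2)]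
    hideal_mult_right[OF hprimeD(1)[OF assms(1)] _ assms(3)] by blast

lemma hprime_one:
  assumes "hprime Q"
  shows "(0, 1) \<notin> Q"
proof
  assume one: "(0, 1) \<in> Q"
  obtain d f where "f \<in> G d" "(d, f) \<notin> Q" using hprimeD(3)[OF assms] by blast
  with hidealD(4)[OF hprimeD(1)[OF assms] _ one, of f d] show False by simp
qed

lemma hprime_power:
  assumes "hprime Q" "f \<in> G d" "(d, f) \<notin> Q"
  shows "(n * d, f ^ n) \<notin> Q"
proof (induction n)
  case 0
  then show ?case using hprime_one[OF assms(1)] by simp
next
  case (Suc n)
  then show ?case
    using hprime_mult_iff[OF assms(1,2) G_power[OF assms(2)], of n] assms(3) by simp
qed

lemma monom_total:
  assumes "hideal Q"
  shows "monom f d \<in> total Q \<longleftrightarrow> (d, f) \<in> Q"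
proof -
  have "monom f d \<in> total Q \<longleftrightarrow> (\<forall>e. (e, if d = e then f else 0) \<in> Q)"
    by (simp add: total_def)
  also have "\<dots> \<longleftrightarrow> (d, f) \<in> Q"
    using hidealD(2)[OF assms] by (metis (full_types))
  finally show ?thesis .
qed

lemma pieces_total: "hideal Q \<Longrightarrow> pieces (total Q) = Q"
  using hidealD(1) by (auto simp: pieces_def monom_total)

text \<open>
  An ideal that is prime for homogeneous elements is prime: if neither factor lies in it, consider
  in each factor the component of least degree outside of it.  Up to the ideal, the product of these
  two components is a component of the product.
\<close>

lemma relevant_total:
  assumes Q: "hprime Q"
  shows "relevant_prime G (total Q)"
proof -
  note ideal = hprimeD(1)[OF Q]
  have sub: "total Q \<subseteq> carrier (graded_ring G)"
    unfolding carrier_graded[abs_def] total_def subset_iff carrier_graded using hidealD(1)[OF ideal] by blast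
  obtain d0 f0 where f0: "d0 > 0" "f0 \<in> G d0" "(d0, f0) \<notin> Q"
    using hprimeD(3)[OF Q] by blast
  have f0': "monom f0 d0 \<in> carrier (graded_ring G)" "monom f0 d0 \<notin> total Q" "coeff (monom f0 d0) 0 = 0"
    using f0 monom_carrier monom_total[OF ideal] by auto
  have "ideal (total Q) (graded_ring G)"
    unfolding graded_ring_def
  proof (rule ideal_ring_onI)
    show "cring (ring_on {F. \<forall>d. coeff F d \<in> G d})"
      using cring_graded by (simp add: graded_ring_def)
    show "total Q \<subseteq> {F. \<forall>d. coeff F d \<in> G d}"
      using sub by (auto simp: carrier_graded)
    fix F H assume FH: "F \<in> {F. \<forall>d. coeff F d \<in> G d}" "H \<in> total Q"
    show "F * H \<in> total Q"
      unfolding total_def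
    proof (intro CollectI allI)
      fix d
      have "(d, coeff F i * coeff H (d - i)) \<in> Q" if "i \<in> {..d}" for i
        using hidealD(4)[OF ideal, of "coeff F i" i "d - i" "coeff H (d - i)"] FH that
        by (simp add: total_def)
      then show "(d, coeff (F * H) d) \<in> Q"
        unfolding coeff_mult by (rule hideal_sum[OF ideal])
    qed
  qed (auto simp: total_def intro: hidealD[OF ideal] hideal_uminus[OF ideal])
  moreover have "F \<in> total Q \<or> H \<in> total Q"
    if FH: "F \<in> carrier (graded_ring G)" "H \<in> carrier (graded_ring G)" "F * H \<in> total Q" for F H
  proof (rule ccontr)
    assume "\<not> (F \<in> total Q \<or> H \<in> total Q)"
    then have "\<exists>i. (i, coeff F i) \<notin> Q" "\<exists>j. (j, coeff H j) \<notin> Q"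
      unfolding total_def by blast+
    then obtain i j where i: "(i, coeff F i) \<notin> Q" "\<And>k. k < i \<Longrightarrow> (k, coeff F k) \<in> Q"
      and j: "(j, coeff H j) \<notin> Q" "\<And>k. k < j \<Longrightarrow> (k, coeff H k) \<in> Q"
      using exists_least_iff[of "\<lambda>i::nat. (i, coeff F i) \<notin> Q"] exists_least_iff[of "\<lambda>j::nat. (j, coeff H j) \<notin> Q"]
      by blast
    have F: "coeff F k \<in> G k" and H: "coeff H k \<in> G k" for k
      using FH(1,2) by (auto simp: carrier_graded)
    have "(i + j, coeff F k * coeff H (i + j - k)) \<in> Q" if k: "k \<le> i + j" "k \<noteq> i" for k
    proof (cases "k < i")
      case True
      then show ?thesis
        using hideal_mult_right[OF ideal i(2)[OF True] H[of "i + j - k"]] by simp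
    next
      case False
      then have "(i + j - k, coeff H (i + j - k)) \<in> Q" using k by (intro j(2)) simp
      from hidealD(4)[OF ideal F[of k] this] show ?thesis using k by simp
    qed
    then have "(i + j, \<Sum>k\<in>{..i + j} - {i}. coeff F k * coeff H (i + j - k)) \<in> Q"
      by (intro hideal_sum ideal) auto
    moreover have "(i + j, coeff (F * H) (i + j)) \<in> Q"
      using FH(3) by (simp add: total_def)
    moreover have "coeff (F * H) (i + j) =
        coeff F i * coeff H j + (\<Sum>k\<in>{..i + j} - {i}. coeff F k * coeff H (i + j - k))"
      unfolding coeff_mult by (subst sum.remove[of _ i]) auto
    ultimately have "(i + j, coeff F i * coeff H j) \<in> Q"
      using hideal_diff[OF ideal] by fastforce
    then show False
      using hprimeD(2)[OF Q F H] i(1) j(1) by blast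
  qed
  ultimately have "primeideal (total Q) (graded_ring G)"
    using f0'(1,2) by (intro primeidealI cring_graded) (auto simp: graded_ring_def)
  moreover have "\<forall>F\<in>total Q. \<forall>d. monom (coeff F d) d \<in> total Q"
    unfolding total_def using hidealD(2)[OF ideal] by simp
  ultimately show ?thesis
    unfolding relevant_prime_def using f0' by blast
qed

lemma relevant_pieces:
  assumes p: "relevant_prime G p"
  shows "hprime (pieces p)" "p = total (pieces p)"
proof -
  have prime: "primeideal p (graded_ring G)" and hom: "\<forall>F\<in>p. \<forall>d. monom (coeff F d) d \<in> p"
    and rel: "\<not> {F \<in> carrier (graded_ring G). coeff F 0 = 0} \<subseteq> p"
    using p unfolding relevant_prime_def by blast+
  interpret primeideal p "graded_ring G" by fact
  have "ideal p (ring_on {F. \<forall>d. coeff F d \<in> G d})"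
    using is_ideal by (simp add: graded_ring_def)
  note p_ideal = ideal_ring_onD[OF this]
  have "hideal (pieces p)"
    unfolding hideal_def pieces_def
  proof (intro conjI allI impI; unfold mem_Collect_eq split_conv)
    show "0 \<in> G d \<and> monom 0 d \<in> p" for d using G_0 p_ideal(2) by simp
    show "f + g \<in> G d \<and> monom (f + g) d \<in> p"
      if "(f \<in> G d \<and> monom f d \<in> p) \<and> g \<in> G d \<and> monom g d \<in> p" for f g d
      using that p_ideal(3) G_add by (simp add: add_monom[symmetric])
    show "f * g \<in> G (d + e) \<and> monom (f * g) (d + e) \<in> p"
      if "f \<in> G d \<and> g \<in> G e \<and> monom g e \<in> p" for f g d e
      using that p_ideal(4)[of "monom f d" "monom g e"] G_mult[of f d g e] by (simp add: mult_monom G_0)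
  qed blast
  moreover have "(d, f) \<in> pieces p \<or> (e, g) \<in> pieces p"
    if "f \<in> G d" "g \<in> G e" "(d + e, f * g) \<in> pieces p" for d e f g
    using that I_prime[of "monom f d" "monom g e"] monom_carrier
    by (auto simp: pieces_def mult_monom graded_ring_def)
  moreover show total: "p = total (pieces p)"
  proof
    show "p \<subseteq> total (pieces p)"
      using hom p_ideal(1) by (auto simp: total_def pieces_def)
    show "total (pieces p) \<subseteq> p"
    proof
      fix F assume "F \<in> total (pieces p)"
      then have "monom (coeff F d) d \<in> p" for d by (simp add: total_def pieces_def)
      then have "(\<Sum>d\<in>D. monom (coeff F d) d) \<in> p" for D
        by (induction D rule: infinite_finite_induct) (auto intro: p_ideal(2,3))
      then show "F \<in> p" using poly_as_sum_of_monoms[of F] by metis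
    qed
  qed
  moreover have "\<exists>d>0. \<exists>f\<in>G d. (d, f) \<notin> pieces p"
  proof -
    from rel obtain F where F: "\<forall>d. coeff F d \<in> G d" "coeff F 0 = 0" "F \<notin> p"
      by (auto simp: carrier_graded)
    then obtain d where "(d, coeff F d) \<notin> pieces p"
      using total by (auto simp: total_def)
    moreover from this F p_ideal(2) have "d \<noteq> 0"
      by (cases "d = 0") (auto simp: pieces_def G_0)
    ultimately show ?thesis using F(1) by (meson neq0_conv)
  qed
  ultimately show "hprime (pieces p)"
    unfolding hprime_def by blast
qed

lemma proj_points_total:
  assumes "hprime Q" "\<And>Q'. hprime Q' \<Longrightarrow> Q \<subseteq> Q' \<Longrightarrow> Q' = Q"
  shows "total Q \<in> proj_points G"
  unfolding proj_points_def
proof (intro CollectI conjI allI impI)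
  show "relevant_prime G (total Q)" by (rule relevant_total[OF assms(1)])
  fix q assume q: "relevant_prime G q \<and> total Q \<subseteq> q"
  then have "pieces (total Q) \<subseteq> pieces q" by (auto simp: pieces_def)
  then have "Q \<subseteq> pieces q" by (simp add: pieces_total hprimeD(1)[OF assms(1)])
  with assms(2) relevant_pieces q show "q = total Q" by metis
qed

lemma proj_points_pieces:
  assumes "p \<in> proj_points G"
  shows "hprime (pieces p)" "p = total (pieces p)"
    "hprime Q \<Longrightarrow> pieces p \<subseteq> Q \<Longrightarrow> Q = pieces p"
proof -
  have p: "relevant_prime G p" "\<And>q. relevant_prime G q \<Longrightarrow> p \<subseteq> q \<Longrightarrow> q = p"
    using assms unfolding proj_points_def by blast+
  show prime: "hprime (pieces p)" and total: "p = total (pieces p)"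
    using relevant_pieces[OF p(1)] by simp_all
  assume Q: "hprime Q" "pieces p \<subseteq> Q"
  then have "total (pieces p) \<subseteq> total Q" by (auto simp: total_def)
  with p(2)[OF relevant_total[OF Q(1)]] total have "total Q = p" by simp
  then show "Q = pieces p" using pieces_total[OF hprimeD(1)[OF Q(1)]] by simp
qed

lemma in_pieces: "f \<in> G d \<Longrightarrow> (d, f) \<in> pieces p \<longleftrightarrow> monom f d \<in> p"
  by (simp add: pieces_def)


subsection \<open>Primes avoiding an element\<close>

definition adjoin :: "(nat \<times> 'v cpoly) set \<Rightarrow> nat \<Rightarrow> 'v cpoly \<Rightarrow> (nat \<times> 'v cpoly) set" where
  "adjoin Q i a = Q \<union> {(e + i, q + a * s) | e q s. s \<in> G e \<and> (e + i, q) \<in> Q}"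

lemma adjoin_superset: "Q \<subseteq> adjoin Q i a"
  by (simp add: adjoin_def)

lemma adjoin_self: "hideal Q \<Longrightarrow> (i, a) \<in> adjoin Q i a"
  using G_1 hidealD(2)[of Q i] unfolding adjoin_def
  by (intro UnI2 CollectI exI[of _ 0] exI[of _ 1]) auto

lemma adjoinI: "s \<in> G e \<Longrightarrow> (e + i, q) \<in> Q \<Longrightarrow> (e + i, q + a * s) \<in> adjoin Q i a"
  unfolding adjoin_def by blast

lemma adjoin_cases:
  assumes "(n, h) \<in> adjoin Q i a"
  obtains "(n, h) \<in> Q" | e q s where "n = e + i" "h = q + a * s" "s \<in> G e" "(e + i, q) \<in> Q"
  using assms unfolding adjoin_def by blast

lemma hideal_adjoin:
  assumes Q: "hideal Q" and a: "a \<in> G i"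
  shows "hideal (adjoin Q i a)"
  unfolding hideal_def
proof (intro conjI allI impI)
  fix d f assume "(d, f) \<in> adjoin Q i a"
  then show "f \<in> G d"
  proof (cases rule: adjoin_cases)
    case (2 e q s)
    have "a * s \<in> G d" using G_mult[OF a 2(3)] 2(1) by (simp add: add.commute)
    then show ?thesis using 2 G_add hidealD(1)[OF Q] by blast
  qed (rule hidealD(1)[OF Q])
next
  fix d show "(d, 0) \<in> adjoin Q i a"
    using hidealD(2)[OF Q] adjoin_superset by blast
next
  fix d f g assume fg: "(d, f) \<in> adjoin Q i a \<and> (d, g) \<in> adjoin Q i a"
  then have f: "(d, f) \<in> adjoin Q i a" and g: "(d, g) \<in> adjoin Q i a" by blast+
  from f show "(d, f + g) \<in> adjoin Q i a"
  proof (cases rule: adjoin_cases)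
    case f: 1
    from g show ?thesis
    proof (cases rule: adjoin_cases)
      case 1
      then show ?thesis using hidealD(3)[OF Q f] adjoin_superset by blast
    next
      case (2 e q s)
      have "(e + i, (f + q) + a * s) \<in> adjoin Q i a"
        using 2 f hidealD(3)[OF Q] by (intro adjoinI) auto
      then show ?thesis using 2 by (simp add: add.assoc)
    qed
  next
    case f: (2 e q s)
    from g show ?thesis
    proof (cases rule: adjoin_cases)
      case 1
      have "(e + i, (q + g) + a * s) \<in> adjoin Q i a"
        using 1 f hidealD(3)[OF Q] by (intro adjoinI) auto
      then show ?thesis using f by (simp add: algebra_simps)
    next
      case (2 e' q' s')
      then have "e' = e" using f by simp
      then have "(e + i, (q + q') + a * (s + s')) \<in> adjoin Q i a"
        using 2 f hidealD(3)[OF Q] G_add by (intro adjoinI) auto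
      then show ?thesis using f 2 by (simp add: algebra_simps)
    qed
  qed
next
  fix d e f g assume "f \<in> G d \<and> (e, g) \<in> adjoin Q i a"
  then have f: "f \<in> G d" and g: "(e, g) \<in> adjoin Q i a" by blast+
  from g show "(d + e, f * g) \<in> adjoin Q i a"
  proof (cases rule: adjoin_cases)
    case 1
    then show ?thesis using hidealD(4)[OF Q f] adjoin_superset by blast
  next
    case (2 e' q s)
    have "((d + e') + i, f * q + a * (f * s)) \<in> adjoin Q i a"
      using G_mult[OF f 2(3)] hidealD(4)[OF Q f 2(4)] by (intro adjoinI) (auto simp: add.assoc)
    then show ?thesis using 2 by (simp add: algebra_simps)
  qed
qed

text \<open>
  A homogeneous ideal that contains no power of \<open>f\<close>, and is maximal with this property, is prime:
  adjoining two elements outside of it captures two powers of \<open>f\<close>, and hence their product.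
\<close>

lemma hprime_avoiding:
  assumes Q0: "hideal Q0" and f: "f \<in> G d" "d > 0" and avoid: "\<And>N. (N * d, f ^ N) \<notin> Q0"
  obtains Q where "hprime Q" "Q0 \<subseteq> Q"
proof -
  define S where "S = {Q. hideal Q \<and> Q0 \<subseteq> Q \<and> (\<forall>N. (N * d, f ^ N) \<notin> Q)}"
  have "\<exists>M\<in>S. \<forall>X\<in>S. M \<subseteq> X \<longrightarrow> X = M"
  proof (rule subset_Zorn_nonempty)
    show "S \<noteq> {}" using Q0 avoid by (auto simp: S_def)
    fix \<C> assume \<C>: "\<C> \<noteq> {}" "subset.chain S \<C>"
    then have sub: "\<C> \<subseteq> S" and chain: "\<And>X Y. X \<in> \<C> \<Longrightarrow> Y \<in> \<C> \<Longrightarrow> X \<subseteq> Y \<or> Y \<subseteq> X"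
      by (auto simp: subset_chain_def)
    have hid: "hideal X" if "X \<in> \<C>" for X using that sub by (auto simp: S_def)
    have "hideal (\<Union>\<C>)"
      unfolding hideal_def
    proof (intro conjI allI impI)
      fix d f g assume "(d, f) \<in> \<Union>\<C> \<and> (d, g) \<in> \<Union>\<C>"
      then obtain X Y where XY: "X \<in> \<C>" "(d, f) \<in> X" "Y \<in> \<C>" "(d, g) \<in> Y" by blast
      from chain[OF XY(1,3)] show "(d, f + g) \<in> \<Union>\<C>"
      proof
        assume "X \<subseteq> Y"
        then have "(d, f + g) \<in> Y" using XY by (intro hidealD(3)[OF hid[OF XY(3)]]) auto
        then show ?thesis using XY(3) by blast
      next
        assume "Y \<subseteq> X"
        then have "(d, f + g) \<in> X" using XY by (intro hidealD(3)[OF hid[OF XY(1)]]) auto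
        then show ?thesis using XY(1) by blast
      qed
    next
      fix d show "(d, 0) \<in> \<Union>\<C>" using \<C>(1) hidealD(2)[OF hid] by blast
    next
      fix d f assume "(d, f) \<in> \<Union>\<C>"
      then show "f \<in> G d" using hidealD(1)[OF hid] by blast
    next
      fix d e f g assume "f \<in> G d \<and> (e, g) \<in> \<Union>\<C>"
      then show "(d + e, f * g) \<in> \<Union>\<C>" using hidealD(4)[OF hid] by blast
    qed
    then show "\<Union>\<C> \<in> S" using sub \<C>(1) by (auto simp: S_def)
  qed
  then obtain Q where QS: "Q \<in> S" and max: "\<And>X. X \<in> S \<Longrightarrow> Q \<subseteq> X \<Longrightarrow> X = Q"
    by blast
  then have Q: "hideal Q" "Q0 \<subseteq> Q" "\<And>N. (N * d, f ^ N) \<notin> Q"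
    by (simp_all add: S_def)
  have power: "\<exists>N e q s. N * d = e + i \<and> f ^ N = q + a * s \<and> s \<in> G e \<and> (e + i, q) \<in> Q"
    if a: "a \<in> G i" "(i, a) \<notin> Q" for a i
  proof -
    have "adjoin Q i a \<notin> S"
      using max[OF _ adjoin_superset] adjoin_self[OF Q(1)] a(2) by metis
    then obtain N where "(N * d, f ^ N) \<in> adjoin Q i a"
      using hideal_adjoin[OF Q(1) a(1)] adjoin_superset Q(2) unfolding S_def by blast
    then show ?thesis
      by (cases rule: adjoin_cases) (use Q(3) in blast)+
  qed
  have "hprime Q"
    unfolding hprime_def
  proof (intro conjI allI impI)
    show "hideal Q" by (rule Q(1))
    show "\<exists>d>0. \<exists>f\<in>G d. (d, f) \<notin> Q" using Q(3)[of 1] f by auto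
    fix i j a b assume ab: "a \<in> G i \<and> b \<in> G j \<and> (i + j, a * b) \<in> Q"
    show "(i, a) \<in> Q \<or> (j, b) \<in> Q"
    proof (rule ccontr)
      assume "\<not> ((i, a) \<in> Q \<or> (j, b) \<in> Q)"
      with ab power[of a i] power[of b j] obtain N e q s N' e' q' s' where
        1: "N * d = e + i" "f ^ N = q + a * s" "s \<in> G e" "(e + i, q) \<in> Q" and
        2: "N' * d = e' + j" "f ^ N' = q' + b * s'" "s' \<in> G e'" "(e' + j, q') \<in> Q"
        by blast
      have fN: "f ^ N \<in> G (e + i)" using G_power[OF f(1), of N] 1(1) by simp
      have as: "a * s \<in> G (e + i)" using G_mult[of a i s e] ab 1(3) by (simp add: add.commute)
      have "((e + i) + (e' + j), q * f ^ N') \<in> Q"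
        using hideal_mult_right[OF Q(1) 1(4) G_power[OF f(1), of N']] 2(1) by simp
      moreover have "((e + i) + (e' + j), (a * s) * q') \<in> Q"
        by (rule hidealD(4)[OF Q(1) as 2(4)])
      moreover have "((e + e') + (i + j), (s * s') * (a * b)) \<in> Q"
        using hidealD(4)[OF Q(1) G_mult[OF 1(3) 2(3)], of "i + j" "a * b"] ab by simp
      ultimately have "((e + i) + (e' + j), q * f ^ N' + ((a * s) * q' + (s * s') * (a * b))) \<in> Q"
        by (intro hidealD(3)[OF Q(1)]) (simp_all add: add_ac)
      moreover have "q * f ^ N' + ((a * s) * q' + (s * s') * (a * b)) = f ^ (N + N')"
        unfolding power_add 1(2) 2(2) by (simp add: algebra_simps)
      moreover have "(e + i) + (e' + j) = (N + N') * d"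
        using 1(1) 2(1) by (simp add: add_mult_distrib)
      ultimately show False using Q(3)[of "N + N'"] by simp
    qed
  qed
  with Q(2) that show ?thesis by blast
qed

text \<open>
  Since a closed point is maximal, no relevant prime contains it together with an element outside of
  it.  So the ideal generated by both contains a power of every \<open>f\<close> of positive degree.
\<close>

lemma inverse_modulo_point:
  assumes p: "p \<in> proj_points G" and f: "f \<in> G d" "d > 0" "(d, f) \<notin> pieces p"
    and u: "u \<in> G e" "(e, u) \<notin> pieces p"
  shows "\<exists>N e' q s. N * d = e' + e \<and> f ^ N = q + u * s \<and> s \<in> G e' \<and> (e' + e, q) \<in> pieces p"
proof -
  have Q: "hideal (pieces p)" using hprimeD(1)[OF proj_points_pieces(1)[OF p]] .
  have "\<exists>N. (N * d, f ^ N) \<in> adjoin (pieces p) e u"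
  proof (rule ccontr)
    assume "\<nexists>N. (N * d, f ^ N) \<in> adjoin (pieces p) e u"
    then obtain Q' where Q': "hprime Q'" "adjoin (pieces p) e u \<subseteq> Q'"
      using hprime_avoiding[OF hideal_adjoin[OF Q u(1)] f(1,2)] by blast
    then have "Q' = pieces p"
      using proj_points_pieces(3)[OF p] adjoin_superset by blast
    then show False using Q'(2) adjoin_self[OF Q] u(2) by blast
  qed
  then obtain N where "(N * d, f ^ N) \<in> adjoin (pieces p) e u" by blast
  moreover have "(N * d, f ^ N) \<notin> pieces p"
    by (rule hprime_power[OF proj_points_pieces(1)[OF p] f(1,3)])
  ultimately show ?thesis
    by (cases rule: adjoin_cases) blast+
qed


subsection \<open>The Nullstellensatz\<close>

lemma homog_G:
  assumes "f \<in> G d" "g \<in> G d"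
  shows "homog f g D P \<in> G (D * d)"
  unfolding homog_def
proof (rule G_sum)
  fix k assume "k \<in> {..D}"
  then have k: "k * d + (D - k) * d = D * d" by (simp flip: add_mult_distrib)
  have "const (coeff P k) * (g ^ k * f ^ (D - k)) \<in> G (k * d + (D - k) * d)"
    by (intro G_scale G_mult G_power assms)
  then show "const (coeff P k) * g ^ k * f ^ (D - k) \<in> G (D * d)"
    by (simp add: k mult.assoc)
qed

text \<open>
  Over the complex numbers a binary form is a product of linear forms.  A prime that contains it
  contains one of these, which is not proportional to \<open>f\<close> because \<open>f\<close> lies outside of the prime.
\<close>

lemma hprime_homog:
  assumes Q: "hprime Q" and f: "f \<in> G d" "(d, f) \<notin> Q" and g: "g \<in> G d"
    and P: "P \<noteq> 0" "degree P \<le> D" "(D * d, homog f g D P) \<in> Q"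
  shows "\<exists>c. (d, g - const c * f) \<in> Q"
  using P
proof (induction D arbitrary: P)
  case (0 P)
  then obtain c where "P = [:c:]" by (auto elim: degree_eq_zeroE)
  with 0 have "coeff P 0 \<noteq> 0" by simp
  moreover from 0 have "(0, const (coeff P 0) * 1) \<in> Q" by (simp add: homog_def)
  ultimately show ?case
    using hideal_scale_iff[OF hprimeD(1)[OF Q]] hprime_one[OF Q] by blast
next
  case (Suc D P)
  show ?case
  proof (cases "degree P = 0")
    case True
    then obtain c where c: "P = [:c:]" "c \<noteq> 0"
      using Suc.prems(1) degree_eq_zeroE by (metis pCons_0_0)
    have "homog f g (Suc D) P = const c * f ^ Suc D"
      unfolding homog_def c(1) by (subst sum.atMost_Suc_shift) (simp add: const_simps)
    with Suc.prems(3) have "(Suc D * d, f ^ Suc D) \<in> Q"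
      using hideal_scale_iff[OF hprimeD(1)[OF Q] c(2)] by simp
    then show ?thesis using hprime_power[OF Q f] by blast
  next
    case False
    then obtain c where "poly P c = 0"
      using fundamental_theorem_of_algebra[of P] by (auto simp: constant_degree)
    then obtain P' where P': "P = [:- c, 1:] * P'"
      by (auto simp: poly_eq_0_iff_dvd)
    with Suc.prems(1) have "P' \<noteq> 0" by auto
    then have deg: "degree P' \<le> D"
      using Suc.prems(1,2) unfolding P' by (subst (asm) degree_mult_eq) auto
    have lin: "g - const c * f \<in> G d" by (intro G_diff G_scale f g)
    have "homog f g (Suc D) P = (g - const c * f) * homog f g D P'"
      unfolding P' by (rule homog_linear_mult[OF deg])
    with Suc.prems(3) have "(d + D * d, (g - const c * f) * homog f g D P') \<in> Q"
      by simp
    then have "(d, g - const c * f) \<in> Q \<or> (D * d, homog f g D P') \<in> Q"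
      using hprimeD(2)[OF Q lin homog_G[OF f(1) g]] by blast
    then show ?thesis using Suc.IH[OF \<open>P' \<noteq> 0\<close> deg] by blast
  qed
qed

text \<open>
  The residue field at a closed point is the field of complex numbers.  Otherwise every \<open>g - c f\<close>
  would be invertible modulo the point, so some power of \<open>f\<close> would be congruent to
  \<open>(g - c f) s c\<close>, and the power would be the same for infinitely many of the uncountably many \<open>c\<close>.
  The graded pieces have finite dimension, so the cofactors \<open>s c\<close> are linearly dependent; clearing
  the denominators \<open>g - c f\<close> in the dependence gives a non-trivial binary form that vanishes at
  \<open>(g, f)\<close>, and such a form is a product of linear ones.
\<close>

lemma residue_field_complex:
  assumes p: "p \<in> proj_points G" and f: "f \<in> G d" "d > 0" "(d, f) \<notin> pieces p" and g: "g \<in> G d"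
  shows "\<exists>c. (d, g - const c * f) \<in> pieces p"
proof (rule ccontr)
  let ?Q = "pieces p"
  have Q: "hprime ?Q" by (rule proj_points_pieces(1)[OF p])
  note ideal = hprimeD(1)[OF Q]
  assume none: "\<nexists>c. (d, g - const c * f) \<in> ?Q"
  have lin: "g - const c * f \<in> G d" for c by (intro G_diff G_scale f g)
  have "\<exists>N e' q s. N * d = e' + d \<and> f ^ N = q + (g - const c * f) * s \<and> s \<in> G e' \<and> (e' + d, q) \<in> ?Q" for c
    using inverse_modulo_point[OF p f lin, of c] none by blast
  then obtain N E q s where Nqs: "\<And>c. N c * d = E c + d" "\<And>c. f ^ N c = q c + (g - const c * f) * s c"
    "\<And>c. s c \<in> G (E c)" "\<And>c. (E c + d, q c) \<in> ?Q"
    by metis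
  have "\<exists>n. infinite {c. N c = n}"
  proof (rule ccontr)
    assume "\<nexists>n. infinite {c. N c = n}"
    then have "countable (\<Union>n. {c. N c = n})" by (intro countable_UN) (auto intro: countable_finite)
    moreover have "(\<Union>n. {c. N c = n}) = UNIV" by blast
    ultimately show False using uncountable_UNIV_complex by simp
  qed
  then obtain n where n: "infinite {c. N c = n}" by blast
  define e where "e = n * d - d"
  have e: "n * d = e + d" "\<And>c. N c = n \<Longrightarrow> E c = e"
  proof -
    obtain c where "N c = n" using n infinite_imp_nonempty by blast
    then show "n * d = e + d" using Nqs(1)[of c] by (simp add: e_def)
    show "E c = e" if "N c = n" for c using Nqs(1)[of c] that by (simp add: e_def)
  qed
  obtain C where C: "C \<subseteq> {c. N c = n}" "finite C" "card C = Suc (card (A e))"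
    using infinite_arbitrarily_large[OF n] by blast
  obtain a where a: "\<exists>c\<in>C. a c \<noteq> 0"
      "\<forall>m\<in>A e. (\<Sum>c\<in>C. a c * Poly_Mapping.lookup (s c) m) = 0"
    using linear_system_nontrivial_solution[OF A_finite C(2), of e "\<lambda>c. Poly_Mapping.lookup (s c)"] C(3)
    by auto
  have sC: "s c \<in> G e" if "c \<in> C" for c using Nqs(3)[of c] e(2) C(1) that by auto
  have dep: "(\<Sum>c\<in>C. const (a c) * s c) = 0"
  proof (rule poly_mapping_eqI)
    fix m
    have scale: "Poly_Mapping.lookup (const b * h) m = b * Poly_Mapping.lookup h m" for b and h :: "'v cpoly"
      unfolding const_def mult_map_scale_conv_mult[symmetric] by (simp add: Poly_Mapping.map.rep_eq when_def)
    have "(\<Sum>c\<in>C. a c * Poly_Mapping.lookup (s c) m) = 0"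
    proof (cases "m \<in> A e")
      case False
      then have "Poly_Mapping.lookup (s c) m = 0" if "c \<in> C" for c
        using sC[OF that] by (auto simp: spanned_def in_keys_iff)
      then show ?thesis by simp
    qed (use a(2) in blast)
    then show "Poly_Mapping.lookup (\<Sum>c\<in>C. const (a c) * s c) m = Poly_Mapping.lookup 0 m"
      by (simp add: lookup_sum scale)
  qed
  define P where "P = (\<Sum>c\<in>C. smult (a c) (\<Prod>c'\<in>C - {c}. [:- c', 1:]))"
  have card: "card (C - {c}) = card (A e)" if "c \<in> C" for c
    using C(2,3) that by simp
  have homP: "homog f g (card (A e)) P = (\<Sum>c\<in>C. const (a c) * (\<Prod>c'\<in>C - {c}. g - const c' * f))"
    unfolding P_def homog_sum homog_smult
  proof (rule sum.cong[OF refl])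
    fix c assume "c \<in> C"
    then show "const (a c) * homog f g (card (A e)) (\<Prod>c'\<in>C - {c}. [:- c', 1:])
        = const (a c) * (\<Prod>c'\<in>C - {c}. g - const c' * f)"
      using homog_prod_linear[of "C - {c}" f g] card[of c] C(2) by auto
  qed
  have degP: "degree P \<le> card (A e)"
    unfolding P_def
  proof (rule degree_sum_le[OF C(2)])
    fix c assume c: "c \<in> C"
    have "degree (smult (a c) (\<Prod>c'\<in>C - {c}. [:- c', 1:])) \<le> degree (\<Prod>c'\<in>C - {c}. [:- c', 1:])"
      by (rule degree_smult_le)
    also have "\<dots> \<le> card (A e)"
      using homog_prod_linear[of "C - {c}" f g] card[OF c] C(2) by auto
    finally show "degree (smult (a c) (\<Prod>c'\<in>C - {c}. [:- c', 1:])) \<le> card (A e)" .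
  qed
  obtain c0 where c0: "c0 \<in> C" "a c0 \<noteq> 0" using a(1) by blast
  have "poly P c0 = (\<Sum>c\<in>C. a c * (\<Prod>c'\<in>C - {c}. c0 - c'))"
    by (simp add: P_def poly_sum poly_prod)
  also have "\<dots> = a c0 * (\<Prod>c'\<in>C - {c0}. c0 - c')"
  proof -
    have "(\<Prod>c'\<in>C - {c}. c0 - c') = 0" if "c \<in> C - {c0}" for c
      using that c0(1) C(2) by (intro prod_zero) auto
    then have "(\<Sum>c\<in>C - {c0}. a c * (\<Prod>c'\<in>C - {c}. c0 - c')) = 0"
      by (intro sum.neutral ballI) simp
    then show ?thesis
      using sum.remove[OF C(2) c0(1), of "\<lambda>c. a c * (\<Prod>c'\<in>C - {c}. c0 - c')"] by simp
  qed
  finally have "P \<noteq> 0" using c0(2) C(2) by auto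
  have "((card (A e)) * d + n * d, homog f g (card (A e)) P * f ^ n) \<in> ?Q"
  proof -
    have qC: "f ^ n = q c + (g - const c * f) * s c" "(n * d, q c) \<in> ?Q" if "c \<in> C" for c
      using Nqs(2)[of c] Nqs(4)[of c] e C(1) that by auto
    have "homog f g (card (A e)) P * f ^ n
        = (\<Sum>c\<in>C. const (a c) * (\<Prod>c'\<in>C - {c}. g - const c' * f) * (q c + (g - const c * f) * s c))"
      unfolding homP sum_distrib_right by (rule sum.cong) (use qC(1) in auto)
    also have "\<dots> = (\<Sum>c\<in>C. (const (a c) * (\<Prod>c'\<in>C - {c}. g - const c' * f)) * q c)
        + (\<Sum>c\<in>C. ((g - const c * f) * (\<Prod>c'\<in>C - {c}. g - const c' * f)) * (const (a c) * s c))"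
      by (simp add: sum.distrib[symmetric] algebra_simps)
    also have "(\<Sum>c\<in>C. ((g - const c * f) * (\<Prod>c'\<in>C - {c}. g - const c' * f)) * (const (a c) * s c))
        = (\<Sum>c\<in>C. (\<Prod>c'\<in>C. g - const c' * f) * (const (a c) * s c))"
    proof (rule sum.cong[OF refl])
      fix c assume "c \<in> C"
      then show "((g - const c * f) * (\<Prod>c'\<in>C - {c}. g - const c' * f)) * (const (a c) * s c)
          = (\<Prod>c'\<in>C. g - const c' * f) * (const (a c) * s c)"
        using prod.remove[OF C(2), of c "\<lambda>c'. g - const c' * f"] by simp
    qed
    also have "\<dots> = 0" by (simp add: sum_distrib_left[symmetric] dep)
    finally have eq: "homog f g (card (A e)) P * f ^ n
        = (\<Sum>c\<in>C. (const (a c) * (\<Prod>c'\<in>C - {c}. g - const c' * f)) * q c)" by simp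
    have prodG: "(\<Prod>c'\<in>S. g - const c' * f) \<in> G (card S * d)" if "finite S" for S
      using that
    proof (induction S rule: finite_induct)
      case (insert c S)
      then show ?case using G_mult[OF lin[of c] insert.IH] by simp
    qed (simp add: G_1)
    show ?thesis
      unfolding eq
    proof (intro hideal_sum ideal hidealD(4)[OF ideal] qC(2))
      fix c assume "c \<in> C"
      then show "const (a c) * (\<Prod>c'\<in>C - {c}. g - const c' * f) \<in> G (card (A e) * d)"
        using prodG[of "C - {c}"] card[of c] C(2) by (intro G_scale) simp
    qed
  qed
  then have "((card (A e)) * d, homog f g (card (A e)) P) \<in> ?Q"
    using hprimeD(2)[OF Q homog_G[OF f(1) g] G_power[OF f(1), of n]] hprime_power[OF Q f(1,3)] by blast
  with hprime_homog[OF Q f(1,3) g \<open>P \<noteq> 0\<close> degP] none show False by blast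
qed


subsection \<open>Points of Proj given by coordinates\<close>

definition nonzero_at :: "('v \<Rightarrow> complex) \<Rightarrow> bool" where
  "nonzero_at x \<longleftrightarrow> (\<exists>d>0. \<exists>f\<in>G d. peval x f \<noteq> 0)"

lemma monom_point_ideal: "monom f d \<in> point_ideal G x \<longleftrightarrow> f \<in> G d \<and> peval x f = 0"
  unfolding point_ideal_def using G_0 by (auto split: if_splits dest: spec[of _ d])

lemma point_ideal_total: "point_ideal G x = total {(d, f). f \<in> G d \<and> peval x f = 0}"
  by (simp add: point_ideal_def total_def)

text \<open>
  The ideal of a point with coordinates \<open>x\<close> is maximal: if a larger prime contains \<open>u\<close> with
  \<open>u(x) \<noteq> 0\<close>, then for every \<open>h\<close> of positive degree it contains a combination of a power of
  \<open>h\<close> and a power of \<open>u\<close> that vanishes at \<open>x\<close>, and therefore \<open>h\<close> itself.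
\<close>

lemma point_ideal_in_proj:
  assumes "nonzero_at x"
  shows "point_ideal G x \<in> proj_points G"
  unfolding point_ideal_total
proof (rule proj_points_total)
  let ?Q = "{(d, f). f \<in> G d \<and> peval x f = 0}"
  have "hideal ?Q"
    unfolding hideal_def by (auto intro: G_0 G_add G_mult)
  then show "hprime ?Q"
    unfolding hprime_def using assms by (auto simp: nonzero_at_def)
  fix Q' assume Q': "hprime Q'" "?Q \<subseteq> Q'"
  note ideal = hprimeD(1)[OF Q'(1)]
  have "(e, u) \<in> ?Q" if u: "(e, u) \<in> Q'" for e u
  proof (rule ccontr)
    assume "(e, u) \<notin> ?Q"
    moreover have uG: "u \<in> G e" by (rule hidealD(1)[OF ideal u])
    ultimately have ux: "peval x u \<noteq> 0" by simp
    obtain d h where h: "d > 0" "h \<in> G d" "(d, h) \<notin> Q'" using hprimeD(3)[OF Q'(1)] by blast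
    let ?v = "const (peval x u ^ d) * h ^ e - const (peval x h ^ e) * u ^ d"
    have "u ^ d \<in> G (e * d)" using G_power[OF uG, of d] by (simp add: mult.commute)
    then have "(e * d, ?v) \<in> ?Q"
      by (auto intro!: G_diff G_scale G_power h(2))
    then have "(e * d, ?v) \<in> Q'" using Q'(2) by blast
    moreover have "(e * d, u ^ d) \<in> Q'"
      using hideal_mult_right[OF ideal u G_power[OF uG, of "d - 1"]] h(1)
      by (cases d) (simp_all add: mult.commute)
    ultimately have "(e * d, ?v + const (peval x h ^ e) * u ^ d) \<in> Q'"
      using hidealD(3)[OF ideal] hideal_scale[OF ideal] by blast
    then have "(e * d, h ^ e) \<in> Q'"
      using hideal_scale_iff[OF ideal, of "peval x u ^ d"] ux by simp
    then show False using hprime_power[OF Q'(1) h(2,3)] by blast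
  qed
  with Q'(2) show "Q' = ?Q" by (auto simp del: split_paired_All)
qed

text \<open>
  If modulo a closed point every monomial is its value at \<open>x\<close> times a power of a fixed element that
  is not in the point, then the same holds for every \<open>f\<close>, and \<open>f\<close> lies in the point iff its value
  vanishes.
\<close>

lemma point_idealI:
  assumes Q: "p \<in> proj_points G" and M: "M \<in> G 1" "(1, M) \<notin> pieces p" "peval x M = 1"
    and val: "\<And>d m. m \<in> A d \<Longrightarrow> (d, Poly_Mapping.single m 1 - const (mval x m) * M ^ d) \<in> pieces p"
  shows "p = point_ideal G x"
proof -
  have prime: "hprime (pieces p)" by (rule proj_points_pieces(1)[OF Q])
  note ideal = hprimeD(1)[OF prime]
  have Md: "M ^ d \<in> G d" for d using G_power[OF M(1), of d] by simp
  have f_val: "(d, f - const (peval x f) * M ^ d) \<in> pieces p" if f: "f \<in> G d" for d f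
  proof -
    have "(d, \<Sum>m\<in>Poly_Mapping.keys f. const (Poly_Mapping.lookup f m) *
        (Poly_Mapping.single m 1 - const (mval x m) * M ^ d)) \<in> pieces p"
      using f by (intro hideal_sum hideal_scale ideal val) (auto simp: spanned_def)
    also have "(\<Sum>m\<in>Poly_Mapping.keys f. const (Poly_Mapping.lookup f m) *
        (Poly_Mapping.single m 1 - const (mval x m) * M ^ d))
        = (\<Sum>m\<in>Poly_Mapping.keys f. Poly_Mapping.single m (Poly_Mapping.lookup f m))
          - (\<Sum>m\<in>Poly_Mapping.keys f. const (Poly_Mapping.lookup f m * mval x m)) * M ^ d"
      by (simp add: right_diff_distrib sum_subtractf sum_distrib_right const_simps mult.assoc
          single_eq_const_mult[symmetric])
    also have "(\<Sum>m\<in>Poly_Mapping.keys f. const (Poly_Mapping.lookup f m * mval x m) :: 'v cpoly) = const (peval x f)"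
    proof -
      have "const (sum h S) = (\<Sum>s\<in>S. const (h s) :: 'v cpoly)" for h :: "('v \<Rightarrow>\<^sub>0 nat) \<Rightarrow> complex" and S
        by (induction S rule: infinite_finite_induct) (simp_all add: const_simps)
      then show ?thesis by (simp add: peval_def mval_def)
    qed
    finally show ?thesis by (simp add: sum_of_monomials)
  qed
  have "(d, f) \<in> pieces p \<longleftrightarrow> peval x f = 0" if f: "f \<in> G d" for d f
  proof
    assume "(d, f) \<in> pieces p"
    from hideal_diff[OF ideal this f_val[OF f]] have "(d, const (peval x f) * M ^ d) \<in> pieces p"
      by simp
    moreover have "(d, M ^ d) \<notin> pieces p" using hprime_power[OF prime M(1,2), of d] by simp
    ultimately show "peval x f = 0" using hideal_scale_iff[OF ideal] by blast
  next
    assume "peval x f = 0"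
    then show "(d, f) \<in> pieces p" using f_val[OF f] by (simp add: const_simps)
  qed
  then have "pieces p = {(d, f). f \<in> G d \<and> peval x f = 0}"
    using hidealD(1)[OF ideal] by auto
  then show ?thesis
    unfolding point_ideal_total using proj_points_pieces(2)[OF Q] by simp
qed


subsection \<open>Regular functions on Proj\<close>

lemma zar_Proj: "zar (Proj G) = proj_topology G"
  by (simp add: Proj_def)

lemma reg_Proj:
  "h \<in> reg (Proj G) U \<longleftrightarrow> openin (proj_topology G) U \<and>
     (\<forall>p\<in>U. \<exists>W d f g. openin (proj_topology G) W \<and> p \<in> W \<and> W \<subseteq> U \<and> f \<in> G d \<and> g \<in> G d \<and>
       (\<forall>q\<in>W. monom f d \<notin> q \<and> monom (g - const (h q) * f) d \<in> q))"
  by (simp add: Proj_def)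

lemma openin_principal:
  assumes "f \<in> G d" "d > 0"
  shows "openin (proj_topology G) {p \<in> proj_points G. monom f d \<notin> p}"
  unfolding proj_topology_def using assms by (intro topology_generated_by_Basis) blast

lemma point_nonzero:
  assumes "p \<in> proj_points G"
  obtains d f where "d > 0" "f \<in> G d" "monom f d \<notin> p"
  using hprimeD(3)[OF proj_points_pieces(1)[OF assms]] in_pieces by blast

lemma points_Proj: "points (Proj G) = proj_points G"
proof -
  have "p \<in> \<Union> {{p \<in> proj_points G. monom f d \<notin> p} | d f. 0 < d \<and> f \<in> G d}" if "p \<in> proj_points G" for p
    by (rule point_nonzero[OF that]) (use that in blast)
  then show ?thesis
    unfolding points_def zar_Proj proj_topology_def topology_generated_by_topspace by blast
qed

lemma openin_proj_subset: "openin (proj_topology G) U \<Longrightarrow> U \<subseteq> proj_points G"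
  using openin_subset points_Proj by (fastforce simp: points_def zar_Proj)

lemma monom_mult_in_point:
  assumes "p \<in> proj_points G" "f \<in> G d" "g \<in> G e"
  shows "monom (f * g) (d + e) \<in> p \<longleftrightarrow> monom f d \<in> p \<or> monom g e \<in> p"
  using hprime_mult_iff[OF proj_points_pieces(1)[OF assms(1)] assms(2,3)]
  by (simp add: in_pieces assms G_mult)

text \<open>
  The topology is generated by the non-vanishing loci of elements of positive degree.  Multiplication
  with such elements reduces degree zero to this case.
\<close>

lemma openin_principal':
  assumes "f \<in> G d"
  shows "openin (proj_topology G) {p \<in> proj_points G. monom f d \<notin> p}"
proof (subst openin_subopen, safe)
  fix p assume p: "p \<in> proj_points G" "monom f d \<notin> p"
  obtain e h where h: "e > 0" "h \<in> G e" "monom h e \<notin> p" by (rule point_nonzero[OF p(1)])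
  let ?T = "{p \<in> proj_points G. monom (f * h) (d + e) \<notin> p}"
  have "openin (proj_topology G) ?T"
    using h by (intro openin_principal G_mult assms) auto
  moreover have "p \<in> ?T" "?T \<subseteq> {p \<in> proj_points G. monom f d \<notin> p}"
    using p h monom_mult_in_point[OF _ assms h(2)] by auto
  ultimately show "\<exists>T. openin (proj_topology G) T \<and> p \<in> T \<and> T \<subseteq> {p \<in> proj_points G. monom f d \<notin> p}"
    by blast
qed

lemma point_closed:
  assumes p: "p \<in> proj_points G"
  shows "monom 0 d \<in> p" "f \<in> G d \<Longrightarrow> g \<in> G d \<Longrightarrow> monom f d \<in> p \<Longrightarrow> monom g d \<in> p \<Longrightarrow> monom (f + g) d \<in> p"
    "f \<in> G d \<Longrightarrow> g \<in> G d \<Longrightarrow> monom f d \<in> p \<Longrightarrow> monom g d \<in> p \<Longrightarrow> monom (f - g) d \<in> p"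
    "f \<in> G d \<Longrightarrow> monom f d \<in> p \<Longrightarrow> monom (const c * f) d \<in> p"
    "f \<in> G d \<Longrightarrow> c \<noteq> 0 \<Longrightarrow> monom (const c * f) d \<in> p \<Longrightarrow> monom f d \<in> p"
proof -
  have Q: "hideal (pieces p)" by (rule hprimeD(1)[OF proj_points_pieces(1)[OF p]])
  show "monom 0 d \<in> p" using hidealD(2)[OF Q, of d] in_pieces[OF G_0] by simp
  assume f: "f \<in> G d"
  show "monom (const c * f) d \<in> p" if "monom f d \<in> p"
    using hideal_scale[OF Q, of d f c] that in_pieces[OF f] in_pieces[OF G_scale[OF f]] by simp
  show "monom f d \<in> p" if "c \<noteq> 0" "monom (const c * f) d \<in> p"
    using hideal_scale_iff[OF Q, of c d f] that in_pieces[OF f] in_pieces[OF G_scale[OF f]] by simp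
  assume g: "g \<in> G d" and *: "monom f d \<in> p" "monom g d \<in> p"
  show "monom (f + g) d \<in> p"
    using hidealD(3)[OF Q, of d f g] * in_pieces[OF f] in_pieces[OF g] in_pieces[OF G_add[OF f g]] by simp
  show "monom (f - g) d \<in> p"
    using hideal_diff[OF Q, of d f g] * in_pieces[OF f] in_pieces[OF g] in_pieces[OF G_diff[OF f g]] by simp
qed

text \<open>
  The formulas for sums, products and inverses of fractions, read modulo the points: \<open>h q\<close> is the
  value of \<open>g / f\<close> at \<open>q\<close> iff \<open>g - h q f\<close> belongs to \<open>q\<close>.
\<close>

lemma function_sheaf_Proj: "function_sheaf (Proj G)"
proof
  fix h U assume "h \<in> reg (Proj G) U"
  then show "openin (zar (Proj G)) U" by (simp add: reg_Proj zar_Proj)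
next
  fix U h
  assume U: "openin (zar (Proj G)) U"
    and loc: "\<And>x. x \<in> U \<Longrightarrow> \<exists>V g. openin (zar (Proj G)) V \<and> x \<in> V \<and> g \<in> reg (Proj G) V \<and> (\<forall>y\<in>U \<inter> V. h y = g y)"
  show "h \<in> reg (Proj G) U"
    unfolding reg_Proj
  proof (intro conjI ballI)
    show "openin (proj_topology G) U" using U by (simp add: zar_Proj)
    fix p assume p: "p \<in> U"
    from loc[OF p] obtain V k where V: "p \<in> V" "k \<in> reg (Proj G) V" "\<forall>y\<in>U \<inter> V. h y = k y" by blast
    then obtain W d f g where W: "openin (proj_topology G) W" "p \<in> W" "W \<subseteq> V" "f \<in> G d" "g \<in> G d"
      "\<forall>q\<in>W. monom f d \<notin> q \<and> monom (g - const (k q) * f) d \<in> q"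
      unfolding reg_Proj by blast
    have "openin (proj_topology G) (W \<inter> U)" "p \<in> W \<inter> U" "W \<inter> U \<subseteq> U"
        "\<forall>q\<in>W \<inter> U. monom f d \<notin> q \<and> monom (g - const (h q) * f) d \<in> q"
      using W V(3) U p by (auto simp: zar_Proj)
    with W(4,5) show "\<exists>W d f g. openin (proj_topology G) W \<and> p \<in> W \<and> W \<subseteq> U \<and> f \<in> G d \<and> g \<in> G d \<and>
       (\<forall>q\<in>W. monom f d \<notin> q \<and> monom (g - const (h q) * f) d \<in> q)"
      by meson
  qed
next
  fix U c assume U: "openin (zar (Proj G)) U"
  show "(\<lambda>_. c) \<in> reg (Proj G) U"
    unfolding reg_Proj
  proof (intro conjI ballI)
    show "openin (proj_topology G) U" using U by (simp add: zar_Proj)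
    fix p assume p: "p \<in> U"
    have "monom 1 0 \<notin> q \<and> monom (const c - const c * 1) 0 \<in> q" if "q \<in> U" for q
    proof -
      have q: "q \<in> proj_points G" using that U openin_proj_subset by (auto simp: zar_Proj)
      have "(0, 1) \<notin> pieces q" by (rule hprime_one[OF proj_points_pieces(1)[OF q]])
      then have "monom 1 0 \<notin> q" using in_pieces[OF G_1] by blast
      then show ?thesis using point_closed(1)[OF q, of 0] by (metis diff_self mult_1_right)
    qed
    with U p show "\<exists>W d f g. openin (proj_topology G) W \<and> p \<in> W \<and> W \<subseteq> U \<and> f \<in> G d \<and> g \<in> G d \<and>
       (\<forall>q\<in>W. monom f d \<notin> q \<and> monom (g - const c * f) d \<in> q)"
      by - (rule exI[of _ U], rule exI[of _ 0], rule exI[of _ 1], rule exI[of _ "const c"],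
        auto simp: zar_Proj G_1 G_const)
  qed
next
  fix U h h' assume h: "h \<in> reg (Proj G) U" "h' \<in> reg (Proj G) U"
  have U: "openin (proj_topology G) U" using h by (simp add: reg_Proj)
  \<comment> \<open>Locally the two functions have a common denominator.\<close>
  have loc: "\<exists>W d f a b. openin (proj_topology G) W \<and> p \<in> W \<and> W \<subseteq> U \<and> f \<in> G d \<and> a \<in> G d \<and> b \<in> G d \<and>
      (\<forall>q\<in>W. q \<in> proj_points G \<and> monom f d \<notin> q \<and> monom (a - const (h q) * f) d \<in> q \<and>
        monom (b - const (h' q) * f) d \<in> q)" if p: "p \<in> U" for p
  proof -
    from h(1) p obtain W d f g where W: "openin (proj_topology G) W" "p \<in> W" "W \<subseteq> U" "f \<in> G d" "g \<in> G d"
      "\<forall>q\<in>W. monom f d \<notin> q \<and> monom (g - const (h q) * f) d \<in> q"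
      unfolding reg_Proj by blast
    from h(2) p obtain W' e f' g' where W': "openin (proj_topology G) W'" "p \<in> W'" "W' \<subseteq> U" "f' \<in> G e" "g' \<in> G e"
      "\<forall>q\<in>W'. monom f' e \<notin> q \<and> monom (g' - const (h' q) * f') e \<in> q"
      unfolding reg_Proj by blast
    have "q \<in> proj_points G \<and> monom (f * f') (d + e) \<notin> q \<and>
        monom (g * f' - const (h q) * (f * f')) (d + e) \<in> q \<and>
        monom (f * g' - const (h' q) * (f * f')) (d + e) \<in> q" if q: "q \<in> W \<inter> W'" for q
    proof -
      have Q: "q \<in> proj_points G" using q W(1) openin_proj_subset by blast
      have lin: "g - const (h q) * f \<in> G d" "g' - const (h' q) * f' \<in> G e"
        by (intro G_diff G_scale W W')+
      have "monom ((g - const (h q) * f) * f') (d + e) \<in> q" "monom (f * (g' - const (h' q) * f')) (d + e) \<in> q"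
        using monom_mult_in_point[OF Q lin(1) W'(4)] monom_mult_in_point[OF Q W(4) lin(2)] q W(6) W'(6) by blast+
      moreover have "(g - const (h q) * f) * f' = g * f' - const (h q) * (f * f')"
          "f * (g' - const (h' q) * f') = f * g' - const (h' q) * (f * f')"
        by (simp_all add: algebra_simps)
      moreover have "monom (f * f') (d + e) \<notin> q"
        using monom_mult_in_point[OF Q W(4) W'(4)] q W(6) W'(6) by blast
      ultimately show ?thesis using Q by simp
    qed
    then have "openin (proj_topology G) (W \<inter> W') \<and> p \<in> W \<inter> W' \<and> W \<inter> W' \<subseteq> U \<and>
        f * f' \<in> G (d + e) \<and> g * f' \<in> G (d + e) \<and> f * g' \<in> G (d + e) \<and>
        (\<forall>q\<in>W \<inter> W'. q \<in> proj_points G \<and> monom (f * f') (d + e) \<notin> q \<and>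
          monom (g * f' - const (h q) * (f * f')) (d + e) \<in> q \<and>
          monom (f * g' - const (h' q) * (f * f')) (d + e) \<in> q)"
      using W(1-5) W'(1-5) by (auto intro: G_mult)
    then show ?thesis by (intro exI)
  qed
  show "(\<lambda>x. h x + h' x) \<in> reg (Proj G) U"
    unfolding reg_Proj
  proof (intro conjI ballI U)
    fix p assume "p \<in> U"
    from loc[OF this] obtain W d f a b where W: "openin (proj_topology G) W" "p \<in> W" "W \<subseteq> U"
      and fab: "f \<in> G d" "a \<in> G d" "b \<in> G d"
      and q: "\<forall>q\<in>W. q \<in> proj_points G \<and> monom f d \<notin> q \<and> monom (a - const (h q) * f) d \<in> q \<and>
        monom (b - const (h' q) * f) d \<in> q"
      by (elim exE conjE)
    have "monom (a + b - const (h q + h' q) * f) d \<in> q" if "q \<in> W" for q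
    proof -
      from bspec[OF q that] have Q: "q \<in> proj_points G" "monom (a - const (h q) * f) d \<in> q"
        "monom (b - const (h' q) * f) d \<in> q" by simp_all
      have "monom ((a - const (h q) * f) + (b - const (h' q) * f)) d \<in> q"
        by (rule point_closed(2)[OF Q(1) _ _ Q(2,3)]) (intro G_diff G_scale fab)+
      then show ?thesis by (simp add: algebra_simps const_simps)
    qed
    then have "openin (proj_topology G) W \<and> p \<in> W \<and> W \<subseteq> U \<and> f \<in> G d \<and> a + b \<in> G d \<and>
       (\<forall>q\<in>W. monom f d \<notin> q \<and> monom (a + b - const (h q + h' q) * f) d \<in> q)"
      using W fab q by (simp add: G_add)
    then show "\<exists>W d f g. openin (proj_topology G) W \<and> p \<in> W \<and> W \<subseteq> U \<and> f \<in> G d \<and> g \<in> G d \<and>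
       (\<forall>q\<in>W. monom f d \<notin> q \<and> monom (g - const (h q + h' q) * f) d \<in> q)"
      by (intro exI)
  qed
  show "(\<lambda>x. h x * h' x) \<in> reg (Proj G) U"
    unfolding reg_Proj
  proof (intro conjI ballI U)
    fix p assume "p \<in> U"
    from loc[OF this] obtain W d f a b where W: "openin (proj_topology G) W" "p \<in> W" "W \<subseteq> U"
      and fab: "f \<in> G d" "a \<in> G d" "b \<in> G d"
      and q: "\<forall>q\<in>W. q \<in> proj_points G \<and> monom f d \<notin> q \<and> monom (a - const (h q) * f) d \<in> q \<and>
        monom (b - const (h' q) * f) d \<in> q"
      by (elim exE conjE)
    have "monom (f * f) (d + d) \<notin> q \<and> monom (a * b - const (h q * h' q) * (f * f)) (d + d) \<in> q"
      if "q \<in> W" for q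
    proof
      from bspec[OF q that] have Q: "q \<in> proj_points G" "monom f d \<notin> q" "monom (a - const (h q) * f) d \<in> q"
        "monom (b - const (h' q) * f) d \<in> q" by simp_all
      show "monom (f * f) (d + d) \<notin> q"
        using monom_mult_in_point[OF Q(1) fab(1,1)] Q(2) by blast
      have lin: "a - const (h q) * f \<in> G d" "b - const (h' q) * f \<in> G d" and hf: "const (h q) * f \<in> G d"
        by (intro G_diff G_scale fab)+
      have "monom ((a - const (h q) * f) * b) (d + d) \<in> q"
          "monom ((const (h q) * f) * (b - const (h' q) * f)) (d + d) \<in> q"
        using monom_mult_in_point[OF Q(1) lin(1) fab(3)] monom_mult_in_point[OF Q(1) hf lin(2)] Q(3,4) by blast+
      from point_closed(2)[OF Q(1) G_mult[OF lin(1) fab(3)] G_mult[OF hf lin(2)] this]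
      show "monom (a * b - const (h q * h' q) * (f * f)) (d + d) \<in> q"
        by (simp add: algebra_simps const_simps)
    qed
    then have "openin (proj_topology G) W \<and> p \<in> W \<and> W \<subseteq> U \<and> f * f \<in> G (d + d) \<and> a * b \<in> G (d + d) \<and>
       (\<forall>q\<in>W. monom (f * f) (d + d) \<notin> q \<and> monom (a * b - const (h q * h' q) * (f * f)) (d + d) \<in> q)"
      using W fab by (simp add: G_mult)
    then show "\<exists>W d f g. openin (proj_topology G) W \<and> p \<in> W \<and> W \<subseteq> U \<and> f \<in> G d \<and> g \<in> G d \<and>
       (\<forall>q\<in>W. monom f d \<notin> q \<and> monom (g - const (h q * h' q) * f) d \<in> q)"
      by (intro exI)
  qed
next
  fix U h assume h: "h \<in> reg (Proj G) U"
  let ?U = "{x \<in> U. h x \<noteq> 0}"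
  have loc: "\<exists>W d f g. openin (proj_topology G) W \<and> p \<in> W \<and> W \<subseteq> ?U \<and> g \<in> G d \<and> f \<in> G d \<and>
      (\<forall>q\<in>W. monom g d \<notin> q \<and> monom (f - const (inverse (h q)) * g) d \<in> q)" if p: "p \<in> ?U" for p
  proof -
    from h p obtain W d f g where W: "openin (proj_topology G) W" "p \<in> W" "W \<subseteq> U" "f \<in> G d" "g \<in> G d"
      "\<forall>q\<in>W. monom f d \<notin> q \<and> monom (g - const (h q) * f) d \<in> q"
      unfolding reg_Proj by blast
    let ?W = "W \<inter> {q \<in> proj_points G. monom g d \<notin> q}"
    have g_iff: "monom g d \<notin> q \<longleftrightarrow> h q \<noteq> 0" if q: "q \<in> W" for q
    proof -
      have Q: "q \<in> proj_points G" using q W(1) openin_proj_subset by blast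
      show ?thesis
      proof (cases "h q = 0")
        case True
        then show ?thesis using W(6) q by (auto simp: const_simps)
      next
        case False
        have "monom g d \<notin> q"
        proof
          assume "monom g d \<in> q"
          moreover have "monom (g - const (h q) * f) d \<in> q" using W(6) q by blast
          ultimately have "monom (g - (g - const (h q) * f)) d \<in> q"
            by (rule point_closed(3)[OF Q W(5) G_diff[OF W(5) G_scale[OF W(4)]]])
          then have "monom (const (h q) * f) d \<in> q" by simp
          from point_closed(5)[OF Q W(4) False this] show False using W(6) q by blast
        qed
        with False show ?thesis by blast
      qed
    qed
    have "monom (f - const (inverse (h q)) * g) d \<in> q" if q: "q \<in> W" "h q \<noteq> 0" for q
    proof -
      have Q: "q \<in> proj_points G" using q W(1) openin_proj_subset by blast
      have "monom (const (- inverse (h q)) * (g - const (h q) * f)) d \<in> q"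
        using W q by (intro point_closed(4)[OF Q] G_diff G_scale) auto
      moreover have "const (- inverse (h q)) * (g - const (h q) * f) = f - const (inverse (h q)) * g"
      proof -
        have "const (inverse (h q)) * (const (h q) * f) = f"
          using q(2) by (simp add: mult.assoc[symmetric] const_simps(6)[symmetric]) (simp add: const_simps)
        then show ?thesis by (simp add: const_simps algebra_simps)
      qed
      ultimately show ?thesis by simp
    qed
    then have "openin (proj_topology G) ?W \<and> p \<in> ?W \<and> ?W \<subseteq> ?U \<and> g \<in> G d \<and> f \<in> G d \<and>
      (\<forall>q\<in>?W. monom g d \<notin> q \<and> monom (f - const (inverse (h q)) * g) d \<in> q)"
      using W p g_iff openin_proj_subset[OF W(1)] openin_principal'[OF W(5)] by auto
    then show ?thesis by (intro exI)
  qed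
  have "openin (proj_topology G) ?U"
  proof (subst openin_subopen, rule ballI)
    fix p assume "p \<in> ?U"
    from loc[OF this] show "\<exists>W. openin (proj_topology G) W \<and> p \<in> W \<and> W \<subseteq> ?U"
      by (elim exE conjE) (intro exI conjI)
  qed
  moreover have "\<exists>W d g f. openin (proj_topology G) W \<and> p \<in> W \<and> W \<subseteq> ?U \<and> g \<in> G d \<and> f \<in> G d \<and>
      (\<forall>q\<in>W. monom g d \<notin> q \<and> monom (f - const (inverse (h q)) * g) d \<in> q)" if "p \<in> ?U" for p
    using loc[OF that] by (elim exE conjE) (intro exI conjI)
  ultimately show "(\<lambda>x. inverse (h x)) \<in> reg (Proj G) ?U"
    unfolding reg_Proj by (intro conjI ballI)
qed

lemma fraction_regular:
  assumes f: "f \<in> G d" "d > 0" and g: "g \<in> G d"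
  shows "(\<lambda>q. SOME c. monom (g - const c * f) d \<in> q) \<in> reg (Proj G) {q \<in> proj_points G. monom f d \<notin> q}"
  unfolding reg_Proj
proof (intro conjI ballI)
  let ?W = "{q \<in> proj_points G. monom f d \<notin> q}"
  show W: "openin (proj_topology G) ?W" by (rule openin_principal[OF f])
  have val: "monom (g - const (SOME c. monom (g - const c * f) d \<in> q) * f) d \<in> q" if q: "q \<in> ?W" for q
  proof -
    have "\<exists>c. (d, g - const c * f) \<in> pieces q"
      using q in_pieces[OF f(1)] by (intro residue_field_complex f g) auto
    then have "\<exists>c. monom (g - const c * f) d \<in> q"
      unfolding pieces_def by blast
    then show ?thesis by (rule someI_ex)
  qed
  fix p assume p: "p \<in> ?W"
  have "monom f d \<notin> q" if "q \<in> ?W" for q using that by simp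
  then have "openin (proj_topology G) ?W \<and> p \<in> ?W \<and> ?W \<subseteq> ?W \<and> f \<in> G d \<and> g \<in> G d \<and>
      (\<forall>q\<in>?W. monom f d \<notin> q \<and> monom (g - const (SOME c. monom (g - const c * f) d \<in> q) * f) d \<in> q)"
    by (intro conjI ballI W p subset_refl f g val)
  then show "\<exists>W d' f' g'. openin (proj_topology G) W \<and> p \<in> W \<and> W \<subseteq> ?W \<and> f' \<in> G d' \<and> g' \<in> G d' \<and>
      (\<forall>q\<in>W. monom f' d' \<notin> q \<and> monom (g' - const (SOME c. monom (g - const c * f) d \<in> q) * f') d' \<in> q)"
    by (intro exI)
qed

lemma fraction_point_ideal:
  assumes "f \<in> G d" "g \<in> G d" "peval x f \<noteq> 0"
  shows "(SOME c. monom (g - const c * f) d \<in> point_ideal G x) = peval x g / peval x f"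
proof (rule some_equality)
  show "monom (g - const (peval x g / peval x f) * f) d \<in> point_ideal G x"
    using assms by (simp add: monom_point_ideal G_diff G_scale)
  fix c assume "monom (g - const c * f) d \<in> point_ideal G x"
  then show "c = peval x g / peval x f"
    using assms by (simp add: monom_point_ideal field_simps)
qed

text \<open>
  In regular coordinates \<open>e\<close>, the pullback of a fraction \<open>g / f\<close> is the quotient of two
  polynomials in \<open>e\<close>, hence regular.
\<close>

lemma morphism_into_Proj:
  assumes X: "function_sheaf X" and into: "\<And>y. y \<in> points X \<Longrightarrow> \<psi> y \<in> proj_points G"
    and loc: "\<And>y. y \<in> points X \<Longrightarrow> \<exists>U e. openin (zar X) U \<and> y \<in> U \<and> (\<forall>v. e v \<in> reg X U) \<and>
      (\<forall>z\<in>U. \<psi> z = point_ideal G (\<lambda>v. e v z))"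
  shows "morphism X (Proj G) \<psi>"
proof -
  interpret X: function_sheaf X by fact
  have cont: "continuous_map (zar X) (zar (Proj G)) \<psi>"
    unfolding zar_Proj proj_topology_def
  proof (rule continuous_on_generated_topo)
    show "\<psi> ` topspace (zar X) \<subseteq> \<Union> {{p \<in> proj_points G. monom f d \<notin> p} |d f. 0 < d \<and> f \<in> G d}"
      using into points_Proj
      unfolding points_def zar_Proj proj_topology_def topology_generated_by_topspace by blast
    fix S assume "S \<in> {{p \<in> proj_points G. monom f d \<notin> p} |d f. 0 < d \<and> f \<in> G d}"
    then obtain d f where S: "S = {p \<in> proj_points G. monom f d \<notin> p}" and f: "f \<in> G d" by blast
    show "openin (zar X) (\<psi> -` S \<inter> topspace (zar X))"
    proof (subst openin_subopen, safe)
      fix y assume y: "\<psi> y \<in> S" "y \<in> topspace (zar X)"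
      then obtain U e where U: "openin (zar X) U" "y \<in> U" "\<forall>v. e v \<in> reg X U"
          "\<forall>z\<in>U. \<psi> z = point_ideal G (\<lambda>v. e v z)"
        using loc[of y] unfolding points_def by blast
      let ?T = "{z \<in> U. peval (\<lambda>v. e v z) f \<noteq> 0}"
      have "openin (zar X) ?T"
        by (rule X.openin_nonzero[OF X.reg_peval]) (use U in auto)
      moreover have S_iff: "\<psi> z \<in> S \<longleftrightarrow> peval (\<lambda>v. e v z) f \<noteq> 0" if z: "z \<in> U" for z
      proof -
        have "\<psi> z \<in> proj_points G" using into openin_subset[OF U(1)] z unfolding points_def by blast
        then show ?thesis using U(4) z f unfolding S by (auto simp: monom_point_ideal)
      qed
      moreover have "y \<in> ?T" "?T \<subseteq> \<psi> -` S \<inter> topspace (zar X)"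
        using S_iff U(2) y openin_subset[OF U(1)] by auto
      ultimately show "\<exists>T. openin (zar X) T \<and> y \<in> T \<and> T \<subseteq> \<psi> -` S \<inter> topspace (zar X)" by blast
    qed
  qed
  moreover have "h \<circ> \<psi> \<in> reg X {y \<in> points X. \<psi> y \<in> V}" if h: "h \<in> reg (Proj G) V" for V h
  proof (rule X.reg_local)
    have V: "openin (proj_topology G) V" using h by (simp add: reg_Proj)
    show "openin (zar X) {y \<in> points X. \<psi> y \<in> V}"
      unfolding points_def by (rule openin_continuous_map_preimage[OF cont]) (simp add: zar_Proj V)
    fix y assume y: "y \<in> {y \<in> points X. \<psi> y \<in> V}"
    with h obtain W d f g where W: "openin (proj_topology G) W" "\<psi> y \<in> W" "W \<subseteq> V" "f \<in> G d" "g \<in> G d"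
      "\<forall>q\<in>W. monom f d \<notin> q \<and> monom (g - const (h q) * f) d \<in> q"
      unfolding reg_Proj by blast
    from y loc[of y] obtain U e where U: "openin (zar X) U" "y \<in> U" "\<forall>v. e v \<in> reg X U"
        "\<forall>z\<in>U. \<psi> z = point_ideal G (\<lambda>v. e v z)"
      by blast
    let ?T = "U \<inter> {y \<in> points X. \<psi> y \<in> W}"
    have T: "openin (zar X) ?T"
      unfolding points_def
      by (intro openin_Int U openin_continuous_map_preimage[OF cont]) (simp add: zar_Proj W)
    have val: "peval (\<lambda>v. e v z) f \<noteq> 0 \<and> h (\<psi> z) = peval (\<lambda>v. e v z) g / peval (\<lambda>v. e v z) f"
      if z: "z \<in> ?T" for z
    proof -
      have "monom f d \<notin> point_ideal G (\<lambda>v. e v z)"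
        "monom (g - const (h (\<psi> z)) * f) d \<in> point_ideal G (\<lambda>v. e v z)"
        using z W(6) U(4) by auto
      then show ?thesis using W(4) by (auto simp: monom_point_ideal field_simps)
    qed
    have "(\<lambda>z. peval (\<lambda>v. e v z) g / peval (\<lambda>v. e v z) f) \<in> reg X ?T"
      by (intro X.reg_divide X.reg_peval T X.reg_subset[OF _ T, of _ U]) (use U val in auto)
    then show "\<exists>V' g. openin (zar X) V' \<and> y \<in> V' \<and> g \<in> reg X V' \<and>
        (\<forall>z\<in>{y \<in> points X. \<psi> y \<in> V} \<inter> V'. (h \<circ> \<psi>) z = g z)"
      using T y U(2) W(2) val
      by - (rule exI[of _ ?T], rule exI[of _ "\<lambda>z. peval (\<lambda>v. e v z) g / peval (\<lambda>v. e v z) f"], auto)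
  qed
  ultimately show ?thesis
    unfolding morphism_def by blast
qed

end


section \<open>Products of projective spaces as Proj of a monomial algebra\<close>

definition multidegree :: "'k set \<Rightarrow> ('k \<Rightarrow> 'i set) \<Rightarrow> ('k \<Rightarrow> nat) \<Rightarrow> nat \<Rightarrow> ('i \<Rightarrow> nat) set" where
  "multidegree K J c d =
     {b. (\<forall>i. i \<notin> (\<Union>k\<in>K. J k) \<longrightarrow> b i = 0) \<and> (\<forall>k\<in>K. (\<Sum>i\<in>J k. b i) = d * c k)}"

definition move :: "('i \<Rightarrow> nat) \<Rightarrow> 'i \<Rightarrow> 'i \<Rightarrow> 'i \<Rightarrow> nat" where
  "move b s i = (\<lambda>j. (b j - (if j = s then 1 else 0)) + (if j = i then 1 else 0))"

text \<open>
  The monomials of degree \<open>d\<close> correspond to the exponent vectors \<open>b\<close> of multidegree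
  \<open>(d c k)\<^sub>k\<close> in blocks of variables \<open>J k\<close>, and at the point \<open>pt y\<close> they take the values
  \<open>\<Prod> y i ^ b i\<close>.  So Proj of the algebra is the product over \<open>k\<close> of the projective
  spaces with homogeneous coordinates \<open>y i\<close>, \<open>i \<in> J k\<close>, in a Segre-Veronese embedding.
\<close>

locale segre =
  fixes K :: "'k set" and J :: "'k \<Rightarrow> 'i set" and c :: "'k \<Rightarrow> nat"
    and mk :: "nat \<Rightarrow> ('i \<Rightarrow> nat) \<Rightarrow> ('v \<Rightarrow>\<^sub>0 nat)" and pt :: "('i \<Rightarrow> complex) \<Rightarrow> 'v \<Rightarrow> complex"
  assumes finite_K: "finite K" and finite_J: "k \<in> K \<Longrightarrow> finite (J k)"
    and disjoint: "disjoint_family_on J K" and c_pos: "k \<in> K \<Longrightarrow> c k > 0"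
    and mk_0: "mk 0 (\<lambda>_. 0) = 0"
    and mk_add: "mk d b + mk e b' = mk (d + e) (\<lambda>i. b i + b' i)"
    and pt_coordinate: "(\<exists>i. \<forall>y. pt y v = y i) \<or> (\<forall>y. pt y v = 1)"
    and mval_mk: "mval (pt y) (mk d b) = (\<Prod>i\<in>(\<Union>k\<in>K. J k). y i ^ b i)"
begin

abbreviation T :: "'i set" where "T \<equiv> (\<Union>k\<in>K. J k)"
abbreviation B :: "nat \<Rightarrow> ('i \<Rightarrow> nat) set" where "B \<equiv> multidegree K J c"

lemma finite_T: "finite T"
  using finite_K finite_J by blast

lemma block_unique: "i \<in> J k \<Longrightarrow> i \<in> J k' \<Longrightarrow> k \<in> K \<Longrightarrow> k' \<in> K \<Longrightarrow> k = k'"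
  using disjoint unfolding disjoint_family_on_def by blast

lemma multidegree_add: "b \<in> B d \<Longrightarrow> b' \<in> B e \<Longrightarrow> (\<lambda>i. b i + b' i) \<in> B (d + e)"
  by (simp add: multidegree_def sum.distrib add_mult_distrib)

lemma finite_multidegree: "finite (B d)"
proof (rule finite_subset)
  let ?N = "d * (\<Sum>k\<in>K. c k)"
  show "B d \<subseteq> {b. \<forall>i. (i \<in> T \<longrightarrow> b i \<in> {..?N}) \<and> (i \<notin> T \<longrightarrow> b i = 0)}"
  proof (intro subsetI CollectI allI conjI impI)
    fix b i assume b: "b \<in> B d"
    show "b i = 0" if "i \<notin> T" using b that by (simp add: multidegree_def)
    assume "i \<in> T"
    then obtain k where k: "k \<in> K" "i \<in> J k" by blast
    have "b i \<le> (\<Sum>i\<in>J k. b i)" using k finite_J by (intro member_le_sum) auto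
    also have "\<dots> = d * c k" using b k by (simp add: multidegree_def)
    also have "\<dots> \<le> ?N" using k finite_K by (intro mult_le_mono2 member_le_sum) auto
    finally show "b i \<in> {..?N}" by simp
  qed
  show "finite {b. \<forall>i. (i \<in> T \<longrightarrow> b i \<in> {..?N}) \<and> (i \<notin> T \<longrightarrow> b i = (0::nat))}"
    using finite_T by (intro finite_set_of_finite_funs) auto
qed

sublocale monomial_algebra "\<lambda>d. mk d ` B d"
proof
  have "(\<lambda>_. 0) \<in> B 0" by (simp add: multidegree_def)
  then show "0 \<in> mk 0 ` B 0" using mk_0 by (metis imageI)
  show "m + m' \<in> mk (d + e) ` B (d + e)" if "m \<in> mk d ` B d" "m' \<in> mk e ` B e" for m m' d e
    using that by (auto simp: mk_add intro!: imageI multidegree_add)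
qed (simp add: finite_multidegree)

definition M :: "nat \<Rightarrow> ('i \<Rightarrow> nat) \<Rightarrow> 'v cpoly" where
  "M d b = Poly_Mapping.single (mk d b) 1"

definition w :: "('i \<Rightarrow> complex) \<Rightarrow> ('i \<Rightarrow> nat) \<Rightarrow> complex" where
  "w y b = (\<Prod>i\<in>T. y i ^ b i)"

definition admissible :: "('i \<Rightarrow> complex) \<Rightarrow> bool" where
  "admissible y \<longleftrightarrow> (\<forall>k\<in>K. \<exists>i\<in>J k. y i \<noteq> 0)"

lemma M_G: "b \<in> B d \<Longrightarrow> M d b \<in> G d"
  unfolding M_def by (rule G_single) blast

lemma M_mult: "M d b * M e b' = M (d + e) (\<lambda>i. b i + b' i)"
  by (simp add: M_def mult_single mk_add)

lemma M_power: "M d b ^ n = M (n * d) (\<lambda>i. n * b i)"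
proof (induction n)
  case 0
  show ?case by (simp add: M_def mk_0 flip: single_one)
qed (simp add: M_mult)

lemma peval_M: "peval (pt y) (M d b) = w y b"
  by (simp add: M_def w_def mval_mk)

lemma w_add: "w y (\<lambda>i. b i + b' i) = w y b * w y b'"
  by (simp add: w_def power_add prod.distrib)

lemma move_multidegree:
  assumes b: "b \<in> B d" and k: "k \<in> K" "s \<in> J k" "i \<in> J k" and pos: "b s > 0"
  shows "move b s i \<in> B d"
proof -
  have sum: "(\<Sum>j\<in>J k'. move b s i j) = (\<Sum>j\<in>J k'. b j)" if k': "k' \<in> K" for k'
  proof -
    let ?e = "\<lambda>s j. if j = s then 1 else (0::nat)"
    have pt: "move b s i j + ?e s j = b j + ?e i j" for j
      using pos by (auto simp: move_def)
    have "(\<Sum>j\<in>J k'. move b s i j) + (\<Sum>j\<in>J k'. ?e s j) = (\<Sum>j\<in>J k'. b j) + (\<Sum>j\<in>J k'. ?e i j)"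
      by (simp only: sum.distrib[symmetric] pt)
    moreover have "(\<Sum>j\<in>J k'. ?e s j) = (\<Sum>j\<in>J k'. ?e i j)"
    proof (cases "k' = k")
      case True
      then show ?thesis using k finite_J by simp
    next
      case False
      then have "s \<notin> J k'" "i \<notin> J k'" using block_unique k k' by blast+
      then show ?thesis using finite_J[OF k'] by simp
    qed
    ultimately show ?thesis by simp
  qed
  have "move b s i j = 0" if "j \<notin> T" for j
    using that b k by (auto simp: move_def multidegree_def)
  then show ?thesis using b by (simp add: multidegree_def sum)
qed

lemma w_move:
  assumes "s \<in> T" "i \<in> T" "b s > 0"
  shows "w y (move b s i) * y s = w y b * y i"
proof -
  let ?e = "\<lambda>s j. if j = s then 1 else (0::nat)"
  have e: "w y (?e s) = y s" if "s \<in> T" for s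
  proof -
    have "w y (?e s) = (\<Prod>j\<in>T. if j = s then y j else 1)"
      unfolding w_def by (rule prod.cong) auto
    then show ?thesis using that finite_T by simp
  qed
  have "(\<lambda>j. move b s i j + ?e s j) = (\<lambda>j. b j + ?e i j)"
    using assms(3) by (auto simp: move_def)
  then have "w y (move b s i) * w y (?e s) = w y b * w y (?e i)"
    by (simp only: w_add[symmetric])
  then show ?thesis using assms e by simp
qed

lemma move_add:
  assumes "b i > 0" "b' s > 0"
  shows "(\<lambda>j. move b i s j + move b' s i j) = (\<lambda>j. b j + b' j)"
  using assms by (auto simp: move_def)


subsection \<open>Vertex monomials\<close>

text \<open>
  A monomial of degree one that involves a single variable of every block is a vertex of the Newton
  polytope, a product of simplices.  Its non-vanishing locus is the product of standard
  affine charts of the projective spaces.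
\<close>

definition selector :: "('k \<Rightarrow> 'i) \<Rightarrow> bool" where
  "selector \<tau> \<longleftrightarrow> (\<forall>k\<in>K. \<tau> k \<in> J k)"

definition vertex :: "('k \<Rightarrow> 'i) \<Rightarrow> 'i \<Rightarrow> nat" where
  "vertex \<tau> i = (\<Sum>k\<in>K. if i = \<tau> k then c k else 0)"

lemma selector_in_block: "selector \<tau> \<Longrightarrow> k \<in> K \<Longrightarrow> k' \<in> K \<Longrightarrow> \<tau> k' \<in> J k \<longleftrightarrow> k' = k"
  unfolding selector_def using block_unique by blast

lemma vertex_at: "selector \<tau> \<Longrightarrow> k \<in> K \<Longrightarrow> vertex \<tau> (\<tau> k) = c k"
proof -
  assume \<tau>: "selector \<tau>" and k: "k \<in> K"
  have "(\<tau> k = \<tau> k') = (k' = k)" if "k' \<in> K" for k'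
    using selector_in_block[OF \<tau> k that] selector_in_block[OF \<tau> k k] by metis
  then have "vertex \<tau> (\<tau> k) = (\<Sum>k'\<in>K. if k' = k then c k' else 0)"
    unfolding vertex_def by (intro sum.cong) auto
  then show ?thesis using k finite_K by simp
qed

lemma vertex_eq_0: "i \<notin> \<tau> ` K \<Longrightarrow> vertex \<tau> i = 0"
  unfolding vertex_def by (rule sum.neutral) auto

lemma vertex_multidegree:
  assumes \<tau>: "selector \<tau>"
  shows "vertex \<tau> \<in> B 1"
proof -
  have "(\<Sum>i\<in>J k. vertex \<tau> i) = c k" if k: "k \<in> K" for k
  proof -
    have "(\<Sum>i\<in>J k. vertex \<tau> i) = (\<Sum>i\<in>{\<tau> k}. vertex \<tau> i)"
    proof (rule sum.mono_neutral_right[OF finite_J[OF k]])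
      show "{\<tau> k} \<subseteq> J k" using \<tau> k by (auto simp: selector_def)
      show "\<forall>i\<in>J k - {\<tau> k}. vertex \<tau> i = 0"
        using selector_in_block[OF \<tau> k] by (intro ballI vertex_eq_0) auto
    qed
    then show ?thesis using vertex_at[OF \<tau> k] by simp
  qed
  moreover have "vertex \<tau> i = 0" if "i \<notin> T" for i
    using that \<tau> by (intro vertex_eq_0) (auto simp: selector_def)
  ultimately show ?thesis by (simp add: multidegree_def)
qed

lemma w_vertex:
  assumes \<tau>: "selector \<tau>"
  shows "w y (vertex \<tau>) = (\<Prod>k\<in>K. y (\<tau> k) ^ c k)"
proof -
  have "w y (vertex \<tau>) = (\<Prod>k\<in>K. \<Prod>i\<in>T. y i ^ (if i = \<tau> k then c k else 0))"
    unfolding w_def vertex_def by (subst prod.swap) (simp add: power_sum)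
  also have "\<dots> = (\<Prod>k\<in>K. y (\<tau> k) ^ c k)"
  proof (rule prod.cong[OF refl])
    fix k assume k: "k \<in> K"
    have "(\<Prod>i\<in>T. y i ^ (if i = \<tau> k then c k else 0)) = (\<Prod>i\<in>T. if i = \<tau> k then y i ^ c k else 1)"
      by (rule prod.cong) auto
    then show "(\<Prod>i\<in>T. y i ^ (if i = \<tau> k then c k else 0)) = y (\<tau> k) ^ c k"
      using \<tau> k finite_T by (auto simp: selector_def)
  qed
  finally show ?thesis .
qed

lemma w_vertex_nonzero: "selector \<tau> \<Longrightarrow> w y (vertex \<tau>) \<noteq> 0 \<longleftrightarrow> (\<forall>k\<in>K. y (\<tau> k) \<noteq> 0)"
  using finite_K c_pos by (auto simp: w_vertex)

lemma admissible_selector: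
  assumes "admissible y"
  obtains \<tau> where "selector \<tau>" "\<And>k. k \<in> K \<Longrightarrow> y (\<tau> k) \<noteq> 0"
proof -
  from assms have "\<forall>k\<in>K. \<exists>i. i \<in> J k \<and> y i \<noteq> 0" unfolding admissible_def by blast
  then obtain \<tau> where "\<forall>k\<in>K. \<tau> k \<in> J k \<and> y (\<tau> k) \<noteq> 0" using bchoice by metis
  with that show ?thesis unfolding selector_def by blast
qed

lemma admissible_nonzero_at: "admissible y \<Longrightarrow> nonzero_at (pt y)"
proof -
  assume "admissible y"
  then obtain \<tau> where \<tau>: "selector \<tau>" "\<And>k. k \<in> K \<Longrightarrow> y (\<tau> k) \<noteq> 0" by (rule admissible_selector) blast
  then have "peval (pt y) (M 1 (vertex \<tau>)) \<noteq> 0" using w_vertex_nonzero by (simp add: peval_M)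
  then show ?thesis using M_G[OF vertex_multidegree[OF \<tau>(1)]] unfolding nonzero_at_def by (intro exI[of _ 1]) auto
qed


subsection \<open>Homogeneous coordinates of a point\<close>

lemma monomial_outside_point:
  assumes p: "p \<in> proj_points G"
  obtains d b where "d > 0" "b \<in> B d" "(d, M d b) \<notin> pieces p"
proof -
  note prime = proj_points_pieces(1)[OF p]
  obtain d f where f: "d > 0" "f \<in> G d" "(d, f) \<notin> pieces p" using hprimeD(3)[OF prime] by blast
  have "\<exists>m\<in>Poly_Mapping.keys f. (d, Poly_Mapping.single m 1) \<notin> pieces p"
  proof (rule ccontr)
    assume "\<not> ?thesis"
    then have "(d, \<Sum>m\<in>Poly_Mapping.keys f. const (Poly_Mapping.lookup f m) * Poly_Mapping.single m 1) \<in> pieces p"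
      by (intro hideal_sum hideal_scale hprimeD(1)[OF prime]) blast
    then show False using f(3) by (simp add: single_eq_const_mult[symmetric] sum_of_monomials)
  qed
  then obtain m where "m \<in> Poly_Mapping.keys f" "(d, Poly_Mapping.single m 1) \<notin> pieces p" by blast
  moreover from this(1) f(2) obtain b where "b \<in> B d" "m = mk d b" by (auto simp: spanned_def)
  ultimately show ?thesis using that[OF f(1)] by (simp add: M_def)
qed

text \<open>
  A monomial outside of the point involves a variable of every block.  A large power of it is
  divisible by the vertex monomial of these variables, which is therefore outside of the point too.
\<close>

lemma vertex_outside_point:
  assumes p: "p \<in> proj_points G"
  obtains \<tau> where "selector \<tau>" "(1, M 1 (vertex \<tau>)) \<notin> pieces p"
proof -
  note prime = proj_points_pieces(1)[OF p]
  obtain d b where b: "d > 0" "b \<in> B d" "(d, M d b) \<notin> pieces p"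
    by (rule monomial_outside_point[OF p])
  have "\<forall>k\<in>K. \<exists>i. i \<in> J k \<and> b i > 0"
  proof
    fix k assume k: "k \<in> K"
    have "(\<Sum>i\<in>J k. b i) = d * c k" using b(2) k by (simp add: multidegree_def)
    then have "(\<Sum>i\<in>J k. b i) \<noteq> 0" using b(1) c_pos[OF k] by simp
    then show "\<exists>i. i \<in> J k \<and> b i > 0" by (meson neq0_conv sum.neutral)
  qed
  then obtain \<tau> where \<tau>: "\<forall>k\<in>K. \<tau> k \<in> J k \<and> b (\<tau> k) > 0" using bchoice by metis
  then have sel: "selector \<tau>" by (simp add: selector_def)
  note vB = vertex_multidegree[OF sel]
  define N where "N = Suc (\<Sum>k\<in>K. c k)"
  have le: "vertex \<tau> i \<le> N * b i" for i
  proof (cases "i \<in> \<tau> ` K")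
    case True
    then obtain k where k: "k \<in> K" "i = \<tau> k" by blast
    have "vertex \<tau> i = c k" using vertex_at[OF sel] k by simp
    also have "\<dots> \<le> N" unfolding N_def using k finite_K by (intro le_SucI member_le_sum) auto
    also have "\<dots> \<le> N * b i" using \<tau> k mult_le_mono2[of 1 "b i" N] by (auto simp: Suc_le_eq)
    finally show ?thesis .
  qed (simp add: vertex_eq_0)
  define r where "r = (\<lambda>i. N * b i - vertex \<tau> i)"
  have "N * d \<ge> 1" using b(1) by (simp add: N_def)
  have "r \<in> B (N * d - 1)"
  proof -
    have "(\<Sum>i\<in>J k. r i) = (N * d - 1) * c k" if k: "k \<in> K" for k
    proof -
      have "(\<Sum>i\<in>J k. r i) = (\<Sum>i\<in>J k. N * b i) - (\<Sum>i\<in>J k. vertex \<tau> i)"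
        unfolding r_def by (rule sum_subtractf_nat) (rule le)
      also have "(\<Sum>i\<in>J k. N * b i) = N * (d * c k)"
        using b(2) k by (simp add: multidegree_def flip: sum_distrib_left)
      also have "(\<Sum>i\<in>J k. vertex \<tau> i) = c k" using vB k by (simp add: multidegree_def)
      finally show ?thesis by (simp add: diff_mult_distrib mult.assoc)
    qed
    moreover have "r i = 0" if "i \<notin> T" for i using that b(2) by (simp add: r_def multidegree_def)
    ultimately show ?thesis by (simp add: multidegree_def)
  qed
  moreover have "(\<lambda>i. vertex \<tau> i + r i) = (\<lambda>i. N * b i)" using le by (auto simp: r_def)
  ultimately have "M d b ^ N = M 1 (vertex \<tau>) * M (N * d - 1) r"
    using \<open>N * d \<ge> 1\<close> by (simp add: M_power M_mult)
  moreover have "(N * d, M d b ^ N) \<notin> pieces p" by (rule hprime_power[OF prime M_G[OF b(2)] b(3)])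
  ultimately have "(1, M 1 (vertex \<tau>)) \<notin> pieces p"
    using hprime_mult_iff[OF prime M_G[OF vB] M_G[OF \<open>r \<in> B (N * d - 1)\<close>]] \<open>N * d \<ge> 1\<close> by auto
  with sel that show ?thesis by blast
qed

text \<open>
  With \<open>M\<^sub>0\<close> a vertex monomial outside of the point, the coordinate \<open>y i\<close> is the value at
  the point of the fraction that is obtained by replacing one factor of \<open>M\<^sub>0\<close> by the
  variable \<open>i\<close> of the same block.  Replacing the other factors one by one expresses the value of
  every monomial in terms of the \<open>y i\<close>.
\<close>

theorem point_coordinates:
  assumes p: "p \<in> proj_points G"
  obtains y where "admissible y" "p = point_ideal G (pt y)"
proof -
  let ?P = "pieces p"
  have prime: "hprime ?P" by (rule proj_points_pieces(1)[OF p])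
  note ideal = hprimeD(1)[OF prime]
  obtain \<tau> where \<tau>: "selector \<tau>" "(1, M 1 (vertex \<tau>)) \<notin> ?P"
    by (rule vertex_outside_point[OF p])
  let ?v = "vertex \<tau>"
  define M0 where "M0 = M 1 ?v"
  have vB: "?v \<in> B 1" by (rule vertex_multidegree[OF \<tau>(1)])
  have M0: "M0 \<in> G 1" "(1, M0) \<notin> ?P" using M_G[OF vB] \<tau>(2) by (simp_all add: M0_def)
  have \<tau>J: "\<tau> k \<in> J k" if "k \<in> K" for k using \<tau>(1) that by (simp add: selector_def)
  have v_pos: "?v (\<tau> k) > 0" if "k \<in> K" for k using vertex_at[OF \<tau>(1) that] c_pos[OF that] by simp
  have vmB: "move ?v (\<tau> k) i \<in> B 1" if "k \<in> K" "i \<in> J k" for k i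
    using move_multidegree[OF vB that(1) \<tau>J that(2) v_pos] that(1) by blast
  have "\<forall>i\<in>T. \<exists>a. \<forall>k\<in>K. i \<in> J k \<longrightarrow>
      (1, M 1 (move ?v (\<tau> k) i) - const a * M0) \<in> ?P \<and> (i = \<tau> k \<longrightarrow> a = 1)"
  proof
    fix i assume "i \<in> T"
    then obtain k where k: "k \<in> K" "i \<in> J k" by blast
    have k': "k' = k" if "k' \<in> K" "i \<in> J k'" for k'
      using block_unique[OF that(2) k(2) that(1) k(1)] .
    have "\<exists>a. (1, M 1 (move ?v (\<tau> k) i) - const a * M0) \<in> ?P \<and> (i = \<tau> k \<longrightarrow> a = 1)"
    proof (cases "i = \<tau> k")
      case True
      then have "move ?v (\<tau> k) i = ?v" using v_pos[OF k(1)] by (auto simp: move_def)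
      then show ?thesis using hidealD(2)[OF ideal] by (intro exI[of _ 1]) (simp add: M0_def const_simps)
    next
      case False
      then show ?thesis using residue_field_complex[OF p M0(1) _ M0(2) M_G[OF vmB[OF k]]] by simp
    qed
    then obtain a where "(1, M 1 (move ?v (\<tau> k) i) - const a * M0) \<in> ?P \<and> (i = \<tau> k \<longrightarrow> a = 1)" ..
    then have "\<forall>k'\<in>K. i \<in> J k' \<longrightarrow>
      (1, M 1 (move ?v (\<tau> k') i) - const a * M0) \<in> ?P \<and> (i = \<tau> k' \<longrightarrow> a = 1)"
      using k' by auto
    then show "\<exists>a. \<forall>k\<in>K. i \<in> J k \<longrightarrow>
      (1, M 1 (move ?v (\<tau> k) i) - const a * M0) \<in> ?P \<and> (i = \<tau> k \<longrightarrow> a = 1)" by (rule exI)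
  qed
  from bchoice[OF this] obtain y where y: "\<And>i k. k \<in> K \<Longrightarrow> i \<in> J k \<Longrightarrow>
      (1, M 1 (move ?v (\<tau> k) i) - const (y i) * M0) \<in> ?P \<and> (i = \<tau> k \<longrightarrow> y i = 1)"
    by blast
  have y\<tau>: "y (\<tau> k) = 1" if "k \<in> K" for k using y[OF that \<tau>J[OF that]] by simp
  have M0d: "M0 ^ d \<in> G d" for d using G_power[OF M0(1), of d] by simp
  let ?T = "T - \<tau> ` K"
  have val: "(d, M d b - const (w y b) * M0 ^ d) \<in> ?P" if "b \<in> B d" for d b
    using that
  proof (induction "\<Sum>i\<in>?T. b i" arbitrary: b rule: less_induct)
    case (less b)
    show ?case
    proof (cases "\<forall>i\<in>?T. b i = 0")
      case True
      have "b i = d * ?v i" for i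
      proof (cases "i \<in> \<tau> ` K")
        case i: True
        then obtain k where k: "k \<in> K" "i = \<tau> k" by blast
        have "(\<Sum>j\<in>J k. b j) = (\<Sum>j\<in>{\<tau> k}. b j)"
        proof (rule sum.mono_neutral_right[OF finite_J[OF k(1)]])
          show "{\<tau> k} \<subseteq> J k" using \<tau>J k by simp
          show "\<forall>i\<in>J k - {\<tau> k}. b i = 0"
            using True k selector_in_block[OF \<tau>(1) k(1)] by blast
        qed
        then show ?thesis using less.prems k vertex_at[OF \<tau>(1) k(1)] by (simp add: multidegree_def)
      next
        case False
        have "b i = 0" using True less.prems False by (cases "i \<in> T") (auto simp: multidegree_def)
        then show ?thesis using vertex_eq_0[OF False] by simp
      qed
      then have "b = (\<lambda>i. d * ?v i)" by (rule ext)
      then have "M d b = M0 ^ d" by (simp add: M0_def M_power)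
      moreover have "w y b = 1"
        unfolding w_def
      proof (intro prod.neutral ballI)
        fix i assume "i \<in> T"
        then show "y i ^ b i = 1" using True y\<tau> by (cases "i \<in> \<tau> ` K") auto
      qed
      ultimately show ?thesis using hidealD(2)[OF ideal] by (simp add: const_simps)
    next
      case False
      then obtain i where i: "i \<in> T" "i \<notin> \<tau> ` K" "b i > 0" by blast
      then obtain k where k: "k \<in> K" "i \<in> J k" by blast
      let ?b = "move b i (\<tau> k)" and ?m = "M 1 (move ?v (\<tau> k) i)"
      have bB: "?b \<in> B d" by (rule move_multidegree[OF less.prems k(1,2) \<tau>J[OF k(1)] i(3)])
      have "(\<Sum>j\<in>?T. ?b j) < (\<Sum>j\<in>?T. b j)"
        using finite_T i k(1) by (intro sum_strict_mono_ex1) (auto simp: move_def intro!: bexI[of _ i])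
      from less.hyps[OF this bB] have IH: "(d, M d ?b - const (w y ?b) * M0 ^ d) \<in> ?P" .
      have "w y b = w y ?b * y i"
      proof -
        have "\<tau> k \<in> T" using \<tau>J[OF k(1)] k(1) by blast
        from w_move[of i "\<tau> k" b y, OF i(1) this i(3)] show ?thesis
          using y\<tau>[OF k(1)] by simp
      qed
      moreover have "M d b * M0 = M d ?b * ?m"
        unfolding M0_def M_mult using move_add[of b i ?v "\<tau> k", OF i(3) v_pos[OF k(1)]] by simp
      ultimately have "(M d b - const (w y b) * M0 ^ d) * M0
          = (M d ?b - const (w y ?b) * M0 ^ d) * ?m + (const (w y ?b) * M0 ^ d) * (?m - const (y i) * M0)"
        by (simp add: algebra_simps const_simps)
      moreover have "(d + 1, (M d ?b - const (w y ?b) * M0 ^ d) * ?m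
            + (const (w y ?b) * M0 ^ d) * (?m - const (y i) * M0)) \<in> ?P"
        using y[OF k]
        by (intro hidealD(3)[OF ideal] hideal_mult_right[OF ideal IH] M_G vmB k
            hidealD(4)[OF ideal G_scale[OF M0d]]) blast
      ultimately have "(d + 1, (M d b - const (w y b) * M0 ^ d) * M0) \<in> ?P" by simp
      moreover have "M d b - const (w y b) * M0 ^ d \<in> G d" by (intro G_diff G_scale M_G M0d less.prems)
      ultimately show ?thesis using hprimeD(2)[OF prime _ M0(1)] M0(2) by blast
    qed
  qed
  have "p = point_ideal G (pt y)"
  proof (rule point_idealI[OF p M0])
    show "peval (pt y) M0 = 1"
      unfolding M0_def peval_M w_vertex[OF \<tau>(1)] by (simp add: y\<tau>)
    fix d m assume "m \<in> mk d ` B d"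
    then obtain b where "b \<in> B d" "m = mk d b" by blast
    with val[OF this(1)] show "(d, Poly_Mapping.single m 1 - const (mval (pt y) m) * M0 ^ d) \<in> ?P"
      by (simp add: M_def w_def mval_mk)
  qed
  moreover have "admissible y" unfolding admissible_def
  proof
    fix k assume "k \<in> K"
    then show "\<exists>i\<in>J k. y i \<noteq> 0" using y\<tau> \<tau>J by (intro bexI[of _ "\<tau> k"]) auto
  qed
  ultimately show ?thesis using that by blast
qed

lemma point_in_proj: "admissible y \<Longrightarrow> point_ideal G (pt y) \<in> proj_points G"
  by (intro point_ideal_in_proj admissible_nonzero_at)

text \<open>
  On the piece of degree \<open>d\<close>, scaling the coordinates of each block by \<open>l k\<close> multiplies all values by
  the same power \<open>(\<Prod>k\<in>K. l k ^ c k) ^ d\<close>.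
\<close>

lemma point_ideal_scale:
  assumes l: "\<And>k. k \<in> K \<Longrightarrow> l k \<noteq> 0" and y: "\<And>k i. k \<in> K \<Longrightarrow> i \<in> J k \<Longrightarrow> y' i = l k * y i"
  shows "point_ideal G (pt y') = point_ideal G (pt y)"
proof -
  define u where "u = (\<Prod>k\<in>K. l k ^ c k)"
  have u: "u \<noteq> 0" unfolding u_def using l finite_K by simp
  have w: "w y' b = u ^ d * w y b" if b: "b \<in> B d" for d b
  proof -
    have "(\<Prod>i\<in>T. f i) = (\<Prod>k\<in>K. \<Prod>i\<in>J k. f i)" for f :: "'i \<Rightarrow> complex"
      using finite_K finite_J block_unique by (intro prod.UNION_disjoint) auto
    note split = this
    have "w y' b = (\<Prod>k\<in>K. \<Prod>i\<in>J k. l k ^ b i * y i ^ b i)"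
      unfolding w_def split by (intro prod.cong refl) (simp add: y power_mult_distrib)
    also have "\<dots> = (\<Prod>k\<in>K. (\<Prod>i\<in>J k. l k ^ b i)) * w y b"
      unfolding w_def split by (simp add: prod.distrib)
    also have "(\<Prod>k\<in>K. (\<Prod>i\<in>J k. l k ^ b i)) = (\<Prod>k\<in>K. (l k ^ c k) ^ d)"
      using b by (intro prod.cong refl) (simp add: multidegree_def power_sum[symmetric] power_mult[symmetric] mult.commute)
    also have "\<dots> = u ^ d" by (simp add: u_def prod_power_distrib)
    finally show ?thesis .
  qed
  have "peval (pt y') f = u ^ d * peval (pt y) f" if "f \<in> G d" for f d
  proof -
    have "mval (pt y') m = u ^ d * mval (pt y) m" if "m \<in> Poly_Mapping.keys f" for m
      using \<open>f \<in> G d\<close> that w by (auto simp: spanned_def mval_mk w_def dest!: subsetD)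
    then show ?thesis
      unfolding peval_def mval_def[symmetric] by (simp add: sum_distrib_left mult.left_commute)
  qed
  with u have "f \<in> G d \<Longrightarrow> peval (pt y') f = 0 \<longleftrightarrow> peval (pt y) f = 0" for f d by simp
  then show ?thesis unfolding point_ideal_def by blast
qed

text \<open>
  Ratios of coordinates of one block are values of fractions of degree one with a vertex monomial as
  denominator, so they are determined by the point.
\<close>

lemma point_ideal_eqD:
  assumes y: "admissible y" and eq: "point_ideal G (pt y) = point_ideal G (pt y')"
  obtains l where "\<And>k. k \<in> K \<Longrightarrow> l k \<noteq> 0" "\<And>k i. k \<in> K \<Longrightarrow> i \<in> J k \<Longrightarrow> y' i = l k * y i"
proof -
  obtain \<tau> where \<tau>: "selector \<tau>" "\<And>k. k \<in> K \<Longrightarrow> y (\<tau> k) \<noteq> 0" using y by (rule admissible_selector) blast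
  let ?v = "vertex \<tau>"
  have vB: "?v \<in> B 1" by (rule vertex_multidegree[OF \<tau>(1)])
  have zero_iff: "peval (pt y) f = 0 \<longleftrightarrow> peval (pt y') f = 0" if "f \<in> G 1" for f
    using eq monom_point_ideal[of f 1] that by blast
  have wy: "w y ?v \<noteq> 0" using \<tau> w_vertex_nonzero by blast
  then have wy': "w y' ?v \<noteq> 0" using zero_iff[OF M_G[OF vB]] by (simp add: peval_M)
  then have y': "y' (\<tau> k) \<noteq> 0" if "k \<in> K" for k using w_vertex_nonzero[OF \<tau>(1)] that by blast
  have "y' i = (y' (\<tau> k) / y (\<tau> k)) * y i" if k: "k \<in> K" "i \<in> J k" for k i
  proof -
    have \<tau>k: "\<tau> k \<in> J k" using \<tau>(1) k(1) by (simp add: selector_def)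
    have pos: "?v (\<tau> k) > 0" using vertex_at[OF \<tau>(1) k(1)] c_pos[OF k(1)] by simp
    let ?m = "move ?v (\<tau> k) i"
    have mB: "?m \<in> B 1" by (rule move_multidegree[OF vB k(1) \<tau>k k(2) pos])
    have T: "\<tau> k \<in> T" "i \<in> T" using k \<tau>k by blast+
    have "w y ?m = w y ?v * (y i / y (\<tau> k))" "w y' ?m = w y' ?v * (y' i / y' (\<tau> k))"
      using w_move[of "\<tau> k" i ?v y, OF T pos] w_move[of "\<tau> k" i ?v y', OF T pos] \<tau>(2)[OF k(1)] y'[OF k(1)]
      by (simp_all add: field_simps)
    moreover have "M 1 ?m - const (y i / y (\<tau> k)) * M 1 ?v \<in> G 1"
      by (intro G_diff G_scale M_G vB mB)
    from zero_iff[OF this] have "w y ?m - y i / y (\<tau> k) * w y ?v = 0 \<longleftrightarrow> w y' ?m - y i / y (\<tau> k) * w y' ?v = 0"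
      by (simp add: peval_M)
    ultimately have "w y' ?v * (y' i / y' (\<tau> k)) = w y' ?v * (y i / y (\<tau> k))"
      by (simp add: mult.commute)
    then have "y' i / y' (\<tau> k) = y i / y (\<tau> k)" using mult_left_cancel[OF wy'] by blast
    then show ?thesis using y'[OF k(1)] by (simp add: field_simps)
  qed
  moreover have "y' (\<tau> k) / y (\<tau> k) \<noteq> 0" if "k \<in> K" for k using y'[OF that] \<tau>(2)[OF that] by simp
  ultimately show ?thesis using that[of "\<lambda>k. y' (\<tau> k) / y (\<tau> k)"] by blast
qed

text \<open>
  On the chart of a vertex monomial, dividing the coordinates of each block by the selected one makes
  them values of fractions, and these are regular.
\<close>

lemma local_coordinates:
  assumes p: "p \<in> proj_points G"
  obtains U e where "openin (zar (Proj G)) U" "p \<in> U" "\<And>i. e i \<in> reg (Proj G) U"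
    "\<And>q. q \<in> U \<Longrightarrow> admissible (\<lambda>i. e i q) \<and> q = point_ideal G (pt (\<lambda>i. e i q))"
proof -
  obtain \<tau> where \<tau>: "selector \<tau>" "(1, M 1 (vertex \<tau>)) \<notin> pieces p"
    by (rule vertex_outside_point[OF p])
  let ?v = "vertex \<tau>"
  have vB: "?v \<in> B 1" by (rule vertex_multidegree[OF \<tau>(1)])
  define U where "U = {q \<in> proj_points G. monom (M 1 ?v) 1 \<notin> q}"
  have U: "openin (zar (Proj G)) U"
    unfolding U_def zar_Proj by (rule openin_principal[OF M_G[OF vB]]) simp
  define lev where "lev i = (SOME k. k \<in> K \<and> i \<in> J k)" for i
  have lev: "lev i \<in> K" "i \<in> J (lev i)" if "i \<in> T" for i
  proof -
    have "\<exists>k. k \<in> K \<and> i \<in> J k" using that by blast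
    then have "lev i \<in> K \<and> i \<in> J (lev i)" unfolding lev_def by (rule someI_ex)
    then show "lev i \<in> K" "i \<in> J (lev i)" by blast+
  qed
  let ?m = "\<lambda>i. move ?v (\<tau> (lev i)) i"
  have \<tau>J: "\<tau> k \<in> J k" if "k \<in> K" for k using \<tau>(1) that by (simp add: selector_def)
  have v_pos: "?v (\<tau> k) > 0" if "k \<in> K" for k using vertex_at[OF \<tau>(1) that] c_pos[OF that] by simp
  have mB: "?m i \<in> B 1" if "i \<in> T" for i
    by (rule move_multidegree[OF vB lev(1)[OF that] \<tau>J[OF lev(1)[OF that]] lev(2)[OF that] v_pos[OF lev(1)[OF that]]])
  define e where "e i = (if i \<in> T then (\<lambda>q. SOME a. monom (M 1 (?m i) - const a * M 1 ?v) 1 \<in> q) else (\<lambda>_. 0))" for i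
  interpret sheaf: function_sheaf "Proj G" by (rule function_sheaf_Proj)
  have "e i \<in> reg (Proj G) U" for i
  proof (cases "i \<in> T")
    case True
    then show ?thesis
      unfolding e_def U_def using fraction_regular[OF M_G[OF vB] _ M_G[OF mB[OF True]]] by simp
  next
    case False
    then show ?thesis unfolding e_def using sheaf.reg_const[OF U, of 0] by (simp only: if_False)
  qed
  moreover have "admissible (\<lambda>i. e i q) \<and> q = point_ideal G (pt (\<lambda>i. e i q))" if q: "q \<in> U" for q
  proof -
    from q have qG: "q \<in> proj_points G" "monom (M 1 ?v) 1 \<notin> q" by (simp_all add: U_def)
    obtain y where y: "admissible y" "q = point_ideal G (pt y)" by (rule point_coordinates[OF qG(1)])
    have wv: "w y ?v \<noteq> 0" using qG(2) M_G[OF vB] unfolding y(2) by (simp add: monom_point_ideal peval_M)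
    then have y\<tau>: "y (\<tau> k) \<noteq> 0" if "k \<in> K" for k using w_vertex_nonzero[OF \<tau>(1)] that by blast
    have e: "e i q = inverse (y (\<tau> k)) * y i" if k: "k \<in> K" "i \<in> J k" for k i
    proof -
      have i: "i \<in> T" using k by blast
      have [simp]: "lev i = k" using lev[OF i] k block_unique by blast
      have "e i q = w y (?m i) / w y ?v"
        unfolding e_def y(2) using i fraction_point_ideal[OF M_G[OF vB] M_G[OF mB[OF i]], of "pt y"] wv
        by (simp add: peval_M)
      also have "\<dots> = inverse (y (\<tau> k)) * y i"
        using w_move[of "\<tau> k" i ?v y] i \<tau>J[OF k(1)] k(1) v_pos[OF k(1)] wv y\<tau>[OF k(1)]
        by (auto simp: field_simps)
      finally show ?thesis .
    qed
    have "e (\<tau> k) q \<noteq> 0" if "k \<in> K" for k using e[OF that \<tau>J[OF that]] y\<tau>[OF that] by simp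
    then have "admissible (\<lambda>i. e i q)" unfolding admissible_def using \<tau>J by blast
    moreover have "point_ideal G (pt (\<lambda>i. e i q)) = point_ideal G (pt y)"
      by (rule point_ideal_scale[of "\<lambda>k. inverse (y (\<tau> k))"]) (use y\<tau> e in auto)
    ultimately show ?thesis using y(2) by simp
  qed
  moreover have "p \<in> U" using p \<tau>(2) in_pieces[OF M_G[OF vB]] by (simp add: U_def)
  ultimately show ?thesis using that[OF U] by blast
qed

end


subsection \<open>Projective space\<close>

definition power_product :: "nat set \<Rightarrow> (nat \<Rightarrow> nat) \<Rightarrow> (nat \<Rightarrow>\<^sub>0 nat)" where
  "power_product V b = (\<Sum>i\<in>V. Poly_Mapping.single i (b i))"

lemma lookup_power_product:
  "finite V \<Longrightarrow> Poly_Mapping.lookup (power_product V b) i = (if i \<in> V then b i else 0)"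
  by (simp add: power_product_def lookup_sum lookup_single when_def)

lemma segre_projective:
  assumes "finite V"
  shows "segre {()} (\<lambda>_. V) (\<lambda>_. 1) (\<lambda>d. power_product V) (\<lambda>y. y)"
proof
  show "power_product V b + power_product V b' = power_product V (\<lambda>i. b i + b' i)" for b b'
    by (simp add: power_product_def single_add sum.distrib)
  show "(\<exists>i. \<forall>y. y v = (y i :: complex)) \<or> (\<forall>y. y v = (1 :: complex))" for v :: nat
    by blast
qed (auto simp: assms power_product_def mval_sum disjoint_family_on_def)

lemma homogeneous_polys_spanned:
  assumes V: "finite V"
  shows "homogeneous_polys V = spanned (\<lambda>d. power_product V ` multidegree {()} (\<lambda>_. V) (\<lambda>_. 1) d)"
proof
  fix d
  have "Poly_Mapping.keys m \<subseteq> V \<and> (\<Sum>v\<in>Poly_Mapping.keys m. Poly_Mapping.lookup m v) = d \<longleftrightarrow>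
      m \<in> power_product V ` multidegree {()} (\<lambda>_. V) (\<lambda>_. 1) d" (is "?l \<longleftrightarrow> ?r") for m
  proof
    assume ?l
    then have "m = power_product V (Poly_Mapping.lookup m)"
      using V by (intro poly_mapping_eqI) (auto simp: lookup_power_product in_keys_iff)
    moreover have "(\<Sum>v\<in>V. Poly_Mapping.lookup m v) = d"
      using \<open>?l\<close> V by (subst sum.mono_neutral_right[of V "Poly_Mapping.keys m"]) (auto simp: in_keys_iff)
    then have "Poly_Mapping.lookup m \<in> multidegree {()} (\<lambda>_. V) (\<lambda>_. 1) d"
      using \<open>?l\<close> by (auto simp: multidegree_def in_keys_iff)
    ultimately show ?r by blast
  next
    assume ?r
    then obtain b where b: "m = power_product V b" "(\<Sum>i\<in>V. b i) = d" by (auto simp: multidegree_def)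
    have sub: "Poly_Mapping.keys m \<subseteq> V" using V by (auto simp: b(1) lookup_power_product in_keys_iff split: if_splits)
    have "(\<Sum>v\<in>Poly_Mapping.keys m. Poly_Mapping.lookup m v) = (\<Sum>v\<in>V. Poly_Mapping.lookup m v)"
      by (rule sum.mono_neutral_left[OF V sub]) (auto simp: in_keys_iff)
    with sub V b show ?l by (simp add: lookup_power_product)
  qed
  then show "homogeneous_polys V d = spanned (\<lambda>d. power_product V ` multidegree {()} (\<lambda>_. V) (\<lambda>_. 1) d) d"
    unfolding homogeneous_polys_def spanned_def polys_def by blast
qed


section \<open>A hyperplane in every factor\<close>

context segre
begin

definition hyperplanes :: "'v cpoly poly set set" where
  "hyperplanes = {point_ideal G (pt y) | y. admissible y \<and> (\<forall>k\<in>K. (\<Sum>i\<in>J k. y i) = 0)}"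

definition free_coords :: "'k \<Rightarrow> nat set" where
  "free_coords k = {i. int i \<le> int (card (J k)) - 2}"

abbreviation H :: "'k \<Rightarrow> nat \<Rightarrow> nat cpoly set" where
  "H k \<equiv> homogeneous_polys (free_coords k)"

text \<open>
  In order to identify the hyperplanes with standard projective spaces, the variables of each block
  are numbered; the one with the largest number is the coordinate that the linear form determines.
\<close>

definition enum :: "'k \<Rightarrow> nat \<Rightarrow> 'i" where
  "enum k = (SOME f. bij_betw f {..<card (J k)} (J k))"

definition index :: "'k \<Rightarrow> 'i \<Rightarrow> nat" where
  "index k = inv_into {..<card (J k)} (enum k)"

definition block :: "'i \<Rightarrow> 'k" where
  "block i = (SOME k. k \<in> K \<and> i \<in> J k)"

definition restrict_coords :: "'k \<Rightarrow> ('i \<Rightarrow> complex) \<Rightarrow> nat \<Rightarrow> complex" where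
  "restrict_coords k y m = y (enum k m)"

definition extend_coords :: "('k \<Rightarrow> nat \<Rightarrow> complex) \<Rightarrow> 'i \<Rightarrow> complex" where
  "extend_coords z i =
     (if i \<in> T then
        let k = block i in
        if index k i \<in> free_coords k then z k (index k i) else - (\<Sum>m\<in>free_coords k. z k m)
      else 0)"

lemma free_coords_eq: "free_coords k = {..<card (J k) - 1}"
  by (auto simp: free_coords_def)

lemma finite_free_coords [simp]: "finite (free_coords k)"
  by (simp add: free_coords_eq)

lemma enum:
  assumes "k \<in> K"
  shows "bij_betw (enum k) {..<card (J k)} (J k)"
proof -
  have "\<exists>f. bij_betw f {..<card (J k)} (J k)"
    using ex_bij_betw_nat_finite[OF finite_J[OF assms]] by (simp add: atLeast0LessThan)
  then show ?thesis unfolding enum_def by (rule someI_ex)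
qed

lemma block: "k \<in> K \<Longrightarrow> i \<in> J k \<Longrightarrow> block i = k"
  unfolding block_def by (rule some_equality) (auto dest: block_unique)

lemma index_enum: "k \<in> K \<Longrightarrow> m < card (J k) \<Longrightarrow> index k (enum k m) = m"
  unfolding index_def by (rule inv_into_f_f) (use enum in \<open>auto simp: bij_betw_def\<close>)

lemma enum_in: "k \<in> K \<Longrightarrow> m < card (J k) \<Longrightarrow> enum k m \<in> J k"
  using enum[of k] by (auto simp: bij_betw_def)

lemma enum_surj:
  assumes "k \<in> K" "i \<in> J k"
  obtains m where "m < card (J k)" "i = enum k m"
  using enum[OF assms(1)] assms(2) by (auto simp: bij_betw_def)

lemma sum_block:
  assumes k: "k \<in> K" and ne: "J k \<noteq> {}"
  shows "(\<Sum>i\<in>J k. y i) = (\<Sum>m\<in>free_coords k. y (enum k m)) + (y (enum k (card (J k) - 1)) :: complex)"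
proof -
  have "card (J k) > 0" using ne finite_J[OF k] by (simp add: card_gt_0_iff)
  then obtain N where N: "card (J k) = Suc N" using gr0_implies_Suc by blast
  have "(\<Sum>i\<in>J k. y i) = (\<Sum>m<card (J k). y (enum k m))"
    using sum.reindex_bij_betw[OF enum[OF k], of y] by simp
  then show ?thesis by (simp add: N free_coords_eq)
qed

lemma extend_enum:
  assumes "k \<in> K" "m < card (J k)"
  shows "extend_coords z (enum k m) =
    (if m \<in> free_coords k then z k m else - (\<Sum>m\<in>free_coords k. z k m))"
  using assms enum_in[OF assms] block[OF assms(1) enum_in[OF assms]] index_enum[OF assms]
  by (auto simp: extend_coords_def Let_def)

lemma restrict_extend:
  assumes "k \<in> K" "m \<in> free_coords k"
  shows "restrict_coords k (extend_coords z) m = z k m"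
  using assms by (simp add: restrict_coords_def extend_enum free_coords_eq)

lemma extend_restrict:
  assumes y: "\<forall>k\<in>K. (\<Sum>i\<in>J k. y i) = 0" and i: "k \<in> K" "i \<in> J k"
  shows "extend_coords (\<lambda>k. restrict_coords k y) i = y i"
proof -
  obtain m where m: "m < card (J k)" "i = enum k m" by (rule enum_surj[OF i])
  show ?thesis
  proof (cases "m \<in> free_coords k")
    case True
    then show ?thesis using m i by (simp add: extend_enum restrict_coords_def)
  next
    case False
    then have last: "m = card (J k) - 1" using m by (auto simp: free_coords_eq)
    have "(\<Sum>m\<in>free_coords k. y (enum k m)) + y i = 0"
      using y sum_block[of k y] i m last by auto
    then show ?thesis
      using m i False by (simp add: extend_enum restrict_coords_def neg_eq_iff_add_eq_0)
  qed
qed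

lemma extend_sum_zero:
  assumes k: "k \<in> K"
  shows "(\<Sum>i\<in>J k. extend_coords z i) = 0"
proof (cases "J k = {}")
  case False
  then have "card (J k) > 0" using finite_J[OF k] by (simp add: card_gt_0_iff)
  then have last: "extend_coords z (enum k (card (J k) - 1)) = - (\<Sum>m\<in>free_coords k. z k m)"
    using k by (subst extend_enum) (auto simp: free_coords_eq)
  have "(\<Sum>m\<in>free_coords k. extend_coords z (enum k m)) = (\<Sum>m\<in>free_coords k. z k m)"
    using k by (intro sum.cong refl) (simp add: extend_enum free_coords_eq)
  with last show ?thesis using sum_block[OF k False, of "extend_coords z"] by simp
qed simp

lemma extend_scale:
  assumes "k \<in> K" "i \<in> J k" "\<And>m. m \<in> free_coords k \<Longrightarrow> z' k m = l * z k m"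
  shows "extend_coords z' i = l * extend_coords z i"
proof -
  obtain m where m: "m < card (J k)" "i = enum k m" by (rule enum_surj[OF assms(1,2)])
  have "(\<Sum>m\<in>free_coords k. z' k m) = l * (\<Sum>m\<in>free_coords k. z k m)"
    unfolding sum_distrib_left by (rule sum.cong) (use assms(3) in auto)
  then show ?thesis using m assms by (simp add: extend_enum)
qed

lemma proj_space_H: "proj_space (int (card (J k)) - 2) = Proj (H k)"
  by (simp add: proj_space_def free_coords_def)

abbreviation admissible_factor :: "'k \<Rightarrow> (nat \<Rightarrow> complex) \<Rightarrow> bool" where
  "admissible_factor k \<equiv> segre.admissible {()} (\<lambda>_. free_coords k)"

lemma admissible_factor_iff: "admissible_factor k z \<longleftrightarrow> (\<exists>m\<in>free_coords k. z m \<noteq> 0)"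
  by (simp add: segre.admissible_def[OF segre_projective])

lemma admissible_extend:
  assumes "\<And>k. k \<in> K \<Longrightarrow> admissible_factor k (z k)"
  shows "admissible (extend_coords z)"
  unfolding admissible_def
proof
  fix k assume k: "k \<in> K"
  then obtain m where m: "m \<in> free_coords k" "z k m \<noteq> 0" using assms admissible_factor_iff by blast
  then have "m < card (J k)" by (auto simp: free_coords_eq)
  then show "\<exists>i\<in>J k. extend_coords z i \<noteq> 0"
    using k m by (intro bexI[of _ "enum k m"] enum_in) (simp_all add: extend_enum)
qed

lemma admissible_restrict:
  assumes y: "admissible y" and k: "k \<in> K" "(\<Sum>i\<in>J k. y i) = 0"
  shows "admissible_factor k (restrict_coords k y)"
proof (rule ccontr)
  assume "\<not> ?thesis"
  then have z: "y (enum k m) = 0" if "m \<in> free_coords k" for m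
    using that unfolding admissible_factor_iff restrict_coords_def by blast
  obtain i where i: "i \<in> J k" "y i \<noteq> 0" using y k(1) unfolding admissible_def by blast
  obtain m where m: "m < card (J k)" "i = enum k m" by (rule enum_surj[OF k(1) i(1)])
  with i(2) z have "m \<notin> free_coords k" by auto
  then have "m = card (J k) - 1" using m by (auto simp: free_coords_eq)
  then show False using sum_block[OF k(1), of y] k(2) z i m by auto
qed

lemma point_restrict_cong:
  assumes "admissible y" "point_ideal G (pt y) = point_ideal G (pt y')" "k \<in> K"
  shows "point_ideal (H k) (restrict_coords k y) = point_ideal (H k) (restrict_coords k y')"
proof -
  interpret P: segre "{()}" "\<lambda>_. free_coords k" "\<lambda>_. 1" "\<lambda>d. power_product (free_coords k)" "\<lambda>y. y"
    by (rule segre_projective) simp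
  obtain l where l: "\<And>k. k \<in> K \<Longrightarrow> l k \<noteq> 0" "\<And>k i. k \<in> K \<Longrightarrow> i \<in> J k \<Longrightarrow> y' i = l k * y i"
    by (rule point_ideal_eqD[OF assms(1,2)]) blast
  have "point_ideal P.G (restrict_coords k y') = point_ideal P.G (restrict_coords k y)"
  proof (rule P.point_ideal_scale[of "\<lambda>_. l k"])
    show "l k \<noteq> 0" by (rule l(1)[OF assms(3)])
    fix m assume "m \<in> free_coords k"
    then have "enum k m \<in> J k" by (intro enum_in assms(3)) (auto simp: free_coords_eq)
    then show "restrict_coords k y' m = l k * restrict_coords k y m"
      unfolding restrict_coords_def by (rule l(2)[OF assms(3)])
  qed
  then show ?thesis by (simp add: homogeneous_polys_spanned)
qed

lemma point_factor_eqD: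
  assumes "admissible_factor k z" "point_ideal (H k) z = point_ideal (H k) z'"
  obtains l where "l \<noteq> 0" "\<And>m. m \<in> free_coords k \<Longrightarrow> z' m = l * z m"
proof -
  interpret P: segre "{()}" "\<lambda>_. free_coords k" "\<lambda>_. 1" "\<lambda>d. power_product (free_coords k)" "\<lambda>y. y"
    by (rule segre_projective) simp
  have "point_ideal P.G z = point_ideal P.G z'"
    using assms(2) by (simp add: homogeneous_polys_spanned)
  then obtain l :: "unit \<Rightarrow> complex" where "\<And>k. k \<in> {()} \<Longrightarrow> l k \<noteq> 0"
    "\<And>u i. u \<in> {()} \<Longrightarrow> i \<in> free_coords k \<Longrightarrow> z' i = l u * z i"
    using P.point_ideal_eqD[OF assms(1)] by blast
  then show ?thesis using that[of "l ()"] by blast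
qed

lemma point_extend_cong:
  assumes "\<And>k. k \<in> K \<Longrightarrow> admissible_factor k (z k)"
    and "\<And>k. k \<in> K \<Longrightarrow> point_ideal (H k) (z k) = point_ideal (H k) (z' k)"
  shows "point_ideal G (pt (extend_coords z')) = point_ideal G (pt (extend_coords z))"
proof -
  have "\<forall>k\<in>K. \<exists>l. l \<noteq> 0 \<and> (\<forall>m\<in>free_coords k. z' k m = l * z k m)"
    using point_factor_eqD[OF assms] by metis
  from bchoice[OF this] obtain l where l: "\<And>k. k \<in> K \<Longrightarrow> l k \<noteq> 0"
    "\<And>k m. k \<in> K \<Longrightarrow> m \<in> free_coords k \<Longrightarrow> z' k m = l k * z k m"
    by blast
  show ?thesis
    by (rule point_ideal_scale[of l]) (use l extend_scale in auto)
qed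

lemma factor_point:
  assumes "p \<in> points (Proj (H k))"
  obtains z where "admissible_factor k z" "p = point_ideal (H k) z"
proof -
  interpret P: segre "{()}" "\<lambda>_. free_coords k" "\<lambda>_. 1" "\<lambda>d. power_product (free_coords k)" "\<lambda>y. y"
    by (rule segre_projective) simp
  have "p \<in> proj_points P.G"
    using assms P.points_Proj by (simp add: homogeneous_polys_spanned)
  then show ?thesis
    using P.point_coordinates that by (metis homogeneous_polys_spanned finite_free_coords)
qed

lemma factor_point_in: "admissible_factor k z \<Longrightarrow> point_ideal (H k) z \<in> points (Proj (H k))"
proof -
  interpret P: segre "{()}" "\<lambda>_. free_coords k" "\<lambda>_. 1" "\<lambda>d. power_product (free_coords k)" "\<lambda>y. y"
    by (rule segre_projective) simp
  assume "admissible_factor k z"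
  then have "point_ideal P.G z \<in> points (Proj P.G)"
    unfolding P.points_Proj by (rule P.point_in_proj)
  then show ?thesis by (simp add: homogeneous_polys_spanned)
qed

lemma factor_local_coordinates:
  assumes "p \<in> points (Proj (H k))"
  obtains U e where "openin (zar (Proj (H k))) U" "p \<in> U" "\<And>i. e i \<in> reg (Proj (H k)) U"
    "\<And>q. q \<in> U \<Longrightarrow> admissible_factor k (\<lambda>i. e i q) \<and> q = point_ideal (H k) (\<lambda>i. e i q)"
proof -
  interpret P: segre "{()}" "\<lambda>_. free_coords k" "\<lambda>_. 1" "\<lambda>d. power_product (free_coords k)" "\<lambda>y. y"
    by (rule segre_projective) simp
  have eq: "H k = P.G" by (simp add: homogeneous_polys_spanned)
  have "p \<in> proj_points P.G" using assms P.points_Proj by (simp add: eq)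
  then show ?thesis
    by (rule P.local_coordinates) (rule that, unfold eq)
qed

lemma function_sheaf_factor: "function_sheaf (Proj (H k))"
proof -
  interpret P: segre "{()}" "\<lambda>_. free_coords k" "\<lambda>_. 1" "\<lambda>d. power_product (free_coords k)" "\<lambda>y. y"
    by (rule segre_projective) simp
  show ?thesis using P.function_sheaf_Proj by (simp add: homogeneous_polys_spanned)
qed

lemma morphism_into_factor:
  assumes "function_sheaf X" "\<And>y. y \<in> points X \<Longrightarrow> \<psi> y \<in> points (Proj (H k))"
    and "\<And>y. y \<in> points X \<Longrightarrow> \<exists>U e. openin (zar X) U \<and> y \<in> U \<and> (\<forall>v. e v \<in> reg X U) \<and>
      (\<forall>z\<in>U. \<psi> z = point_ideal (H k) (\<lambda>v. e v z))"
  shows "morphism X (Proj (H k)) \<psi>"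
proof -
  interpret P: segre "{()}" "\<lambda>_. free_coords k" "\<lambda>_. 1" "\<lambda>d. power_product (free_coords k)" "\<lambda>y. y"
    by (rule segre_projective) simp
  have eq: "H k = P.G" by (simp add: homogeneous_polys_spanned)
  show ?thesis
    using assms unfolding eq P.points_Proj by (rule P.morphism_into_Proj)
qed

definition coords :: "'v cpoly poly set \<Rightarrow> 'i \<Rightarrow> complex" where
  "coords p = (SOME y. admissible y \<and> p = point_ideal G (pt y))"

definition factor_coords :: "'k \<Rightarrow> nat cpoly poly set \<Rightarrow> nat \<Rightarrow> complex" where
  "factor_coords k p = (SOME z. admissible_factor k z \<and> p = point_ideal (H k) z)"

definition to_product :: "'v cpoly poly set \<Rightarrow> 'k \<Rightarrow> nat cpoly poly set" where
  "to_product p = (\<lambda>k\<in>K. point_ideal (H k) (restrict_coords k (coords p)))"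

definition from_product :: "('k \<Rightarrow> nat cpoly poly set) \<Rightarrow> 'v cpoly poly set" where
  "from_product q = point_ideal G (pt (extend_coords (\<lambda>k. factor_coords k (q k))))"

lemma coords:
  assumes "p \<in> proj_points G"
  shows "admissible (coords p)" "point_ideal G (pt (coords p)) = p"
proof -
  obtain y where "admissible y" "p = point_ideal G (pt y)" by (rule point_coordinates[OF assms])
  then have "\<exists>y. admissible y \<and> p = point_ideal G (pt y)" by blast
  from someI_ex[OF this] show "admissible (coords p)" "point_ideal G (pt (coords p)) = p"
    unfolding coords_def by simp_all
qed

lemma factor_coords:
  assumes "p \<in> points (Proj (H k))"
  shows "admissible_factor k (factor_coords k p)" "point_ideal (H k) (factor_coords k p) = p"
proof -
  obtain z where "admissible_factor k z" "p = point_ideal (H k) z" by (rule factor_point[OF assms])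
  then have "\<exists>z. admissible_factor k z \<and> p = point_ideal (H k) z" by blast
  from someI_ex[OF this] show "admissible_factor k (factor_coords k p)" "point_ideal (H k) (factor_coords k p) = p"
    unfolding factor_coords_def by simp_all
qed

lemma hyperplanes_sub: "hyperplanes \<subseteq> proj_points G"
  unfolding hyperplanes_def using point_in_proj by blast

lemma hyperplanes_coords:
  assumes p: "p \<in> hyperplanes" and y: "admissible y" "p = point_ideal G (pt y)"
  shows "\<forall>k\<in>K. (\<Sum>i\<in>J k. y i) = 0"
proof -
  from p obtain y' where y': "admissible y'" "p = point_ideal G (pt y')" "\<forall>k\<in>K. (\<Sum>i\<in>J k. y' i) = 0"
    unfolding hyperplanes_def by blast
  obtain l where l: "\<And>k i. k \<in> K \<Longrightarrow> i \<in> J k \<Longrightarrow> y i = l k * y' i"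
    by (rule point_ideal_eqD[OF y'(1), of y]) (use y y' in auto)
  have "(\<Sum>i\<in>J k. y i) = l k * (\<Sum>i\<in>J k. y' i)" if "k \<in> K" for k
    unfolding sum_distrib_left by (rule sum.cong) (use l that in auto)
  then show ?thesis using y'(3) by simp
qed

lemma to_product_eq:
  assumes "p \<in> hyperplanes" "admissible y" "p = point_ideal G (pt y)" "k \<in> K"
  shows "to_product p k = point_ideal (H k) (restrict_coords k y)"
proof -
  have "p \<in> proj_points G" using assms(1) hyperplanes_sub by blast
  note c = coords[OF this]
  show ?thesis
    unfolding to_product_def using assms(4) point_restrict_cong[OF assms(2) _ assms(4), of "coords p"] c assms(3)
    by simp
qed

lemma from_product_eq:
  assumes "\<And>k. k \<in> K \<Longrightarrow> admissible_factor k (z k)" "\<And>k. k \<in> K \<Longrightarrow> q k = point_ideal (H k) (z k)"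
  shows "from_product q = point_ideal G (pt (extend_coords z))"
  unfolding from_product_def
proof (rule point_extend_cong[OF assms(1)])
  fix k assume k: "k \<in> K"
  have "q k \<in> points (Proj (H k))" using factor_point_in assms k by simp
  from factor_coords(2)[OF this] assms(2)[OF k]
  show "point_ideal (H k) (z k) = point_ideal (H k) (factor_coords k (q k))" by simp
qed

text \<open>
  On each factor the hyperplane \<open>\<Sum> y i = 0\<close> is a projective space of one dimension less:
  the last coordinate is determined by the other ones.
\<close>

theorem hyperplanes_isomorphic:
  "isomorphic (subvariety (Proj G) hyperplanes)
     (prod_space K (\<lambda>k. proj_space (int (card (J k)) - 2)))"
proof -
  let ?M = "subvariety (Proj G) hyperplanes" and ?P = "prod_space K (\<lambda>k. Proj (H k))"
  interpret fam: sheaf_family K "\<lambda>k. Proj (H k)"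
    by (rule sheaf_family.intro) (auto intro: finite_K function_sheaf_factor)
  have sheaf_M: "function_sheaf ?M" by (rule function_sheaf_subvariety[OF function_sheaf_Proj])
  have sheaf_P: "function_sheaf ?P" by (rule fam.function_sheaf_prod)
  have points_M: "points ?M = hyperplanes"
    using hyperplanes_sub by (auto simp: subvariety_simps points_Proj)
  have points_P: "points ?P = (\<Pi>\<^sub>E k\<in>K. points (Proj (H k)))" by (rule fam.points_prod)
  have adm: "admissible (coords p)" "p = point_ideal G (pt (coords p))" "\<forall>k\<in>K. (\<Sum>i\<in>J k. coords p i) = 0"
    if p: "p \<in> hyperplanes" for p
  proof -
    have pG: "p \<in> proj_points G" using p hyperplanes_sub by blast
    show "admissible (coords p)" and eq: "p = point_ideal G (pt (coords p))" using coords[OF pG] by simp_all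
    then show "\<forall>k\<in>K. (\<Sum>i\<in>J k. coords p i) = 0" by (intro hyperplanes_coords[OF p])
  qed
  have admP: "admissible_factor k (factor_coords k (q k))" "q k = point_ideal (H k) (factor_coords k (q k))"
    if "q \<in> points ?P" "k \<in> K" for q k
  proof -
    have "q k \<in> points (Proj (H k))" using that unfolding points_P by (auto simp: PiE_iff)
    from factor_coords[OF this]
    show "admissible_factor k (factor_coords k (q k))" "q k = point_ideal (H k) (factor_coords k (q k))" by simp_all
  qed
  have from_in: "from_product q \<in> hyperplanes" if q: "q \<in> points ?P" for q
  proof -
    have "admissible (extend_coords (\<lambda>k. factor_coords k (q k)))"
      by (rule admissible_extend) (rule admP(1)[OF q])
    moreover have "\<forall>k\<in>K. (\<Sum>i\<in>J k. extend_coords (\<lambda>k. factor_coords k (q k)) i) = 0"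
      by (intro ballI extend_sum_zero)
    ultimately show ?thesis unfolding from_product_def hyperplanes_def by blast
  qed
  have to_in: "to_product p k \<in> points (Proj (H k))" if p: "p \<in> hyperplanes" and k: "k \<in> K" for p k
    unfolding to_product_eq[OF p adm(1,2)[OF p] k]
    using adm[OF p] k by (intro factor_point_in admissible_restrict) auto
  have "morphism ?M ?P to_product"
  proof (rule fam.morphism_into_prod[OF sheaf_M])
    fix k assume k: "k \<in> K"
    show "morphism ?M (Proj (H k)) (\<lambda>p. to_product p k)"
    proof (rule morphism_into_factor[OF sheaf_M])
      fix p assume "p \<in> points ?M"
      then have p: "p \<in> hyperplanes" by (simp add: points_M)
      then show "to_product p k \<in> points (Proj (H k))" using k by (rule to_in)
      have pG: "p \<in> proj_points G" using p hyperplanes_sub by blast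
      obtain U e where U: "openin (zar (Proj G)) U" "p \<in> U" "\<And>i. e i \<in> reg (Proj G) U"
        "\<And>q. q \<in> U \<Longrightarrow> admissible (\<lambda>i. e i q) \<and> q = point_ideal G (pt (\<lambda>i. e i q))"
        by (rule local_coordinates[OF pG]) blast
      have "openin (zar ?M) (U \<inter> hyperplanes)"
        using U(1) by (auto simp: subvariety_simps openin_subtopology)
      moreover have "e i \<in> reg ?M (U \<inter> hyperplanes)" for i
        by (rule reg_restrict_subvariety[OF U(1,3)])
      moreover have "to_product q k = point_ideal (H k) (\<lambda>v. e (enum k v) q)" if "q \<in> U \<inter> hyperplanes" for q
        using to_product_eq[of q "\<lambda>i. e i q" k] U(4)[of q] that k by (simp add: restrict_coords_def[abs_def])
      ultimately have "openin (zar ?M) (U \<inter> hyperplanes) \<and> p \<in> U \<inter> hyperplanes \<and>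
          (\<forall>v. (\<lambda>v. e (enum k v)) v \<in> reg ?M (U \<inter> hyperplanes)) \<and>
          (\<forall>z\<in>U \<inter> hyperplanes. to_product z k = point_ideal (H k) (\<lambda>v. (\<lambda>v. e (enum k v)) v z))"
        using U(2) p by simp
      then show "\<exists>U e. openin (zar ?M) U \<and> p \<in> U \<and> (\<forall>v. e v \<in> reg ?M U) \<and>
          (\<forall>z\<in>U. to_product z k = point_ideal (H k) (\<lambda>v. e v z))"
        by (intro exI)
    qed
  qed (simp add: to_product_def)
  moreover have "morphism ?P ?M from_product"
  proof (rule morphism_into_subvariety[OF sheaf_P _ from_in])
    show "morphism ?P (Proj G) from_product"
    proof (rule morphism_into_Proj[OF sheaf_P])
      fix q assume q: "q \<in> points ?P"
      then show "from_product q \<in> proj_points G" using from_in hyperplanes_sub by blast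
      have "\<forall>k\<in>K. \<exists>U e. openin (zar (Proj (H k))) U \<and> q k \<in> U \<and> (\<forall>i. e i \<in> reg (Proj (H k)) U) \<and>
          (\<forall>p\<in>U. admissible_factor k (\<lambda>i. e i p) \<and> p = point_ideal (H k) (\<lambda>i. e i p))"
      proof
        fix k assume "k \<in> K"
        then have "q k \<in> points (Proj (H k))" using q unfolding points_P by (auto simp: PiE_iff)
        then show "\<exists>U e. openin (zar (Proj (H k))) U \<and> q k \<in> U \<and> (\<forall>i. e i \<in> reg (Proj (H k)) U) \<and>
          (\<forall>p\<in>U. admissible_factor k (\<lambda>i. e i p) \<and> p = point_ideal (H k) (\<lambda>i. e i p))"
          by (rule factor_local_coordinates) blast
      qed
      then obtain U e where U: "\<And>k. k \<in> K \<Longrightarrow> openin (zar (Proj (H k))) (U k)" "\<And>k. k \<in> K \<Longrightarrow> q k \<in> U k"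
        "\<And>k i. k \<in> K \<Longrightarrow> e k i \<in> reg (Proj (H k)) (U k)"
        "\<And>k p. k \<in> K \<Longrightarrow> p \<in> U k \<Longrightarrow> admissible_factor k (\<lambda>i. e k i p) \<and> p = point_ideal (H k) (\<lambda>i. e k i p)"
        by metis
      interpret P: function_sheaf ?P by (rule sheaf_P)
      define W where "W = {x \<in> points ?P. \<forall>k\<in>K. x k \<in> U k}"
      have W: "openin (zar ?P) W"
      proof -
        have "openin (zar ?P) ((\<Inter>k\<in>K. {x \<in> points ?P. x k \<in> U k}) \<inter> topspace (zar ?P))"
          by (intro openin_INT finite_K openin_preimage[OF fam.morphism_projection] U(1))
        also have "(\<Inter>k\<in>K. {x \<in> points ?P. x k \<in> U k}) \<inter> topspace (zar ?P) = W"
          by (auto simp: W_def points_def)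
        finally show ?thesis .
      qed
      have eW: "(\<lambda>x. e k i (x k)) \<in> reg ?P W" if "k \<in> K" for k i
        by (rule P.reg_subset[OF reg_preimage[OF fam.morphism_projection[OF that] U(1)[OF that] U(3)[OF that]] W])
          (use that in \<open>auto simp: W_def\<close>)
      define z where "z x k i = e k i (x k)" for x :: "'k \<Rightarrow> nat cpoly poly set" and k i
      have ext: "(\<lambda>x. extend_coords (z x) i) \<in> reg ?P W" for i
      proof (cases "i \<in> T")
        case True
        then obtain k where k: "k \<in> K" "i \<in> J k" by blast
        have "(\<lambda>x. extend_coords (z x) i) =
            (if index k i \<in> free_coords k then (\<lambda>x. e k (index k i) (x k))
             else (\<lambda>x. - (\<Sum>m\<in>free_coords k. e k m (x k))))"
          using True by (auto simp: extend_coords_def block[OF k] z_def)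
        moreover have "(\<lambda>x. - (\<Sum>m\<in>free_coords k. e k m (x k))) \<in> reg ?P W"
          by (intro P.reg_uminus P.reg_sum eW W k(1))
        ultimately show ?thesis using eW[OF k(1)] by simp
      next
        case False
        then show ?thesis unfolding extend_coords_def by (simp add: P.reg_const[OF W])
      qed
      have pt_reg: "(\<lambda>x. pt (extend_coords (z x)) v) \<in> reg ?P W" for v
        using pt_coordinate[of v] ext P.reg_const[OF W, of 1] by (elim disjE exE) simp_all
      have "from_product x = point_ideal G (\<lambda>v. pt (extend_coords (z x)) v)" if "x \<in> W" for x
      proof (rule from_product_eq)
        fix k assume k: "k \<in> K"
        have "z x k = (\<lambda>i. e k i (x k))" by (simp add: z_def fun_eq_iff)
        with U(4)[OF k, of "x k"] that k
        show "admissible_factor k (z x k)" "x k = point_ideal (H k) (z x k)" by (simp_all add: W_def)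
      qed
      then have "openin (zar ?P) W \<and> q \<in> W \<and> (\<forall>v. (\<lambda>v x. pt (extend_coords (z x)) v) v \<in> reg ?P W) \<and>
          (\<forall>x\<in>W. from_product x = point_ideal G (\<lambda>v. (\<lambda>v x. pt (extend_coords (z x)) v) v x))"
        using W U(2) q pt_reg by (auto simp: W_def)
      then show "\<exists>U e. openin (zar ?P) U \<and> q \<in> U \<and> (\<forall>v. e v \<in> reg ?P U) \<and>
          (\<forall>z\<in>U. from_product z = point_ideal G (\<lambda>v. e v z))"
        by (intro exI)
    qed
  qed
  moreover have "from_product (to_product p) = p" if "p \<in> points ?M" for p
  proof -
    have p: "p \<in> hyperplanes" using that by (simp add: points_M)
    have "from_product (to_product p) = point_ideal G (pt (extend_coords (\<lambda>k. restrict_coords k (coords p))))"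
      using adm[OF p] by (intro from_product_eq admissible_restrict to_product_eq[OF p]) auto
    also have "\<dots> = point_ideal G (pt (coords p))"
      by (rule point_ideal_scale[of "\<lambda>_. 1"]) (use extend_restrict adm(3)[OF p] in auto)
    finally show ?thesis by (simp only: adm(2)[OF p, symmetric])
  qed
  moreover have "to_product (from_product q) = q" if q: "q \<in> points ?P" for q
  proof (rule ext)
    fix k
    let ?z = "\<lambda>k. factor_coords k (q k)"
    show "to_product (from_product q) k = q k"
    proof (cases "k \<in> K")
      case True
      interpret P: segre "{()}" "\<lambda>_. free_coords k" "\<lambda>_. 1" "\<lambda>d. power_product (free_coords k)" "\<lambda>y. y"
        by (rule segre_projective) simp
      have "to_product (from_product q) k = point_ideal (H k) (restrict_coords k (extend_coords ?z))"
        by (rule to_product_eq[OF from_in[OF q] _ _ True])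
          (auto simp: from_product_def intro!: admissible_extend admP[OF q])
      also have "\<dots> = point_ideal (H k) (?z k)"
        using P.point_ideal_scale[of "\<lambda>_. 1" "restrict_coords k (extend_coords ?z)" "?z k"] restrict_extend[OF True]
        by (simp add: homogeneous_polys_spanned)
      finally show ?thesis by (simp only: admP(2)[OF q True, symmetric])
    next
      case False
      have "q k = undefined"
        by (rule PiE_arb[OF q[unfolded points_P] False])
      with False show ?thesis by (simp add: to_product_def)
    qed
  qed
  ultimately have "isomorphic ?M ?P" unfolding isomorphic_def by blast
  then show ?thesis unfolding proj_space_H .
qed

end


section \<open>Semi-invariants of chains\<close>

lemma chain_arrows_eq:
  "chain_arrows l I = (\<lambda>(k, j). Xarr k j) ` Sigma {1..l} I \<union> (\<lambda>(k, j). Yarr (k - 1) j) ` Sigma {2..l} I"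
  unfolding chain_arrows_def by (auto simp: image_iff)

lemma finite_chain_arrows: "(\<And>k. k \<in> {1..l} \<Longrightarrow> finite (I k)) \<Longrightarrow> finite (chain_arrows l I)"
  unfolding chain_arrows_eq by (intro finite_UnI finite_imageI finite_SigmaI) auto

text \<open>
  The arrow \<open>Yarr (k - 1) j\<close> ends in level \<open>k\<close>, so the arrows are counted by the level of
  their branch.
\<close>

lemma prod_chain_arrows:
  fixes g :: "chain_arrow \<Rightarrow> complex"
  assumes fin: "\<And>k. k \<in> {1..l} \<Longrightarrow> finite (I k)"
  shows "(\<Prod>v\<in>chain_arrows l I. g v) =
    (\<Prod>k=1..l. \<Prod>j\<in>I k. g (Xarr k j)) * (\<Prod>k=2..l. \<Prod>j\<in>I k. g (Yarr (k - 1) j))"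
proof -
  let ?X = "(\<lambda>(k, j). Xarr k j) ` Sigma {1..l} I" and ?Y = "(\<lambda>(k, j). Yarr (k - 1) j) ` Sigma {2..l} I"
  have fin2: "finite (I k)" if "k \<in> {2..l}" for k using fin that by simp
  have "(\<Prod>v\<in>chain_arrows l I. g v) = (\<Prod>v\<in>?X. g v) * (\<Prod>v\<in>?Y. g v)"
    unfolding chain_arrows_eq
    by (rule prod.union_disjoint) (auto intro!: finite_imageI finite_SigmaI fin)
  also have "(\<Prod>v\<in>?X. g v) = (\<Prod>(k, j)\<in>Sigma {1..l} I. g (Xarr k j))"
    by (subst prod.reindex) (auto simp: inj_on_def case_prod_beta)
  also have "\<dots> = (\<Prod>k=1..l. \<Prod>j\<in>I k. g (Xarr k j))"
    by (rule prod.Sigma[symmetric]) (use fin in auto)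
  also have "(\<Prod>v\<in>?Y. g v) = (\<Prod>(k, j)\<in>Sigma {2..l} I. g (Yarr (k - 1) j))"
    by (subst prod.reindex) (auto simp: inj_on_def case_prod_beta)
  also have "\<dots> = (\<Prod>k=2..l. \<Prod>j\<in>I k. g (Yarr (k - 1) j))"
    by (rule prod.Sigma[symmetric]) (use fin2 in auto)
  finally show ?thesis .
qed

lemma prod_powi:
  fixes x :: complex
  assumes "x \<noteq> 0"
  shows "(\<Prod>s\<in>S. x powi f s) = x powi (\<Sum>s\<in>S. f s)"
  by (induction S rule: infinite_finite_induct) (simp_all add: power_int_add assms)

lemma two_powi_inject:
  assumes "(2::complex) powi a = 2 powi b"
  shows "a = b"
proof -
  have "norm ((2::complex) powi a) = norm ((2::complex) powi b)" using assms by simp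
  then have *: "(2::real) powi a = 2 powi b" by (simp add: norm_power_int)
  show ?thesis
  proof (rule ccontr)
    assume "a \<noteq> b"
    then consider "a < b" | "b < a" by linarith
    then show False
    proof cases
      case 1
      from power_int_strict_increasing[OF this, of "2::real"] * show False by simp
    next
      case 2
      from power_int_strict_increasing[OF this, of "2::real"] * show False by simp
    qed
  qed
qed

lemma sum_single_branch:
  fixes f :: "nat \<Rightarrow> nat \<Rightarrow> int"
  assumes "finite A" "\<And>k. k \<in> A \<Longrightarrow> finite (I k)" "k0 \<in> A \<Longrightarrow> j0 \<in> I k0"
  shows "(\<Sum>k\<in>A. \<Sum>j\<in>I k. if k = k0 \<and> j = j0 then f k j else 0) = (if k0 \<in> A then f k0 j0 else 0)"
proof -
  have "(\<Sum>k\<in>A. \<Sum>j\<in>I k. if k = k0 \<and> j = j0 then f k j else 0) = (\<Sum>k\<in>A. if k = k0 then f k0 j0 else 0)"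
  proof (rule sum.cong[OF refl])
    fix k assume k: "k \<in> A"
    show "(\<Sum>j\<in>I k. if k = k0 \<and> j = j0 then f k j else 0) = (if k = k0 then f k0 j0 else 0)"
      using assms k by (cases "k = k0") auto
  qed
  then show ?thesis using assms(1) by simp
qed

locale star_chain =
  fixes n r :: nat and \<theta> :: "nat \<Rightarrow> int" and I :: "nat \<Rightarrow> nat set"
  assumes r_pos: "1 \<le> r" and \<theta>_pos: "\<forall>j\<in>{1..n}. 0 < \<theta> j"
    and generic: "generic n (star_stab n r \<theta>) (star_dim r)"
    and cover: "(\<Union>k\<in>{1..r}. I k) = {1..n}" and disjoint: "disjoint_family_on I {1..r}"
begin

abbreviation arrows :: "chain_arrow set" where
  "arrows \<equiv> chain_arrows r I"

text \<open>
  The number \<open>C\<^sub>k\<close>: a monomial of weight \<open>\<eta>\<close> has degree \<open>\<eta> C\<^sub>k\<close> in the arrows from the centre of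
  level \<open>k - 1\<close> to the branches of level \<open>k\<close>.
\<close>

definition excess :: "nat \<Rightarrow> int" where
  "excess k = int r * (\<Sum>i=1..<k. \<Sum>j\<in>I i. \<theta> j) - (int k - 1) * (\<Sum>j=1..n. \<theta> j)"

lemma branch: "k \<in> {1..r} \<Longrightarrow> j \<in> I k \<Longrightarrow> j \<in> {1..n}"
  using cover by blast

lemma finite_branches: "k \<in> {1..r} \<Longrightarrow> finite (I k)"
  using finite_subset[of "I k" "{1..n}"] branch by blast

lemma finite_arrows: "finite arrows"
  by (rule finite_chain_arrows) (rule finite_branches)

lemma sum_branches: "(\<Sum>k=1..r. \<Sum>j\<in>I k. f j) = (\<Sum>j=1..n. f j :: int)"
proof -
  have "(\<Sum>j\<in>(\<Union>k\<in>{1..r}. I k). f j) = (\<Sum>k\<in>{1..r}. \<Sum>j\<in>I k. f j)"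
    by (rule sum.UNION_disjoint)
      (use finite_branches disjoint in \<open>auto simp: disjoint_family_on_def\<close>)
  then show ?thesis unfolding cover by (rule sym)
qed

lemma excess_1: "excess 1 = 0"
  by (simp add: excess_def)

lemma excess_Suc: "1 \<le> k \<Longrightarrow> excess (Suc k) = excess k + int r * (\<Sum>j\<in>I k. \<theta> j) - (\<Sum>j=1..n. \<theta> j)"
  by (simp add: excess_def algebra_simps)

lemma excess_end: "excess (Suc r) = 0"
proof -
  have "{1..<Suc r} = {1..r}" by auto
  then show ?thesis unfolding excess_def by (simp only: sum_branches) simp
qed

definition balanced :: "nat \<Rightarrow> (chain_arrow \<Rightarrow>\<^sub>0 nat) \<Rightarrow> bool" where
  "balanced d m \<longleftrightarrow> Poly_Mapping.keys m \<subseteq> arrows \<and>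
     (\<forall>k\<in>{1..r}. \<forall>j\<in>I k. int (Poly_Mapping.lookup m (Xarr k j)) =
        int d * (int r * \<theta> j) + (if k = 1 then 0 else int (Poly_Mapping.lookup m (Yarr (k - 1) j)))) \<and>
     (\<forall>k\<in>{2..r}. (\<Sum>j\<in>I k. int (Poly_Mapping.lookup m (Yarr (k - 1) j))) = int d * excess k)"

lemma act_scales: "chain_act t x v = chain_act t (\<lambda>_. 1) v * x v"
  by (cases v) simp_all

lemma mval_act: "mval (chain_act t x) m = mval (chain_act t (\<lambda>_. 1)) m * mval x m"
proof -
  have "chain_act t x = (\<lambda>v. chain_act t (\<lambda>_. 1) v * x v)" by (intro ext act_scales)
  then show ?thesis by (simp only: mval_mult_point)
qed

lemma mval_arrows:
  assumes "Poly_Mapping.keys m \<subseteq> arrows"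
  shows "mval x m = (\<Prod>k=1..r. \<Prod>j\<in>I k. x (Xarr k j) ^ Poly_Mapping.lookup m (Xarr k j)) *
    (\<Prod>k=2..r. \<Prod>j\<in>I k. x (Yarr (k - 1) j) ^ Poly_Mapping.lookup m (Yarr (k - 1) j))"
  unfolding mval_superset[OF finite_arrows assms] by (rule prod_chain_arrows) (rule finite_branches)

lemma mval_torus:
  assumes "Poly_Mapping.keys m \<subseteq> arrows"
  shows "mval (chain_act t (\<lambda>_. 1)) m =
    (\<Prod>k=1..r. \<Prod>j\<in>I k. (t k 0 / t k j) ^ Poly_Mapping.lookup m (Xarr k j)) *
    (\<Prod>k=2..r. \<Prod>j\<in>I k. (t k j / t (k - 1) 0) ^ Poly_Mapping.lookup m (Yarr (k - 1) j))"
proof -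
  have "chain_act t (\<lambda>_. 1) (Yarr (k - 1) j) = t k j / t (k - 1) 0" if "k \<in> {2..r}" for k j
  proof -
    have "k - 1 + 1 = k" using that by simp
    then show ?thesis by (simp add: divide_inverse)
  qed
  then have "(\<Prod>k=2..r. \<Prod>j\<in>I k. chain_act t (\<lambda>_. 1) (Yarr (k - 1) j) ^ Poly_Mapping.lookup m (Yarr (k - 1) j))
      = (\<Prod>k=2..r. \<Prod>j\<in>I k. (t k j / t (k - 1) 0) ^ Poly_Mapping.lookup m (Yarr (k - 1) j))"
    by (intro prod.cong refl) simp
  then show ?thesis unfolding mval_arrows[OF assms] by (simp add: divide_inverse)
qed

lemma char_eq: "chain_char r I (star_stab n r \<theta>) t ^ d =
  (\<Prod>k=1..r. t k 0 powi (int d * (\<Sum>j=1..n. \<theta> j)) * (\<Prod>j\<in>I k. t k j powi (- (int d * (int r * \<theta> j)))))"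
proof -
  have pw: "(x powi a) ^ d = x powi (int d * a)" for x :: complex and a
    by (simp add: power_int_mult mult.commute flip: power_int_of_nat)
  have "chain_char r I (star_stab n r \<theta>) t ^ d =
      (\<Prod>k=1..r. (t k 0 powi star_stab n r \<theta> 0) ^ d * (\<Prod>j\<in>I k. (t k j powi star_stab n r \<theta> j) ^ d))"
    by (simp add: chain_char_def prod_power_distrib power_mult_distrib)
  also have "\<dots> = (\<Prod>k=1..r. t k 0 powi (int d * (\<Sum>j=1..n. \<theta> j)) * (\<Prod>j\<in>I k. t k j powi (- (int d * (int r * \<theta> j)))))"
  proof (intro prod.cong refl arg_cong2[of _ _ _ _ "(*)"])
    fix k assume "k \<in> {1..r}"
    show "(t k 0 powi star_stab n r \<theta> 0) ^ d = t k 0 powi (int d * (\<Sum>j=1..n. \<theta> j))"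
      by (simp add: pw star_stab_def)
    fix j assume "j \<in> I k"
    then have "j \<noteq> 0" using branch[OF \<open>k \<in> {1..r}\<close>] by fastforce
    then show "(t k j powi star_stab n r \<theta> j) ^ d = t k j powi (- (int d * (int r * \<theta> j)))"
      by (simp add: pw star_stab_def)
  qed
  finally show ?thesis .
qed

text \<open>
  Summation by parts, written multiplicatively.
\<close>

lemma telescope:
  fixes u :: "nat \<Rightarrow> complex"
  assumes "\<And>k. k \<in> {1..L} \<Longrightarrow> u k \<noteq> 0" "1 \<le> L"
  shows "(\<Prod>k=2..L. (u k / u (k - 1)) powi c k) * u L powi (- c (Suc L))
    = u 1 powi (- c 1) * (\<Prod>k=1..L. u k powi (c k - c (Suc k)))"
  using assms(2,1)
proof (induction L rule: dec_induct)
  case base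
  then have "u 1 \<noteq> 0" by simp
  then show ?case by (simp flip: power_int_add)
next
  case (step L)
  have nz: "u L \<noteq> 0" "u (Suc L) \<noteq> 0" using step.prems step.hyps by auto
  have IH: "(\<Prod>k=2..L. (u k / u (k - 1)) powi c k) * u L powi (- c (Suc L))
    = u 1 powi (- c 1) * (\<Prod>k=1..L. u k powi (c k - c (Suc k)))"
    using step.prems by (intro step.IH) auto
  have "{2..Suc L} = insert (Suc L) {2..L}" using step.hyps by auto
  have "(\<Prod>k=2..Suc L. (u k / u (k - 1)) powi c k) * u (Suc L) powi (- c (Suc (Suc L)))
     = ((\<Prod>k=2..L. (u k / u (k - 1)) powi c k) * u L powi (- c (Suc L))) *
        (u (Suc L) powi c (Suc L) * u (Suc L) powi (- c (Suc (Suc L))))"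
  proof -
    have "(\<Prod>k=2..Suc L. (u k / u (k - 1)) powi c k)
        = (u (Suc L) / u L) powi c (Suc L) * (\<Prod>k=2..L. (u k / u (k - 1)) powi c k)"
      unfolding \<open>{2..Suc L} = insert (Suc L) {2..L}\<close> by simp
    also have "(u (Suc L) / u L) powi c (Suc L) = u (Suc L) powi c (Suc L) * u L powi (- c (Suc L))"
      by (simp only: power_int_divide_distrib) (simp only: power_int_minus divide_inverse)
    finally show ?thesis by (simp only: mult_ac)
  qed
  also have "u (Suc L) powi c (Suc L) * u (Suc L) powi (- c (Suc (Suc L))) = u (Suc L) powi (c (Suc L) - c (Suc (Suc L)))"
    using nz by (simp flip: power_int_add)
  also have "((\<Prod>k=2..L. (u k / u (k - 1)) powi c k) * u L powi (- c (Suc L))) * u (Suc L) powi (c (Suc L) - c (Suc (Suc L)))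
      = u 1 powi (- c 1) * (\<Prod>k=1..Suc L. u k powi (c k - c (Suc k)))"
    unfolding IH by (simp add: mult_ac)
  finally show ?case .
qed

lemma split_first_level: "{1..r} = insert 1 {2..r}"
  using r_pos by auto

text \<open>
  The factors of the torus coordinates of branches are clear from the exponents.  The arrows between
  levels \<open>k - 1\<close> and \<open>k\<close> contribute \<open>(t k 0 / t (k - 1) 0) ^ (d * excess k)\<close>; summation by parts
  turns these ratios into powers of the single \<open>t k 0\<close>, with exponents that are the differences of
  successive excesses.
\<close>

lemma balanced_weight:
  assumes m: "balanced d m" and t: "t \<in> chain_torus r I"
  shows "mval (chain_act t (\<lambda>_. 1)) m = chain_char r I (star_stab n r \<theta>) t ^ d"
proof -
  let ?b = "\<lambda>k j. Poly_Mapping.lookup m (Yarr (k - 1) j)"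
  let ?\<theta>0 = "\<Sum>j=1..n. \<theta> j"
  have keys: "Poly_Mapping.keys m \<subseteq> arrows" using m by (simp add: balanced_def)
  have tk: "t k 0 \<noteq> 0" "\<And>j. j \<in> I k \<Longrightarrow> t k j \<noteq> 0" if "k \<in> {1..r}" for k
    using t that by (auto simp: chain_torus_def)
  define N where "N j = nat (int d * (int r * \<theta> j))" for j
  have N: "int (N j) = int d * (int r * \<theta> j)" if "k \<in> {1..r}" "j \<in> I k" for k j
  proof -
    have "0 < \<theta> j" using branch[OF that] \<theta>_pos by blast
    then show ?thesis by (simp add: N_def)
  qed
  have X: "(\<Prod>j\<in>I k. (t k 0 / t k j) ^ Poly_Mapping.lookup m (Xarr k j))
      = (\<Prod>j\<in>I k. (t k 0 / t k j) ^ N j) * (if k = 1 then 1 else \<Prod>j\<in>I k. (t k 0 / t k j) ^ ?b k j)"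
    if k: "k \<in> {1..r}" for k
  proof -
    have "Poly_Mapping.lookup m (Xarr k j) = N j + (if k = 1 then 0 else ?b k j)" if j: "j \<in> I k" for j
    proof -
      have "int (Poly_Mapping.lookup m (Xarr k j)) = int (N j) + (if k = 1 then 0 else int (?b k j))"
        using m k j N[OF k j] by (simp add: balanced_def)
      then show ?thesis by (auto split: if_splits)
    qed
    then show ?thesis by (simp add: power_add prod.distrib)
  qed
  have "(\<Prod>k=1..r. if k = 1 then 1 else \<Prod>j\<in>I k. (t k 0 / t k j) ^ ?b k j)
      = (\<Prod>k=2..r. if k = 1 then 1 else \<Prod>j\<in>I k. (t k 0 / t k j) ^ ?b k j)"
    unfolding split_first_level by (subst prod.insert) auto
  also have "\<dots> = (\<Prod>k=2..r. \<Prod>j\<in>I k. (t k 0 / t k j) ^ ?b k j)"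
    by (rule prod.cong) auto
  finally have "mval (chain_act t (\<lambda>_. 1)) m = (\<Prod>k=1..r. \<Prod>j\<in>I k. (t k 0 / t k j) ^ N j) *
      ((\<Prod>k=2..r. \<Prod>j\<in>I k. (t k 0 / t k j) ^ ?b k j) * (\<Prod>k=2..r. \<Prod>j\<in>I k. (t k j / t (k - 1) 0) ^ ?b k j))"
    unfolding mval_torus[OF keys] by (simp add: X prod.distrib mult.assoc)
  also have "(\<Prod>k=2..r. \<Prod>j\<in>I k. (t k 0 / t k j) ^ ?b k j) * (\<Prod>k=2..r. \<Prod>j\<in>I k. (t k j / t (k - 1) 0) ^ ?b k j)
      = (\<Prod>k=2..r. (t k 0 / t (k - 1) 0) powi (int d * excess k))"
    unfolding prod.distrib[symmetric]
  proof (rule prod.cong[OF refl])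
    fix k assume k: "k \<in> {2..r}"
    have "(\<Prod>j\<in>I k. (t k 0 / t k j) ^ ?b k j * (t k j / t (k - 1) 0) ^ ?b k j) = (\<Prod>j\<in>I k. (t k 0 / t (k - 1) 0) ^ ?b k j)"
    proof (rule prod.cong[OF refl])
      fix j assume "j \<in> I k"
      then have "t k j \<noteq> 0" using tk[of k] k by simp
      then show "(t k 0 / t k j) ^ ?b k j * (t k j / t (k - 1) 0) ^ ?b k j = (t k 0 / t (k - 1) 0) ^ ?b k j"
        by (simp flip: power_mult_distrib)
    qed
    also have "\<dots> = (t k 0 / t (k - 1) 0) powi (int (\<Sum>j\<in>I k. ?b k j))"
      by (simp only: power_sum power_int_of_nat)
    also have "int (\<Sum>j\<in>I k. ?b k j) = int d * excess k"
      using m k by (simp add: balanced_def)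
    finally show "(\<Prod>j\<in>I k. (t k 0 / t k j) ^ ?b k j * (t k j / t (k - 1) 0) ^ ?b k j)
        = (t k 0 / t (k - 1) 0) powi (int d * excess k)" .
  qed
  also have "\<dots> = (\<Prod>k=1..r. t k 0 powi (int d * excess k - int d * excess (Suc k)))"
    using telescope[of r "\<lambda>k. t k 0" "\<lambda>k. int d * excess k"] tk(1) r_pos
    by (simp add: excess_1[simplified] excess_end)
  also have "(\<Prod>k=1..r. \<Prod>j\<in>I k. (t k 0 / t k j) ^ N j) * \<dots>
      = (\<Prod>k=1..r. t k 0 powi (int d * ?\<theta>0) * (\<Prod>j\<in>I k. t k j powi (- (int d * (int r * \<theta> j)))))"
    unfolding prod.distrib[symmetric]
  proof (rule prod.cong[OF refl])
    fix k assume k: "k \<in> {1..r}"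
    have "(\<Prod>j\<in>I k. (t k 0 / t k j) ^ N j)
        = (\<Prod>j\<in>I k. t k 0 powi (int d * (int r * \<theta> j)) * t k j powi (- (int d * (int r * \<theta> j))))"
    proof (rule prod.cong[OF refl])
      fix j assume "j \<in> I k"
      show "(t k 0 / t k j) ^ N j = t k 0 powi (int d * (int r * \<theta> j)) * t k j powi (- (int d * (int r * \<theta> j)))"
        unfolding N[OF k \<open>j \<in> I k\<close>, symmetric] power_int_minus power_int_of_nat
        by (simp only: power_divide) (simp only: divide_inverse)
    qed
    also have "\<dots> = t k 0 powi (\<Sum>j\<in>I k. int d * (int r * \<theta> j)) * (\<Prod>j\<in>I k. t k j powi (- (int d * (int r * \<theta> j))))"
      by (simp only: prod.distrib prod_powi[OF tk(1)[OF k]])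
    finally have "(\<Prod>j\<in>I k. (t k 0 / t k j) ^ N j) * t k 0 powi (int d * excess k - int d * excess (Suc k))
        = (t k 0 powi (\<Sum>j\<in>I k. int d * (int r * \<theta> j)) * t k 0 powi (int d * excess k - int d * excess (Suc k)))
           * (\<Prod>j\<in>I k. t k j powi (- (int d * (int r * \<theta> j))))"
      by (simp add: mult_ac)
    also have "t k 0 powi (\<Sum>j\<in>I k. int d * (int r * \<theta> j)) * t k 0 powi (int d * excess k - int d * excess (Suc k))
        = t k 0 powi (int d * ?\<theta>0)"
    proof -
      have e: "excess (Suc k) = excess k + int r * (\<Sum>j\<in>I k. \<theta> j) - ?\<theta>0" using k by (intro excess_Suc) simp
      have "(\<Sum>j\<in>I k. int d * (int r * \<theta> j)) + (int d * excess k - int d * excess (Suc k)) = int d * ?\<theta>0"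
        unfolding e by (simp add: algebra_simps sum_distrib_left[symmetric])
      then show ?thesis using tk(1)[OF k] by (simp flip: power_int_add)
    qed
    finally show "(\<Prod>j\<in>I k. (t k 0 / t k j) ^ N j) * t k 0 powi (int d * excess k - int d * excess (Suc k))
        = t k 0 powi (int d * ?\<theta>0) * (\<Prod>j\<in>I k. t k j powi (- (int d * (int r * \<theta> j))))" .
  qed
  finally show ?thesis unfolding char_eq .
qed

text \<open>
  On torus elements whose coordinates are powers of two, weights are linear in the exponents.  Unit
  vectors \<open>s\<close> then extract the condition at a single vertex.
\<close>

lemma weight_linear:
  fixes s :: "nat \<Rightarrow> nat \<Rightarrow> int"
  assumes keys: "Poly_Mapping.keys m \<subseteq> arrows"
    and wt: "\<And>t. t \<in> chain_torus r I \<Longrightarrow> mval (chain_act t (\<lambda>_. 1)) m = chain_char r I (star_stab n r \<theta>) t ^ d"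
  shows "(\<Sum>k=1..r. \<Sum>j\<in>I k. (s k 0 - s k j) * int (Poly_Mapping.lookup m (Xarr k j))) +
     (\<Sum>k=2..r. \<Sum>j\<in>I k. (s k j - s (k - 1) 0) * int (Poly_Mapping.lookup m (Yarr (k - 1) j)))
    = (\<Sum>k=1..r. s k 0 * (int d * (\<Sum>j=1..n. \<theta> j)) + (\<Sum>j\<in>I k. s k j * (- (int d * (int r * \<theta> j)))))"
proof -
  define t :: "nat \<Rightarrow> nat \<Rightarrow> complex" where "t k j = 2 powi s k j" for k j
  have two: "(2::complex) \<noteq> 0" by simp
  have add_powi: "(2::complex) powi a * 2 powi b = 2 powi (a + b)" for a b
    by (simp add: power_int_add)
  have "t \<in> chain_torus r I" by (simp add: chain_torus_def t_def)
  note wt[OF this]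
  moreover have "(t k j / t k' j') ^ N = 2 powi ((s k j - s k' j') * int N)" for k j k' j' N
    by (simp add: t_def power_int_mult flip: power_int_diff)
  moreover have "t k j powi a = 2 powi (s k j * a)" for k j a
    by (simp add: t_def power_int_mult)
  ultimately have "(2::complex) powi ((\<Sum>k=1..r. \<Sum>j\<in>I k. (s k 0 - s k j) * int (Poly_Mapping.lookup m (Xarr k j))) +
     (\<Sum>k=2..r. \<Sum>j\<in>I k. (s k j - s (k - 1) 0) * int (Poly_Mapping.lookup m (Yarr (k - 1) j))))
    = 2 powi (\<Sum>k=1..r. s k 0 * (int d * (\<Sum>j=1..n. \<theta> j)) + (\<Sum>j\<in>I k. s k j * (- (int d * (int r * \<theta> j)))))"
    unfolding mval_torus[OF keys] char_eq
    by (simp only: prod_powi[OF two] add_powi)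
  then show ?thesis by (rule two_powi_inject)
qed

text \<open>
  The unit vector at a branch gives the exponent of its \<open>X\<close>.  The unit vectors at the centres of
  the levels below the last one determine the \<open>Y\<close>-degree of each level from that of the previous
  level.
\<close>

lemma weight_balanced:
  assumes keys: "Poly_Mapping.keys m \<subseteq> arrows"
    and wt: "\<And>t. t \<in> chain_torus r I \<Longrightarrow> mval (chain_act t (\<lambda>_. 1)) m = chain_char r I (star_stab n r \<theta>) t ^ d"
  shows "balanced d m"
proof -
  let ?a = "\<lambda>k j. int (Poly_Mapping.lookup m (Xarr k j))"
  let ?b = "\<lambda>k j. int (Poly_Mapping.lookup m (Yarr (k - 1) j))"
  let ?\<theta>0 = "\<Sum>j=1..n. \<theta> j"
  have fin2: "finite (I k)" if "k \<in> {2..r}" for k using finite_branches that by simp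
  have nz: "j \<noteq> 0" if "k \<in> {1..r}" "j \<in> I k" for k j using branch[OF that] by simp
  have a: "?a k0 j0 = int d * (int r * \<theta> j0) + (if k0 = 1 then 0 else ?b k0 j0)"
    if k0: "k0 \<in> {1..r}" and j0: "j0 \<in> I k0" for k0 j0
  proof -
    define s :: "nat \<Rightarrow> nat \<Rightarrow> int" where "s k j = (if k = k0 \<and> j = j0 then 1 else 0)" for k j
    have s0: "s k 0 = 0" for k using nz[OF k0 j0] by (simp add: s_def)
    have "(\<Sum>k=1..r. \<Sum>j\<in>I k. (s k 0 - s k j) * ?a k j) = (\<Sum>k=1..r. \<Sum>j\<in>I k. if k = k0 \<and> j = j0 then - ?a k j else 0)"
      unfolding s0 by (intro sum.cong refl) (simp add: s_def)
    also have "\<dots> = - ?a k0 j0"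
      using k0 j0 finite_branches by (subst sum_single_branch) auto
    finally have 1: "(\<Sum>k=1..r. \<Sum>j\<in>I k. (s k 0 - s k j) * ?a k j) = - ?a k0 j0" .
    have "(\<Sum>k=2..r. \<Sum>j\<in>I k. (s k j - s (k - 1) 0) * ?b k j) = (\<Sum>k=2..r. \<Sum>j\<in>I k. if k = k0 \<and> j = j0 then ?b k j else 0)"
      unfolding s0 by (intro sum.cong refl) (simp add: s_def)
    also have "\<dots> = (if k0 = 1 then 0 else ?b k0 j0)"
      using k0 j0 fin2 by (subst sum_single_branch) auto
    finally have 2: "(\<Sum>k=2..r. \<Sum>j\<in>I k. (s k j - s (k - 1) 0) * ?b k j) = (if k0 = 1 then 0 else ?b k0 j0)" .
    have "(\<Sum>k=1..r. s k 0 * (int d * ?\<theta>0) + (\<Sum>j\<in>I k. s k j * (- (int d * (int r * \<theta> j)))))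
        = (\<Sum>k=1..r. \<Sum>j\<in>I k. if k = k0 \<and> j = j0 then - (int d * (int r * \<theta> j)) else 0)"
      unfolding s0 mult_zero_left add_0 by (intro sum.cong refl) (simp add: s_def)
    also have "\<dots> = - (int d * (int r * \<theta> j0))"
      using k0 j0 finite_branches by (subst sum_single_branch) auto
    finally show ?thesis using weight_linear[OF keys wt, of s] 1 2 by simp
  qed
  have level_step: "(\<Sum>j\<in>I k0. ?a k0 j) - (\<Sum>j\<in>I (Suc k0). ?b (Suc k0) j) = int d * ?\<theta>0"
    if k0: "1 \<le> k0" "k0 < r" for k0
  proof -
    define s :: "nat \<Rightarrow> nat \<Rightarrow> int" where "s k j = (if k = k0 \<and> j = 0 then 1 else 0)" for k j
    have sj: "s k j = 0" if "k \<in> {1..r}" "j \<in> I k" for k j using nz[OF that] by (simp add: s_def)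
    have "(\<Sum>k=1..r. \<Sum>j\<in>I k. (s k 0 - s k j) * ?a k j) = (\<Sum>k=1..r. if k = k0 then \<Sum>j\<in>I k. ?a k j else 0)"
      by (intro sum.cong refl) (simp add: sj, simp add: s_def)
    then have 1: "(\<Sum>k=1..r. \<Sum>j\<in>I k. (s k 0 - s k j) * ?a k j) = (\<Sum>j\<in>I k0. ?a k0 j)" using k0 by simp
    have "(\<Sum>k=2..r. \<Sum>j\<in>I k. (s k j - s (k - 1) 0) * ?b k j) = (\<Sum>k=2..r. if k = Suc k0 then - (\<Sum>j\<in>I k. ?b k j) else 0)"
    proof (intro sum.cong refl)
      fix k assume k: "k \<in> {2..r}"
      then have "(k - 1 = k0) = (k = Suc k0)" by auto
      then have "s (k - 1) 0 = (if k = Suc k0 then 1 else 0)" by (simp add: s_def)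
      moreover have "(\<Sum>j\<in>I k. (s k j - s (k - 1) 0) * ?b k j) = (\<Sum>j\<in>I k. - s (k - 1) 0 * ?b k j)"
        using k by (intro sum.cong refl) (simp add: sj)
      ultimately show "(\<Sum>j\<in>I k. (s k j - s (k - 1) 0) * ?b k j) = (if k = Suc k0 then - (\<Sum>j\<in>I k. ?b k j) else 0)"
        by (simp add: sum_negf)
    qed
    then have 2: "(\<Sum>k=2..r. \<Sum>j\<in>I k. (s k j - s (k - 1) 0) * ?b k j) = - (\<Sum>j\<in>I (Suc k0). ?b (Suc k0) j)"
      using k0 by simp
    have "(\<Sum>k=1..r. s k 0 * (int d * ?\<theta>0) + (\<Sum>j\<in>I k. s k j * (- (int d * (int r * \<theta> j)))))
        = (\<Sum>k=1..r. if k = k0 then int d * ?\<theta>0 else 0)"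
      by (intro sum.cong refl) (simp add: sj, simp add: s_def)
    then have "(\<Sum>k=1..r. s k 0 * (int d * ?\<theta>0) + (\<Sum>j\<in>I k. s k j * (- (int d * (int r * \<theta> j)))))
        = int d * ?\<theta>0" using k0 by simp
    then show ?thesis using weight_linear[OF keys wt, of s] 1 2 by simp
  qed
  have sum: "(if k = 1 then 0 else \<Sum>j\<in>I k. ?b k j) = int d * excess k" if "1 \<le> k" "k \<le> r" for k
    using that
  proof (induction k rule: dec_induct)
    case base
    then show ?case using excess_1 by simp
  next
    case (step k)
    have "(\<Sum>j\<in>I k. ?a k j) = (\<Sum>j\<in>I k. int d * (int r * \<theta> j)) + (if k = 1 then 0 else \<Sum>j\<in>I k. ?b k j)"
      using a[of k] step by (cases "k = 1") (simp_all add: sum.distrib)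
    also have "(if k = 1 then 0 else \<Sum>j\<in>I k. ?b k j) = int d * excess k" using step by simp
    finally have "(\<Sum>j\<in>I (Suc k). ?b (Suc k) j)
        = (\<Sum>j\<in>I k. int d * (int r * \<theta> j)) + int d * excess k - int d * ?\<theta>0"
      using level_step[of k] step.hyps step.prems by simp
    moreover have "excess (Suc k) = excess k + int r * (\<Sum>j\<in>I k. \<theta> j) - ?\<theta>0"
      using step.hyps by (intro excess_Suc) simp
    ultimately have "(\<Sum>j\<in>I (Suc k). ?b (Suc k) j) = int d * excess (Suc k)"
      by (simp only: sum_distrib_left[symmetric] right_diff_distrib distrib_left)
    then show ?case using step.hyps by simp
  qed
  show ?thesis
    unfolding balanced_def
  proof (intro conjI ballI keys)
    fix k j assume "k \<in> {1..r}" "j \<in> I k"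
    then show "?a k j = int d * (int r * \<theta> j) + (if k = 1 then 0 else ?b k j)" by (rule a)
  next
    fix k assume "k \<in> {2..r}"
    then show "(\<Sum>j\<in>I k. ?b k j) = int d * excess k" using sum[of k] by auto
  qed
qed

lemma semi_invariants_iff:
  "f \<in> semi_invariants r I (star_stab n r \<theta>) d \<longleftrightarrow> Poly_Mapping.keys f \<subseteq> {m. balanced d m}"
proof
  assume "f \<in> semi_invariants r I (star_stab n r \<theta>) d"
  then have f: "f \<in> polys arrows" "\<And>t x. t \<in> chain_torus r I \<Longrightarrow>
      peval (chain_act t x) f = chain_char r I (star_stab n r \<theta>) t ^ d * peval x f"
    by (auto simp: semi_invariants_def)
  show "Poly_Mapping.keys f \<subseteq> {m. balanced d m}"
  proof (rule subsetI, rule CollectI, rule weight_balanced)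
    fix m assume m: "m \<in> Poly_Mapping.keys f"
    then show "Poly_Mapping.keys m \<subseteq> arrows" using f(1) by (auto simp: polys_def)
    fix t assume t: "t \<in> chain_torus r I"
    let ?\<chi> = "chain_char r I (star_stab n r \<theta>) t ^ d"
    let ?c = "\<lambda>m. Poly_Mapping.lookup f m * (mval (chain_act t (\<lambda>_. 1)) m - ?\<chi>)"
    have "(\<Sum>m\<in>Poly_Mapping.keys f. ?c m * mval x m) = peval (chain_act t x) f - ?\<chi> * peval x f" for x
      unfolding peval_def mval_def[symmetric] mval_act[of t x]
      by (simp add: sum_distrib_left sum_subtractf[symmetric] algebra_simps)
    then have "?c m = 0"
      using f(2)[OF t] by (intro monomials_independent[OF _ _ m, of ?c]) simp_all
    then show "mval (chain_act t (\<lambda>_. 1)) m = ?\<chi>" using m by (simp add: in_keys_iff)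
  qed
next
  assume f: "Poly_Mapping.keys f \<subseteq> {m. balanced d m}"
  have "peval (chain_act t x) f = chain_char r I (star_stab n r \<theta>) t ^ d * peval x f"
    if "t \<in> chain_torus r I" for t x
  proof -
    have "mval (chain_act t x) m = chain_char r I (star_stab n r \<theta>) t ^ d * mval x m" if "m \<in> Poly_Mapping.keys f" for m
      using f that balanced_weight[OF _ \<open>t \<in> chain_torus r I\<close>] mval_act[of t x m] by auto
    then show ?thesis
      unfolding peval_def mval_def[symmetric] by (simp add: sum_distrib_left mult.left_commute)
  qed
  moreover have "f \<in> polys arrows" using f by (auto simp: polys_def balanced_def)
  ultimately show "f \<in> semi_invariants r I (star_stab n r \<theta>) d" by (simp add: semi_invariants_def)
qed


subsection \<open>The moduli space as a linear section of a product of projective spaces\<close>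

text \<open>
  The monomial of weight \<open>d\<close> with exponents \<open>b\<close> of the arrows \<open>Y\<close>.  Every branch lies in a single
  level, so the branch alone serves as index.
\<close>

definition exponent :: "nat \<Rightarrow> (nat \<Rightarrow> nat) \<Rightarrow> chain_arrow \<Rightarrow> nat" where
  "exponent d b v = (case v of
     Xarr k j \<Rightarrow> d * (r * nat (\<theta> j)) + (if k = 1 then 0 else b j) | Yarr k j \<Rightarrow> b j)"

definition chain_monomial :: "nat \<Rightarrow> (nat \<Rightarrow> nat) \<Rightarrow> (chain_arrow \<Rightarrow>\<^sub>0 nat)" where
  "chain_monomial d b = (\<Sum>v\<in>arrows. Poly_Mapping.single v (exponent d b v))"

text \<open>
  Since no \<open>X\<close> vanishes at a semistable chain, the torus orbit of every such chain contains a
  point where all of them are one.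
\<close>

definition chain_point :: "(nat \<Rightarrow> complex) \<Rightarrow> chain_arrow \<Rightarrow> complex" where
  "chain_point y v = (case v of Xarr k j \<Rightarrow> 1 | Yarr k j \<Rightarrow> y j)"

lemma lookup_chain_monomial:
  "Poly_Mapping.lookup (chain_monomial d b) v = (if v \<in> arrows then exponent d b v else 0)"
  by (simp add: chain_monomial_def lookup_sum lookup_single when_def finite_arrows)

lemma X_arrow: "Xarr k j \<in> arrows \<longleftrightarrow> k \<in> {1..r} \<and> j \<in> I k"
  by (auto simp: chain_arrows_def)

lemma Y_arrow: "k \<in> {2..r} \<Longrightarrow> j \<in> I k \<Longrightarrow> Yarr (k - 1) j \<in> arrows"
  unfolding chain_arrows_def by blast

lemma disjoint_upper: "disjoint_family_on I {2..r}"
  by (rule disjoint_family_on_mono[OF _ disjoint]) auto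

lemma balanced_chain_monomial:
  assumes pos: "\<And>k. k \<in> {2..r} \<Longrightarrow> excess k > 0"
  shows "{m. balanced d m} = chain_monomial d ` multidegree {2..r} I (\<lambda>k. nat (excess k)) d"
proof (intro subset_antisym subsetI)
  fix m assume "m \<in> {m. balanced d m}"
  then have keys: "Poly_Mapping.keys m \<subseteq> arrows"
    and X: "\<And>k j. k \<in> {1..r} \<Longrightarrow> j \<in> I k \<Longrightarrow> int (Poly_Mapping.lookup m (Xarr k j)) =
        int d * (int r * \<theta> j) + (if k = 1 then 0 else int (Poly_Mapping.lookup m (Yarr (k - 1) j)))"
    and S: "\<And>k. k \<in> {2..r} \<Longrightarrow> (\<Sum>j\<in>I k. int (Poly_Mapping.lookup m (Yarr (k - 1) j))) = int d * excess k"
    by (auto simp: balanced_def)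
  define b where "b j = (\<Sum>k=2..r. if j \<in> I k then Poly_Mapping.lookup m (Yarr (k - 1) j) else 0)" for j
  have b: "b j = Poly_Mapping.lookup m (Yarr (k - 1) j)" if k: "k \<in> {2..r}" "j \<in> I k" for k j
  proof -
    have "j \<in> I k' \<longleftrightarrow> k' = k" if "k' \<in> {2..r}" for k'
      using k that disjoint_upper unfolding disjoint_family_on_def by blast
    then have "b j = (\<Sum>k'=2..r. if k' = k then Poly_Mapping.lookup m (Yarr (k' - 1) j) else 0)"
      unfolding b_def by (intro sum.cong) auto
    then show ?thesis using k(1) by simp
  qed
  have "m = chain_monomial d b"
  proof (rule poly_mapping_eqI)
    fix v
    show "Poly_Mapping.lookup m v = Poly_Mapping.lookup (chain_monomial d b) v"
    proof (cases "v \<in> arrows")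
      case False
      then show ?thesis using keys by (auto simp: lookup_chain_monomial in_keys_iff)
    next
      case True
      then consider k j where "v = Xarr k j" "k \<in> {1..r}" "j \<in> I k"
        | k j where "v = Yarr (k - 1) j" "k \<in> {2..r}" "j \<in> I k"
        unfolding chain_arrows_def by blast
      then show ?thesis
      proof cases
        case (1 k j)
        have "0 < \<theta> j" using branch[OF 1(2,3)] \<theta>_pos by blast
        then have "int (Poly_Mapping.lookup m (Xarr k j)) = int (exponent d b (Xarr k j))"
          using X[OF 1(2,3)] b[of k j] 1 by (auto simp: exponent_def)
        then show ?thesis using True 1(1) by (simp add: lookup_chain_monomial)
      next
        case (2 k j)
        then show ?thesis using True b[OF 2(2,3)] by (simp add: lookup_chain_monomial exponent_def)
      qed
    qed
  qed
  moreover have "b \<in> multidegree {2..r} I (\<lambda>k. nat (excess k)) d"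
    unfolding multidegree_def
  proof (intro CollectI conjI allI impI ballI)
    fix k assume k: "k \<in> {2..r}"
    have "int (\<Sum>j\<in>I k. b j) = int d * excess k" using S[OF k] b[OF k] by simp
    also have "\<dots> = int (d * nat (excess k))" using pos[OF k] by simp
    finally show "(\<Sum>j\<in>I k. b j) = d * nat (excess k)" by (simp only: of_nat_eq_iff)
  next
    fix j assume "j \<notin> (\<Union>k\<in>{2..r}. I k)"
    then show "b j = 0" unfolding b_def by (intro sum.neutral) auto
  qed
  ultimately show "m \<in> chain_monomial d ` multidegree {2..r} I (\<lambda>k. nat (excess k)) d" by blast
next
  fix m assume "m \<in> chain_monomial d ` multidegree {2..r} I (\<lambda>k. nat (excess k)) d"
  then obtain b where m: "m = chain_monomial d b" and b: "b \<in> multidegree {2..r} I (\<lambda>k. nat (excess k)) d" by blast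
  have Y: "Poly_Mapping.lookup m (Yarr (k - 1) j) = b j" if "k \<in> {2..r}" "j \<in> I k" for k j
    using Y_arrow[OF that] by (simp add: m lookup_chain_monomial exponent_def)
  show "m \<in> {m. balanced d m}"
    unfolding balanced_def
  proof (intro CollectI conjI ballI)
    show "Poly_Mapping.keys m \<subseteq> arrows"
      by (auto simp: m lookup_chain_monomial in_keys_iff split: if_splits)
    fix k j assume k: "k \<in> {1..r}" "j \<in> I k"
    have "0 < \<theta> j" using branch[OF k] \<theta>_pos by blast
    moreover have "Xarr k j \<in> arrows" using k by (simp add: X_arrow)
    ultimately show "int (Poly_Mapping.lookup m (Xarr k j)) =
        int d * (int r * \<theta> j) + (if k = 1 then 0 else int (Poly_Mapping.lookup m (Yarr (k - 1) j)))"
      using Y[of k j] k by (auto simp: m lookup_chain_monomial exponent_def)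
  next
    fix k assume k: "k \<in> {2..r}"
    have "(\<Sum>j\<in>I k. b j) = d * nat (excess k)" using b k by (simp add: multidegree_def)
    then have "int (\<Sum>j\<in>I k. b j) = int d * excess k" using pos[OF k] by simp
    then show "(\<Sum>j\<in>I k. int (Poly_Mapping.lookup m (Yarr (k - 1) j))) = int d * excess k"
      using Y[OF k] by simp
  qed
qed

lemma semi_invariants_spanned:
  assumes "\<And>k. k \<in> {2..r} \<Longrightarrow> excess k > 0"
  shows "semi_invariants r I (star_stab n r \<theta>)
    = spanned (\<lambda>d. chain_monomial d ` multidegree {2..r} I (\<lambda>k. nat (excess k)) d)"
proof
  fix d
  show "semi_invariants r I (star_stab n r \<theta>) d
    = spanned (\<lambda>d. chain_monomial d ` multidegree {2..r} I (\<lambda>k. nat (excess k)) d) d"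
  proof -
    have "{m. balanced d m} = chain_monomial d ` multidegree {2..r} I (\<lambda>k. nat (excess k)) d"
      by (rule balanced_chain_monomial) (rule assms)
    then show ?thesis using semi_invariants_iff[of _ d] unfolding spanned_def by blast
  qed
qed

lemma segre_chain:
  assumes "\<And>k. k \<in> {2..r} \<Longrightarrow> excess k > 0"
  shows "segre {2..r} I (\<lambda>k. nat (excess k)) chain_monomial chain_point"
proof
  show "finite (I k)" if "k \<in> {2..r}" for k using finite_branches that by simp
  show "disjoint_family_on I {2..r}" by (rule disjoint_upper)
  show "0 < nat (excess k)" if "k \<in> {2..r}" for k using assms[OF that] by simp
  show "chain_monomial 0 (\<lambda>_. 0) = 0"
    unfolding chain_monomial_def by (intro sum.neutral) (auto simp: exponent_def split: chain_arrow.splits)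
  show "chain_monomial d b + chain_monomial e b' = chain_monomial (d + e) (\<lambda>i. b i + b' i)" for d e b b'
    by (rule poly_mapping_eqI)
      (auto simp: lookup_add lookup_chain_monomial exponent_def algebra_simps split: chain_arrow.splits)
  show "(\<exists>i. \<forall>y. chain_point y v = y i) \<or> (\<forall>y. chain_point y v = 1)" for v
    by (cases v) (auto simp: chain_point_def)
  show "mval (chain_point y) (chain_monomial d b) = (\<Prod>i\<in>(\<Union>k\<in>{2..r}. I k). y i ^ b i)" for y d b
  proof -
    have "mval (chain_point y) (chain_monomial d b) = (\<Prod>v\<in>arrows. chain_point y v ^ exponent d b v)"
      by (simp add: chain_monomial_def mval_sum)
    also have "\<dots> = (\<Prod>k=1..r. \<Prod>j\<in>I k. chain_point y (Xarr k j) ^ exponent d b (Xarr k j)) *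
        (\<Prod>k=2..r. \<Prod>j\<in>I k. chain_point y (Yarr (k - 1) j) ^ exponent d b (Yarr (k - 1) j))"
      by (rule prod_chain_arrows) (rule finite_branches)
    also have "\<dots> = (\<Prod>k=2..r. \<Prod>j\<in>I k. y j ^ b j)"
      by (simp add: chain_point_def exponent_def)
    also have "\<dots> = (\<Prod>i\<in>(\<Union>k\<in>{2..r}. I k). y i ^ b i)"
      using finite_branches disjoint_upper
      by (intro prod.UNION_disjoint[symmetric]) (auto simp: disjoint_family_on_def)
    finally show ?thesis .
  qed
qed simp

text \<open>
  Up to sign, the excess is the value of the stability parameter on the subdimension vector with
  \<open>k - 1\<close> at the centre and one at the branches of the levels below \<open>k\<close>.
\<close>

lemma excess_nonzero:
  assumes k: "k \<in> {2..r}"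
  shows "excess k \<noteq> 0"
proof
  assume zero: "excess k = 0"
  let ?U = "\<Union>i\<in>{1..<k}. I i"
  define e :: "nat \<Rightarrow> nat" where "e v = (if v = 0 then k - 1 else if v \<in> ?U then 1 else 0)" for v
  have sub: "?U \<subseteq> {1..n}" using k branch by fastforce
  have "(\<forall>v\<le>n. e v \<le> star_dim r v) \<and> (\<exists>v\<le>n. e v \<noteq> 0) \<and> (\<exists>v\<le>n. e v \<noteq> star_dim r v)"
    using k by (auto simp: e_def star_dim_def intro!: exI[of _ 0])
  then have "(\<Sum>v\<le>n. star_stab n r \<theta> v * int (e v)) \<noteq> 0"
    using generic unfolding generic_def by blast
  moreover have "(\<Sum>v\<le>n. star_stab n r \<theta> v * int (e v)) = - excess k"
  proof -
    have "{..n} = insert 0 {1..n}" by auto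
    then have "(\<Sum>v\<le>n. star_stab n r \<theta> v * int (e v))
        = (\<Sum>j=1..n. \<theta> j) * int (k - 1) + (\<Sum>v=1..n. star_stab n r \<theta> v * int (e v))"
      by (simp add: star_stab_def e_def)
    also have "(\<Sum>v=1..n. star_stab n r \<theta> v * int (e v)) = (\<Sum>v=1..n. if v \<in> ?U then - int r * \<theta> v else 0)"
      by (intro sum.cong) (auto simp: star_stab_def e_def)
    also have "\<dots> = (\<Sum>v\<in>?U. - int r * \<theta> v)"
      by (subst sum.inter_restrict[symmetric]) (simp_all only: Int_absorb1[OF sub] finite_atLeastAtMost)
    also have "\<dots> = (\<Sum>i=1..<k. \<Sum>j\<in>I i. - int r * \<theta> j)"
      using k finite_branches disjoint by (intro sum.UNION_disjoint) (auto simp: disjoint_family_on_def)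
    also have "\<dots> = - int r * (\<Sum>i=1..<k. \<Sum>j\<in>I i. \<theta> j)"
      by (simp only: sum_distrib_left)
    finally show ?thesis using k by (simp add: excess_def of_nat_diff algebra_simps)
  qed
  ultimately show False using zero by simp
qed

text \<open>
  For a monomial of positive weight, the excess is up to a positive factor a sum of exponents.
\<close>

lemma excess_positive:
  assumes "points (chain_moduli_free r I (star_stab n r \<theta>)) \<noteq> {}" and k: "k \<in> {2..r}"
  shows "excess k > 0"
proof -
  let ?G = "semi_invariants r I (star_stab n r \<theta>)"
  from assms(1) obtain p where "p \<in> proj_points ?G"
    unfolding chain_moduli_free_def Proj_def proj_topology_def points_def by auto
  then have rel: "relevant_prime ?G p" by (simp add: proj_points_def)
  then interpret primeideal p "graded_ring ?G" by (simp add: relevant_prime_def)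
  have "0 \<in> p" using additive_subgroup.zero_closed[OF additive_subgroup_axioms] by (simp add: graded_ring_def)
  moreover obtain F where F: "\<forall>d. coeff F d \<in> ?G d" "coeff F 0 = 0" "F \<notin> p"
    using rel by (auto simp: relevant_prime_def graded_ring_def)
  ultimately have "F \<noteq> 0" by blast
  then obtain d where d: "coeff F d \<noteq> 0" by (meson leading_coeff_neq_0)
  with F(2) have "d > 0" by (cases d) auto
  obtain m where "m \<in> Poly_Mapping.keys (coeff F d)" using d by (meson keys_eq_empty ex_in_conv)
  then have "balanced d m" using F(1) semi_invariants_iff by blast
  then have "int d * excess k = (\<Sum>j\<in>I k. int (Poly_Mapping.lookup m (Yarr (k - 1) j)))"
    using k by (simp add: balanced_def)
  also have "\<dots> \<ge> 0" by (intro sum_nonneg) simp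
  finally have "excess k \<ge> 0" using \<open>d > 0\<close> by (simp add: zero_le_mult_iff)
  then show ?thesis using excess_nonzero[OF k] by simp
qed

lemma relation_in_polys: "k \<in> {2..r} \<Longrightarrow> chain_relation I k \<in> polys arrows"
proof -
  assume k: "k \<in> {2..r}"
  have var: "var v \<in> polys arrows" if "v \<in> arrows" for v
    using that by (simp add: polys_def var_def)
  have sum: "sum f S \<in> polys arrows" if "\<And>s. s \<in> S \<Longrightarrow> f s \<in> polys arrows" for f :: "nat \<Rightarrow> chain_arrow cpoly" and S
    using that by (induction S rule: infinite_finite_induct) (auto intro: polys_0 polys_add)
  have "var (Xarr k j) * var (Yarr (k - 1) j) \<in> polys arrows" if "j \<in> I k" for j
    using k that Y_arrow[OF k that] by (intro polys_mult var) (simp_all add: X_arrow)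
  then show ?thesis
    unfolding chain_relation_def by (rule sum)
qed

lemma peval_relation:
  "peval (chain_point y) (chain_relation I k) = (\<Sum>j\<in>I k. y j)"
  by (simp add: chain_relation_def peval_sum chain_point_def)

lemma relation_ideal_mult:
  assumes "k \<in> {2..r}" "f \<in> polys arrows"
  shows "f * chain_relation I k \<in> relation_ideal r I"
proof -
  interpret cring "ring_on (polys arrows)" by (rule cring_polys)
  have sub: "chain_relation I ` {2..r} \<subseteq> carrier (ring_on (polys arrows))"
    using relation_in_polys by auto
  have "ideal (relation_ideal r I) (ring_on (polys arrows))"
    unfolding relation_ideal_def by (rule genideal_ideal[OF sub])
  note D = ideal_ring_onD[OF this]
  have "chain_relation I k \<in> relation_ideal r I"
    using genideal_self[OF sub] assms(1) unfolding relation_ideal_def by blast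
  then show ?thesis using D(4) assms(2) by blast
qed

lemma relation_ideal_vanishes:
  assumes "\<forall>k\<in>{2..r}. (\<Sum>j\<in>I k. y j) = 0" "f \<in> relation_ideal r I"
  shows "peval (chain_point y) f = 0"
  by (rule genideal_vanishes[OF _ _ assms(2)[unfolded relation_ideal_def]])
    (use relation_in_polys assms(1) peval_relation in auto)

text \<open>
  A point satisfies the relation of level \<open>k\<close> iff its coordinates in this level add up to zero.
  For one direction the relation is multiplied by a monomial that does not vanish at the point,
  because the relation itself is not a semi-invariant.
\<close>

theorem chain_moduli_hyperplanes:
  assumes pos: "\<And>k. k \<in> {2..r} \<Longrightarrow> excess k > 0"
  shows "chain_moduli r I (star_stab n r \<theta>) =
    subvariety (Proj (semi_invariants r I (star_stab n r \<theta>)))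
      (segre.hyperplanes {2..r} I (\<lambda>k. nat (excess k)) chain_monomial chain_point)"
proof -
  interpret S: segre "{2..r}" I "\<lambda>k. nat (excess k)" chain_monomial chain_point
    by (rule segre_chain[OF pos])
  have G: "semi_invariants r I (star_stab n r \<theta>) = S.G" by (rule semi_invariants_spanned[OF pos])
  have "{p \<in> points (Proj S.G). \<forall>d. \<forall>f\<in>S.G d \<inter> relation_ideal r I. monom f d \<in> p} = S.hyperplanes"
  proof (intro subset_antisym subsetI)
    fix p assume "p \<in> {p \<in> points (Proj S.G). \<forall>d. \<forall>f\<in>S.G d \<inter> relation_ideal r I. monom f d \<in> p}"
    then have p: "p \<in> proj_points S.G" and van: "\<And>d f. f \<in> S.G d \<Longrightarrow> f \<in> relation_ideal r I \<Longrightarrow> monom f d \<in> p"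
      by (auto simp: S.points_Proj)
    obtain y where y: "S.admissible y" "p = point_ideal S.G (chain_point y)" by (rule S.point_coordinates[OF p])
    obtain \<tau> where \<tau>: "S.selector \<tau>" "\<And>k. k \<in> {2..r} \<Longrightarrow> y (\<tau> k) \<noteq> 0"
      by (rule S.admissible_selector[OF y(1)]) blast
    let ?v = "S.vertex \<tau>"
    have "(\<Sum>j\<in>I k. y j) = 0" if k: "k \<in> {2..r}" for k
    proof -
      have \<tau>k: "\<tau> k \<in> I k" using \<tau>(1) k by (simp add: S.selector_def)
      have v: "?v (\<tau> k) > 0" using S.vertex_at[OF \<tau>(1) k] pos[OF k] by simp
      have mB: "move ?v (\<tau> k) j \<in> S.B 1" if "j \<in> I k" for j
        by (rule S.move_multidegree[OF S.vertex_multidegree[OF \<tau>(1)] k \<tau>k that v])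
      \<comment> \<open>A vertex monomial without one factor of level \<open>k\<close>; its product with the relation has weight one.\<close>
      define u where "u = chain_monomial 1 (\<lambda>i. ?v i - (if i = \<tau> k then 1 else 0))"
      let ?f = "Poly_Mapping.single u 1 * chain_relation I k"
      have relation_term: "Poly_Mapping.single u 1 * (var (Xarr k j) * var (Yarr (k - 1) j)) = S.M 1 (move ?v (\<tau> k) j)"
        if j: "j \<in> I k" for j
      proof -
        have uniq: "j' = j \<and> k' = k" if "k' \<in> {2..r}" "j' \<in> I k'" "j' = j" for k' j'
          using that k j disjoint_upper unfolding disjoint_family_on_def by blast
        have "Poly_Mapping.single (Xarr k j) 1 + Poly_Mapping.single (Yarr (k - 1) j) 1
            = chain_monomial 0 (\<lambda>i. if i = j then 1 else 0)"
        proof (rule poly_mapping_eqI)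
          fix v
          show "Poly_Mapping.lookup (Poly_Mapping.single (Xarr k j) 1 + Poly_Mapping.single (Yarr (k - 1) j) 1) v
              = Poly_Mapping.lookup (chain_monomial 0 (\<lambda>i. if i = j then 1 else 0)) v"
          proof (cases "v \<in> arrows")
            case False
            moreover have "Xarr k j \<in> arrows" "Yarr (k - 1) j \<in> arrows"
              using k j Y_arrow[OF k j] by (simp_all add: X_arrow)
            ultimately show ?thesis by (auto simp: lookup_add lookup_single lookup_chain_monomial when_def)
          next
            case True
            then consider k' j' where "v = Xarr k' j'" "k' \<in> {1..r}" "j' \<in> I k'"
              | k' j' where "v = Yarr (k' - 1) j'" "k' \<in> {2..r}" "j' \<in> I k'"
              unfolding chain_arrows_def by blast
            then show ?thesis
            proof cases
              case (1 k' j')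
              have "k' = 1 \<or> k' \<in> {2..r}" using 1(2) by auto
              then show ?thesis
                using True 1 uniq[of k' j'] k
                by (auto simp: lookup_add lookup_single lookup_chain_monomial exponent_def when_def)
            next
              case (2 k' j')
              then show ?thesis
                using True uniq[of k' j'] k
                by (auto simp: lookup_add lookup_single lookup_chain_monomial exponent_def when_def)
            qed
          qed
        qed
        then have "u + (Poly_Mapping.single (Xarr k j) 1 + Poly_Mapping.single (Yarr (k - 1) j) 1)
            = chain_monomial 1 (move ?v (\<tau> k) j)"
          unfolding u_def by (simp add: S.mk_add move_def)
        then show ?thesis by (simp add: var_def mult_single S.M_def)
      qed
      have f: "?f = (\<Sum>j\<in>I k. S.M 1 (move ?v (\<tau> k) j))"
        unfolding chain_relation_def sum_distrib_left by (rule sum.cong[OF refl]) (rule relation_term)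
      have "?f \<in> S.G 1" unfolding f by (intro S.G_sum S.M_G mB)
      moreover have "?f \<in> relation_ideal r I"
        by (rule relation_ideal_mult[OF k])
          (auto simp: polys_def u_def lookup_chain_monomial in_keys_iff split: if_splits)
      ultimately have "peval (chain_point y) ?f = 0"
        using van[of ?f 1] y(2) S.monom_point_ideal by blast
      moreover have "mval (chain_point y) u \<noteq> 0"
      proof
        assume "mval (chain_point y) u = 0"
        then have "peval (chain_point y) (S.M 1 (move ?v (\<tau> k) (\<tau> k))) = 0"
          unfolding relation_term[OF \<tau>k, symmetric] by simp
        moreover have "move ?v (\<tau> k) (\<tau> k) = ?v" using v by (auto simp: move_def)
        ultimately show False using S.w_vertex_nonzero[OF \<tau>(1), of y] \<tau>(2) by (simp add: S.peval_M)
      qed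
      ultimately show ?thesis by (simp add: peval_relation)
    qed
    then show "p \<in> S.hyperplanes" unfolding S.hyperplanes_def using y by blast
  next
    fix p assume p: "p \<in> S.hyperplanes"
    then obtain y where y: "p = point_ideal S.G (chain_point y)" "\<forall>k\<in>{2..r}. (\<Sum>j\<in>I k. y j) = 0"
      unfolding S.hyperplanes_def by blast
    have "p \<in> points (Proj S.G)" using p S.hyperplanes_sub by (auto simp: S.points_Proj)
    moreover have "monom f d \<in> p" if "f \<in> S.G d" "f \<in> relation_ideal r I" for d f
      using that relation_ideal_vanishes[OF y(2)] by (simp add: y(1) S.monom_point_ideal)
    ultimately show "p \<in> {p \<in> points (Proj S.G). \<forall>d. \<forall>f\<in>S.G d \<inter> relation_ideal r I. monom f d \<in> p}"
      by blast
  qed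
  then show ?thesis unfolding chain_moduli_def proj_closed_def G by simp
qed

theorem chain_moduli_isomorphic:
  assumes "points (chain_moduli_free r I (star_stab n r \<theta>)) \<noteq> {}"
  shows "isomorphic (chain_moduli r I (star_stab n r \<theta>))
    (prod_space {2..r} (\<lambda>k. proj_space (int (card (I k)) - 2)))"
proof -
  have pos: "excess k > 0" if "k \<in> {2..r}" for k by (rule excess_positive[OF assms that])
  interpret S: segre "{2..r}" I "\<lambda>k. nat (excess k)" chain_monomial chain_point
    by (rule segre_chain[OF pos])
  have "chain_moduli r I (star_stab n r \<theta>) = subvariety (Proj S.G) S.hyperplanes"
    using chain_moduli_hyperplanes[OF pos] semi_invariants_spanned[OF pos] by simp
  then show ?thesis using S.hyperplanes_isomorphic by simp
qed

theorem chain_moduli_empty: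
  assumes k: "k \<in> {2..r}" "card (I k) < 2"
  shows "points (chain_moduli r I (star_stab n r \<theta>)) = {}"
proof (rule ccontr)
  assume ne: "\<not> ?thesis"
  then have "points (chain_moduli_free r I (star_stab n r \<theta>)) \<noteq> {}"
    unfolding chain_moduli_def chain_moduli_free_def proj_closed_def subvariety_simps by blast
  then have pos: "excess k > 0" if "k \<in> {2..r}" for k using excess_positive that by blast
  interpret S: segre "{2..r}" I "\<lambda>k. nat (excess k)" chain_monomial chain_point
    by (rule segre_chain[OF pos])
  from ne obtain p where "p \<in> S.hyperplanes"
    using chain_moduli_hyperplanes[OF pos] by (auto simp: subvariety_simps)
  then obtain y where y: "S.admissible y" "(\<Sum>j\<in>I k. y j) = 0"
    using k(1) unfolding S.hyperplanes_def by blast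
  then obtain j where j: "j \<in> I k" "y j \<noteq> 0" using k(1) unfolding S.admissible_def by blast
  have "card (I k) = 1" using k j(1) finite_branches[of k] by (cases "card (I k)") auto
  then have "I k = {j}" using j(1) by (auto simp: card_1_singleton_iff)
  with y(2) j(2) show False by simp
qed

end


section \<open>The moduli space of chains of type (1,...,1)\<close>

theorem theorem5p5:
  fixes n r l :: nat and \<theta> :: "nat \<Rightarrow> int" and I :: "nat \<Rightarrow> nat set"
  assumes "1 \<le> r" and "r < n"
    and "\<forall>j\<in>{1..n}. 0 < \<theta> j"
    and "generic n (star_stab n r \<theta>) (star_dim r)"
    and "l = r"
    and "(\<Union>k\<in>{1..l}. I k) = {1..n}" and "disjoint_family_on I {1..l}"
  shows "(points (chain_moduli_free l I (star_stab n r \<theta>)) \<noteq> {} \<longrightarrow>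
            isomorphic (chain_moduli l I (star_stab n r \<theta>))
              (prod_space {2..l} (\<lambda>k. proj_space (int (card (I k)) - 2)))) \<and>
         ((\<exists>k\<in>{2..l}. card (I k) < 2) \<longrightarrow>
            points (chain_moduli l I (star_stab n r \<theta>)) = {})"
proof -
  interpret star_chain n r \<theta> I
    using assms by unfold_locales simp_all
  show ?thesis
    unfolding \<open>l = r\<close> using chain_moduli_isomorphic chain_moduli_empty by blast
qed

end
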